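(* Let $M$ be a generic smooth convex closed curve in $\mathbb R^2$. Then: (1) the number of cusps of the Wigner caustic of $M$ is odd and not smaller than $3$; (2) the number of cusps of the centre symmetry set (CSS) of $M$ is odd and not smaller than $3$; (3) the number of cusps of the Wigner caustic of $M$ is not greater than the number of cusps of the CSS of $M$.
   Context: A pair $a\ne b$ of points of $M$ is parallel if the tangent lines to $M$ at $a$ and $b$ are parallel. The Wigner caustic of $M$ is the set $E_{1/2}(M)$ of midpoints $\frac12(a+b)$ of parallel pairs. The centre symmetry set (CSS) of $M$ is the envelope of the family of straight lines (chords) joining the points of parallel pairs. For a generic $M$ both are curves, smooth except for ordinary cusps and possible self-intersections. "Generic" means for all curves in a suitable residual (generic) subset of the space of smooth convex closed curves with the $C^\infty$ topology. *)

theory Defs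
  imports "HOL-Analysis.Analysis"
begin

definition vderiv :: "(real \<Rightarrow> 'a::real_normed_vector) \<Rightarrow> real \<Rightarrow> 'a" where
  "vderiv f t = vector_derivative f (at t)"

definition smooth :: "(real \<Rightarrow> 'a::real_normed_vector) \<Rightarrow> bool" where
  "smooth f \<longleftrightarrow> (\<forall>k t. (vderiv ^^ k) f differentiable at t)"

abbreviation cross2 :: "real^2 \<Rightarrow> real^2 \<Rightarrow> real" where
  "cross2 v w \<equiv> det (vector [v, w] :: real^2^2)"


text \<open>
  A closed curve is given by a parametrisation of period 1, defined on all of the real line;
  the curve \<open>M\<close> as a set is \<open>range \<gamma>\<close>.
\<close>

definition smooth_loop :: "(real \<Rightarrow> real^2) \<Rightarrow> bool" where
  "smooth_loop \<gamma> \<longleftrightarrow> smooth \<gamma> \<and> (\<forall>t. \<gamma> (t + 1) = \<gamma> t)"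

text \<open>
  Regular simple closed curves that bound a convex region. Vanishing curvature is not excluded.
\<close>

definition convex_curve :: "(real \<Rightarrow> real^2) \<Rightarrow> bool" where
  "convex_curve \<gamma> \<longleftrightarrow> smooth_loop \<gamma> \<and> (\<forall>t. vderiv \<gamma> t \<noteq> 0) \<and> inj_on \<gamma> {0..<1} \<and>
     range \<gamma> = frontier (convex hull (range \<gamma>))"


definition Ck_ball :: "(real \<Rightarrow> real^2) \<Rightarrow> nat \<Rightarrow> real \<Rightarrow> (real \<Rightarrow> real^2) set" where
  "Ck_ball \<gamma> n e = {\<eta>. smooth_loop \<eta> \<and>
     (\<forall>k\<le>n. \<forall>t. dist ((vderiv ^^ k) \<eta> t) ((vderiv ^^ k) \<gamma> t) < e)}"

definition smooth_loops :: "(real \<Rightarrow> real^2) topology" where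
  "smooth_loops = topology_generated_by {Ck_ball \<gamma> n e |\<gamma> n e. smooth_loop \<gamma> \<and> 0 < e}"

definition convex_curves :: "(real \<Rightarrow> real^2) topology" where
  "convex_curves = subtopology smooth_loops {\<gamma>. convex_curve \<gamma>}"

definition residual_in :: "'a topology \<Rightarrow> 'a set \<Rightarrow> bool" where
  "residual_in X R \<longleftrightarrow> R \<subseteq> topspace X \<and>
     (\<exists>\<U>. countable \<U> \<and> (\<forall>U\<in>\<U>. openin X U \<and> X closure_of U = topspace X) \<and>
           topspace X \<inter> \<Inter>\<U> \<subseteq> R)"


text \<open>
  The tangent line at \<open>\<gamma> s\<close> has the direction \<open>span {vderiv \<gamma> s}\<close>.
\<close>

definition parallel_pair :: "(real \<Rightarrow> real^2) \<Rightarrow> real \<Rightarrow> real \<Rightarrow> bool" where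
  "parallel_pair \<gamma> s t \<longleftrightarrow> \<gamma> s \<noteq> \<gamma> t \<and> span {vderiv \<gamma> s} = span {vderiv \<gamma> t}"

definition wigner_caustic :: "(real \<Rightarrow> real^2) \<Rightarrow> (real^2) set" where
  "wigner_caustic \<gamma> = {midpoint (\<gamma> s) (\<gamma> t) |s t. parallel_pair \<gamma> s t}"

text \<open>
  A germ at \<open>0\<close> of a regular smooth one-parameter family of parallel pairs. The centre symmetry set
  is the envelope of the chords: with \<open>F \<tau> x = 0\<close> the equation of the chord line of
  parameter \<open>\<tau>\<close>, it consists of the points \<open>x\<close> where \<open>F = \<partial>F/\<partial>\<tau> = 0\<close>. Germs at \<open>0\<close> of all
  families suffice, because every parameter value can be shifted to \<open>0\<close>.
\<close>

definition parallel_family :: "(real \<Rightarrow> real^2) \<Rightarrow> (real \<Rightarrow> real) \<Rightarrow> (real \<Rightarrow> real) \<Rightarrow> bool" where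
  "parallel_family \<gamma> u v \<longleftrightarrow> smooth u \<and> smooth v \<and>
     (\<forall>\<^sub>F \<tau> in nhds 0. parallel_pair \<gamma> (u \<tau>) (v \<tau>)) \<and> (vderiv u 0 \<noteq> 0 \<or> vderiv v 0 \<noteq> 0)"

definition chord_eq :: "(real \<Rightarrow> real^2) \<Rightarrow> (real \<Rightarrow> real) \<Rightarrow> (real \<Rightarrow> real) \<Rightarrow> real \<Rightarrow> real^2 \<Rightarrow> real" where
  "chord_eq \<gamma> u v \<tau> x = cross2 (x - \<gamma> (u \<tau>)) (\<gamma> (v \<tau>) - \<gamma> (u \<tau>))"

definition centre_symmetry_set :: "(real \<Rightarrow> real^2) \<Rightarrow> (real^2) set" where
  "centre_symmetry_set \<gamma> = {x. \<exists>u v. parallel_family \<gamma> u v \<and>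
     chord_eq \<gamma> u v 0 x = 0 \<and> ((\<lambda>\<tau>. chord_eq \<gamma> u v \<tau> x) has_real_derivative 0) (at 0)}"

text \<open>
  Points at which some branch of the planar set \<open>E\<close> has an ordinary (semicubical) cusp: a branch
  is a smooth curve germ \<open>\<delta>\<close> contained in \<open>E\<close>, and an ordinary cusp means that \<open>\<delta>' = 0\<close> while
  \<open>\<delta>''\<close> and \<open>\<delta>'''\<close> are linearly independent. Other branches of \<open>E\<close> may pass through the point.
\<close>

definition cusps :: "(real^2) set \<Rightarrow> (real^2) set" where
  "cusps E = {x. \<exists>\<delta>. smooth \<delta> \<and> (\<forall>\<^sub>F t in nhds 0. \<delta> t \<in> E) \<and> \<delta> 0 = x \<and> vderiv \<delta> 0 = 0 \<and>
     cross2 ((vderiv ^^ 2) \<delta> 0) ((vderiv ^^ 3) \<delta> 0) \<noteq> 0}"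

end

theory Submission
  imports Defs
begin

text \<open>
  A convex curve whose curvature does not vanish is parametrised by its tangent angle \<open>\<theta>\<close>, so
  that \<open>\<Gamma>' = \<rho> e\<close> with the radius of curvature \<open>\<rho> > 0\<close> and \<open>e = (cos \<theta>, sin \<theta>)\<close>. The parallel
  pairs are the pairs of angles \<open>\<theta>\<close> and \<open>\<theta> + \<pi>\<close>. Let \<open>r\<close> be the function \<open>r \<theta> = \<rho> (\<theta> + \<pi>)\<close>
  and \<open>D \<theta> = \<Gamma> (\<theta> + \<pi>) - \<Gamma> \<theta>\<close> the chord.

  The midpoint \<open>m\<close> of the chord satisfies \<open>m' = (\<rho> - r) / 2 e\<close>. The chord touches the envelope of
  all chords in the point \<open>c = \<Gamma> + \<rho> / (\<rho> + r) D\<close>, and \<open>c' = w / (\<rho> + r)\<^sup>2 D\<close> with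
  \<open>w = \<rho>' r - \<rho> r'\<close>. Thus both curves are fronts: they move in a direction that keeps
  turning, with a speed that changes sign over half a turn. Where the speed has a simple zero the
  front has an ordinary cusp, and no smooth branch through regular points has one
  (\<open>cusps_of_front\<close>). If the zeros are simple and different zeros give different points, the
  number of cusps is the number of zeros per half turn, which is odd because of the change of sign.
  A caustic with a single cusp could not close up, since it would move to one side of the
  tangent at the cusp; so it has at least three. Up to a positive factor, \<open>w\<close> is the derivative of
  \<open>(\<rho> - r) / (\<rho> + r)\<close>, and Rolle's theorem yields at least as many zeros of \<open>w\<close> as
  of \<open>\<rho> - r\<close>. This proves the assertions for curves subject to four
  conditions: both speeds have simple zeros only, and both fronts separate their cusps
  (\<open>cusp_numbers_of_angle_form\<close>).

  It remains to see that the four conditions, together with nonvanishing curvature, are residual.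
  Their violations are closed conditions on the jets of the curve at one or two parallel pairs, so
  that by compactness they are avoided by open sets of curves, except that
  different cusps have to be separated by a definite angle first (\<open>avoiding_open\<close>); this
  leads to countably many open sets.

  Density is obtained in steps. A radial contraction bends all straight pieces
  of a convex curve. The result has positive curvature and its tangent still turns exactly once, so it
  is convex
  (\<open>has_angle_form_dense\<close>). From then on curves are perturbed with fixed tangent angle,
  \<open>\<Gamma> + \<epsilon> W\<close> with \<open>W'\<close> a multiple of \<open>e\<close>. For the simple zeros there are two free coefficients, and
  the bad pairs of coefficients form a smooth curve in the plane, a null set
  (\<open>simple_gaps_dense\<close>, \<open>simple_wronskian_dense\<close>). For the separation of cusps there is a perturbation
  that keeps the angles of all cusps and translates different cusps by
  different vectors (\<open>separating_displacement\<close>); only countably many sizes of it are bad.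
\<close>

section \<open>Smooth functions of a real variable\<close>

lemma smooth_step:
  "smooth f \<longleftrightarrow> (\<forall>t. f differentiable at t) \<and> smooth (vderiv f)"
proof -
  have "(vderiv ^^ Suc k) f = (vderiv ^^ k) (vderiv f)" for k
    by (simp add: funpow_swap1)
  then show ?thesis
    unfolding smooth_def by (metis funpow_0 not0_implies_Suc)
qed

lemma smooth_has_vderiv:
  "smooth f \<Longrightarrow> (f has_vector_derivative vderiv f t) (at t)"
  using smooth_step[of f] by (simp add: vderiv_def vector_derivative_works)

lemma smooth_vderiv: "smooth f \<Longrightarrow> smooth (vderiv f)"
  using smooth_step by blast

lemma smooth_funpow_vderiv: "smooth f \<Longrightarrow> smooth ((vderiv ^^ k) f)"
  by (induction k) (auto intro: smooth_vderiv)

lemma vderiv_eqI: "(\<And>t. (f has_vector_derivative f' t) (at t)) \<Longrightarrow> vderiv f = f'"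
  unfolding vderiv_def by (auto intro: vector_derivative_at)

lemma vderiv_at: "(f has_vector_derivative d) (at t) \<Longrightarrow> vderiv f t = d"
  unfolding vderiv_def by (rule vector_derivative_at)

lemma smooth_has_real_derivative:
  "smooth (f :: real \<Rightarrow> real) \<Longrightarrow> (f has_real_derivative vderiv f t) (at t)"
  using smooth_has_vderiv by (simp add: has_real_derivative_iff_has_vector_derivative)

lemma vderiv_real_eqI:
  "(\<And>t. (f has_real_derivative f' t) (at t)) \<Longrightarrow> vderiv f = f'"
  by (rule vderiv_eqI) (simp add: has_real_derivative_iff_has_vector_derivative)

lemma smooth_continuous: "smooth f \<Longrightarrow> continuous_on S f"
  using smooth_has_vderiv
  by (meson continuous_at_imp_continuous_on has_vector_derivative_continuous)

lemma smooth_isCont: "smooth f \<Longrightarrow> isCont f t"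
  using smooth_has_vderiv has_vector_derivative_continuous by blast

text \<open>
  Smoothness is a coinductive property: it suffices to exhibit a class of functions that is
  closed under differentiation.
\<close>

lemma smooth_coinduct:
  assumes "C f"
    and step: "\<And>f. C f \<Longrightarrow> \<exists>f'. (\<forall>t. (f has_vector_derivative f' t) (at t)) \<and> C f'"
  shows "smooth f"
proof -
  have C: "C ((vderiv ^^ k) f)" for k
  proof (induction k)
    case (Suc k)
    then obtain f' where "\<forall>t. ((vderiv ^^ k) f has_vector_derivative f' t) (at t)" "C f'"
      using step by blast
    then show ?case
      using vderiv_eqI[of "(vderiv ^^ k) f" f'] by simp
  qed (simp add: assms)
  show ?thesis
    unfolding smooth_def
  proof (intro allI)
    fix k t
    show "(vderiv ^^ k) f differentiable at t"
      using step[OF C[of k]] by (auto simp: differentiable_def has_vector_derivative_def)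
  qed
qed

text \<open>
  All closure properties of smooth real functions follow at once from the observation that the
  following inductively generated class is closed under differentiation. The rule for solutions
  of autonomous differential equations covers inverse functions.
\<close>

inductive smooth_generated :: "(real \<Rightarrow> real) \<Rightarrow> bool" where
  base: "smooth f \<Longrightarrow> smooth_generated f"
| const: "smooth_generated (\<lambda>_. c)"
| ident: "smooth_generated (\<lambda>x. x)"
| sine: "smooth_generated (\<lambda>x. sin x)"
| cosine: "smooth_generated (\<lambda>x. cos x)"
| add: "smooth_generated f \<Longrightarrow> smooth_generated g \<Longrightarrow> smooth_generated (\<lambda>x. f x + g x)"
| mult: "smooth_generated f \<Longrightarrow> smooth_generated g \<Longrightarrow> smooth_generated (\<lambda>x. f x * g x)"
| comp: "smooth_generated f \<Longrightarrow> smooth_generated g \<Longrightarrow> smooth_generated (\<lambda>x. f (g x))"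
| inv: "smooth_generated f \<Longrightarrow> (\<And>x. f x \<noteq> 0) \<Longrightarrow> smooth_generated (\<lambda>x. inverse (f x))"
| ode: "smooth_generated F \<Longrightarrow> (\<And>x. (g has_real_derivative F (g x)) (at x)) \<Longrightarrow>
    smooth_generated g"
| antideriv: "smooth_generated F \<Longrightarrow> (\<And>x. (g has_real_derivative F x) (at x)) \<Longrightarrow>
    smooth_generated g"

lemma smooth_generated_deriv:
  "smooth_generated f \<Longrightarrow> \<exists>f'. (\<forall>x. (f has_real_derivative f' x) (at x)) \<and> smooth_generated f'"
proof (induction rule: smooth_generated.induct)
  case (base f)
  then show ?case
    using smooth_has_real_derivative smooth_vderiv smooth_generated.base by blast
next
  case (const c)
  show ?case
    by (rule exI[of _ "\<lambda>_. 0"]) (auto intro: smooth_generated.const)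
next
  case ident
  show ?case
    by (rule exI[of _ "\<lambda>_. 1"]) (auto intro: smooth_generated.const)
next
  case sine
  show ?case
    by (rule exI[of _ "\<lambda>x. cos x"]) (auto intro: smooth_generated.cosine DERIV_sin)
next
  case cosine
  have "\<forall>x. (cos has_real_derivative -1 * sin x) (at x)"
    by (auto intro!: derivative_eq_intros)
  moreover have "smooth_generated (\<lambda>x. -1 * sin x)"
    by (intro smooth_generated.mult smooth_generated.const smooth_generated.sine)
  ultimately show ?case by (intro exI[of _ "\<lambda>x. -1 * sin x"]) simp
next
  case (add f g)
  then obtain f' g' where
    "\<forall>x. (f has_real_derivative f' x) (at x)" "smooth_generated f'"
    "\<forall>x. (g has_real_derivative g' x) (at x)" "smooth_generated g'" by blast
  then show ?case
    by (intro exI[of _ "\<lambda>x. f' x + g' x"]) (auto intro!: derivative_eq_intros smooth_generated.add)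
next
  case (mult f g)
  then obtain f' g' where d:
    "\<forall>x. (f has_real_derivative f' x) (at x)" "smooth_generated f'"
    "\<forall>x. (g has_real_derivative g' x) (at x)" "smooth_generated g'" by blast
  have "\<forall>x. ((\<lambda>x. f x * g x) has_real_derivative f' x * g x + f x * g' x) (at x)"
    using d by (auto intro!: derivative_eq_intros)
  moreover have "smooth_generated (\<lambda>x. f' x * g x + f x * g' x)"
    using d mult by (intro smooth_generated.add smooth_generated.mult)
  ultimately show ?case by (intro exI[of _ "\<lambda>x. f' x * g x + f x * g' x"] conjI)
next
  case (comp f g)
  then obtain f' g' where d:
    "\<forall>x. (f has_real_derivative f' x) (at x)" "smooth_generated f'"
    "\<forall>x. (g has_real_derivative g' x) (at x)" "smooth_generated g'" by blast
  have "\<forall>x. ((\<lambda>x. f (g x)) has_real_derivative f' (g x) * g' x) (at x)"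
  proof
    fix x
    show "((\<lambda>x. f (g x)) has_real_derivative f' (g x) * g' x) (at x)"
      by (rule DERIV_chain2[of f "f' (g x)" g x]) (use d in auto)
  qed
  moreover have "smooth_generated (\<lambda>x. f' (g x) * g' x)"
    using d comp by (intro smooth_generated.mult smooth_generated.comp[of f' g])
  ultimately show ?case by (intro exI[of _ "\<lambda>x. f' (g x) * g' x"] conjI)
next
  case (inv f)
  then obtain f' where d:
    "\<forall>x. (f has_real_derivative f' x) (at x)" "smooth_generated f'" by blast
  have "\<forall>x. ((\<lambda>x. inverse (f x)) has_real_derivative
          -1 * f' x * (inverse (f x) * inverse (f x))) (at x)"
    using d inv by (auto intro!: derivative_eq_intros)
  moreover have "smooth_generated (\<lambda>x. -1 * f' x * (inverse (f x) * inverse (f x)))"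
    using d inv by (intro smooth_generated.mult smooth_generated.inv smooth_generated.const)
  ultimately show ?case by (intro exI[of _ "\<lambda>x. -1 * f' x * (inverse (f x) * inverse (f x))"] conjI)
next
  case (ode F g)
  have "smooth_generated (\<lambda>x. F (g x))"
    using ode.hyps by (intro smooth_generated.comp[of F g]) (auto intro: smooth_generated.ode)
  then show ?case using ode.hyps by (intro exI[of _ "\<lambda>x. F (g x)"] conjI allI)
next
  case (antideriv F g)
  then show ?case by blast
qed

lemma smooth_generated_smooth: "smooth_generated f \<Longrightarrow> smooth f"
  by (erule smooth_coinduct) (simp add: smooth_generated_deriv flip: has_real_derivative_iff_has_vector_derivative)

named_theorems smooth_intros

lemma smooth_const [smooth_intros]: "smooth (\<lambda>_. c :: real)"
  by (intro smooth_generated_smooth smooth_generated.const)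

lemma smooth_ident [smooth_intros]: "smooth (\<lambda>x :: real. x)"
  by (intro smooth_generated_smooth smooth_generated.ident)

lemma smooth_add [smooth_intros]:
  "smooth f \<Longrightarrow> smooth g \<Longrightarrow> smooth (\<lambda>x. f x + g x :: real)"
  by (rule smooth_generated_smooth) (intro smooth_generated.add smooth_generated.base)

lemma smooth_mult [smooth_intros]:
  "smooth f \<Longrightarrow> smooth g \<Longrightarrow> smooth (\<lambda>x. f x * g x :: real)"
  by (rule smooth_generated_smooth) (intro smooth_generated.mult smooth_generated.base)

lemma smooth_compose:
  "smooth f \<Longrightarrow> smooth g \<Longrightarrow> smooth (\<lambda>x. f (g x :: real) :: real)"
  by (rule smooth_generated_smooth) (intro smooth_generated.comp[of f g] smooth_generated.base)

lemma smooth_sin [smooth_intros]: "smooth f \<Longrightarrow> smooth (\<lambda>x. sin (f x :: real))"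
  using smooth_compose[OF smooth_generated_smooth[OF smooth_generated.sine]] by simp

lemma smooth_cos [smooth_intros]: "smooth f \<Longrightarrow> smooth (\<lambda>x. cos (f x :: real))"
  using smooth_compose[OF smooth_generated_smooth[OF smooth_generated.cosine]] by simp

lemma smooth_minus [smooth_intros]: "smooth f \<Longrightarrow> smooth (\<lambda>x. - f x :: real)"
  using smooth_mult[OF smooth_const[of "-1"]] by simp

lemma smooth_diff [smooth_intros]:
  "smooth f \<Longrightarrow> smooth g \<Longrightarrow> smooth (\<lambda>x. f x - g x :: real)"
  using smooth_add[of f "\<lambda>x. - g x"] smooth_minus by simp

lemma smooth_power [smooth_intros]: "smooth f \<Longrightarrow> smooth (\<lambda>x. f x ^ n :: real)"
  by (induction n) (simp_all add: smooth_const smooth_mult)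

lemma smooth_divide [smooth_intros]:
  "smooth f \<Longrightarrow> smooth g \<Longrightarrow> (\<And>x. g x \<noteq> 0) \<Longrightarrow> smooth (\<lambda>x. f x / g x :: real)"
  unfolding divide_inverse
  by (rule smooth_mult, assumption, rule smooth_generated_smooth)
    (intro smooth_generated.inv smooth_generated.base)

lemma smooth_shift:
  "smooth f \<Longrightarrow> smooth (\<lambda>x. f (x + c) :: real)"
  by (rule smooth_compose[of f]) (assumption | intro smooth_intros)+

lemma smooth_vderiv_real [smooth_intros]: "smooth f \<Longrightarrow> smooth (\<lambda>x. vderiv f x :: real)"
  by (simp add: smooth_vderiv)

lemma smooth_ode:
  "smooth F \<Longrightarrow> (\<And>x. (g has_real_derivative F (g x)) (at x)) \<Longrightarrow> smooth g"
  by (rule smooth_generated_smooth[OF smooth_generated.ode[OF smooth_generated.base]])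

lemma smooth_antideriv:
  "smooth F \<Longrightarrow> (\<And>x. (g has_real_derivative F x) (at x)) \<Longrightarrow> smooth g"
  by (rule smooth_generated_smooth[OF smooth_generated.antideriv[OF smooth_generated.base]])

text \<open>
  Tangent angles, and curves with prescribed radius of curvature, arise as antiderivatives.
\<close>

lemma antiderivative_exists:
  fixes f :: "real \<Rightarrow> real"
  assumes "continuous_on UNIV f"
  shows "\<exists>g. (\<forall>x. (g has_real_derivative f x) (at x)) \<and> g a = c"
proof -
  obtain g where g: "\<And>x. (g has_vector_derivative f x) (at x)"
  proof -
    define g where "g x = (if 0 \<le> x then integral {0..x} f else - integral {x..0} f)" for x
    have "(g has_vector_derivative f x) (at x)" for x
    proof -
      define b where "b = \<bar>x\<bar> + 1"
      have c: "continuous_on {-b..b} f" using assms continuous_on_subset by blast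
      have int: "f integrable_on {u..v}" for u v
        using assms continuous_on_subset integrable_continuous_interval by blast
      have eq: "g y = integral {-b..y} f - integral {-b..0} f" if "y \<in> {-b<..<b}" for y
      proof (cases "0 \<le> y")
        case True
        then show ?thesis
          using Henstock_Kurzweil_Integration.integral_combine[of "-b" 0 y f] that int
          by (simp add: g_def b_def)
      next
        case False
        then show ?thesis
          using Henstock_Kurzweil_Integration.integral_combine[of "-b" y 0 f] that int
          by (simp add: g_def b_def)
      qed
      have "((\<lambda>y. integral {-b..y} f) has_vector_derivative f x) (at x within {-b..b})"
        by (rule integral_has_vector_derivative[OF c]) (auto simp: b_def)
      moreover have "x \<in> interior {-b..b}"
        unfolding interior_atLeastAtMost_real b_def greaterThanLessThan_iff by linarith
      ultimately have "((\<lambda>y. integral {-b..y} f) has_vector_derivative f x) (at x)"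
        by (simp only: at_within_interior)
      then have "((\<lambda>y. integral {-b..y} f - integral {-b..0} f) has_vector_derivative f x) (at x)"
        using has_vector_derivative_diff[OF _ has_vector_derivative_const] by (metis diff_zero)
      then show ?thesis
        by (rule has_vector_derivative_transform_within_open[of _ _ _ "{-b<..<b}"])
          (use eq in \<open>auto simp: b_def\<close>)
    qed
    then show ?thesis by (rule that)
  qed
  have "\<forall>x. ((\<lambda>x. g x - g a + c) has_real_derivative f x) (at x)"
    using g unfolding has_real_derivative_iff_has_vector_derivative[symmetric]
    by (auto intro!: derivative_eq_intros)
  then show ?thesis by (intro exI[of _ "\<lambda>x. g x - g a + c"]) auto
qed

subsection \<open>Plane vectors\<close>

lemma cross2_eq: "cross2 v w = v $ 1 * w $ 2 - v $ 2 * w $ 1"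
  by (simp add: det_2)

lemma vec2_eq_iff: "(v :: real^2) = w \<longleftrightarrow> v $ 1 = w $ 1 \<and> v $ 2 = w $ 2"
  by (simp add: vec_eq_iff forall_2)

lemma inner2_eq: "(v :: real^2) \<bullet> w = v $ 1 * w $ 1 + v $ 2 * w $ 2"
  by (simp add: inner_vec_def sum_2)

lemma has_vector_derivative_vec2:
  "(f has_vector_derivative (d :: real^2)) F \<longleftrightarrow>
   ((\<lambda>t. f t $ 1) has_vector_derivative d $ 1) F \<and> ((\<lambda>t. f t $ 2) has_vector_derivative d $ 2) F"
proof
  assume f: "(f has_vector_derivative d) F"
  have "((\<lambda>t. f t $ i) has_vector_derivative d $ i) F" for i
    using bounded_linear.has_vector_derivative[OF bounded_linear_vec_nth f] .
  then show "((\<lambda>t. f t $ 1) has_vector_derivative d $ 1) F \<and>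
      ((\<lambda>t. f t $ 2) has_vector_derivative d $ 2) F" by blast
next
  assume f: "((\<lambda>t. f t $ 1) has_vector_derivative d $ 1) F \<and>
      ((\<lambda>t. f t $ 2) has_vector_derivative d $ 2) F"
  have "((\<lambda>t. (f t $ 1) *\<^sub>R axis 1 1 + (f t $ 2) *\<^sub>R axis 2 1 :: real^2) has_vector_derivative
      (d $ 1) *\<^sub>R axis 1 1 + (d $ 2) *\<^sub>R axis 2 1) F"
    using f by (intro has_vector_derivative_add
        bounded_linear.has_vector_derivative[OF bounded_linear_scaleR_left]) auto
  moreover have "v = (v $ 1) *\<^sub>R axis 1 1 + (v $ 2) *\<^sub>R axis 2 1" for v :: "real^2"
    by (simp add: vec2_eq_iff axis_def)
  ultimately show "(f has_vector_derivative d) F" by simp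
qed

lemma has_real_derivative_vec2:
  "(f has_vector_derivative (d :: real^2)) F \<longleftrightarrow>
   ((\<lambda>t. f t $ 1) has_real_derivative d $ 1) F \<and> ((\<lambda>t. f t $ 2) has_real_derivative d $ 2) F"
  unfolding has_vector_derivative_vec2 has_real_derivative_iff_has_vector_derivative ..

lemma smooth_vec2:
  fixes f :: "real \<Rightarrow> real^2"
  shows "smooth f \<longleftrightarrow> smooth (\<lambda>t. f t $ 1) \<and> smooth (\<lambda>t. f t $ 2)"
proof
  assume f: "smooth f"
  have "smooth (\<lambda>t. f t $ i)" for i
  proof (rule smooth_coinduct[where C = "\<lambda>h. \<exists>f :: real \<Rightarrow> real^2. smooth f \<and> h = (\<lambda>t. f t $ i)"])
    show "\<exists>g. smooth g \<and> (\<lambda>t. f t $ i) = (\<lambda>t. g t $ i)" using f by blast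
  next
    fix h assume "\<exists>f :: real \<Rightarrow> real^2. smooth f \<and> h = (\<lambda>t. f t $ i)"
    then obtain g :: "real \<Rightarrow> real^2" where g: "smooth g" "h = (\<lambda>t. g t $ i)" by blast
    then have "\<forall>t. (h has_vector_derivative vderiv g t $ i) (at t)"
      using bounded_linear.has_vector_derivative[OF bounded_linear_vec_nth smooth_has_vderiv] by blast
    then show "\<exists>f'. (\<forall>t. (h has_vector_derivative f' t) (at t)) \<and>
        (\<exists>f :: real \<Rightarrow> real^2. smooth f \<and> f' = (\<lambda>t. f t $ i))"
      using smooth_vderiv[OF g(1)] by (intro exI[of _ "\<lambda>t. vderiv g t $ i"]) auto
  qed
  then show "smooth (\<lambda>t. f t $ 1) \<and> smooth (\<lambda>t. f t $ 2)" by blast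
next
  assume f: "smooth (\<lambda>t. f t $ 1) \<and> smooth (\<lambda>t. f t $ 2)"
  show "smooth f"
  proof (rule smooth_coinduct[where C = "\<lambda>f :: real \<Rightarrow> real^2. smooth (\<lambda>t. f t $ 1) \<and> smooth (\<lambda>t. f t $ 2)"])
    fix f :: "real \<Rightarrow> real^2"
    assume f: "smooth (\<lambda>t. f t $ 1) \<and> smooth (\<lambda>t. f t $ 2)"
    let ?d = "\<lambda>t. vector [vderiv (\<lambda>t. f t $ 1) t, vderiv (\<lambda>t. f t $ 2) t] :: real^2"
    have "\<forall>t. (f has_vector_derivative ?d t) (at t)"
      using f by (simp add: has_vector_derivative_vec2 smooth_has_vderiv)
    moreover have "smooth (\<lambda>t. ?d t $ 1) \<and> smooth (\<lambda>t. ?d t $ 2)"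
      using f by (simp add: smooth_vderiv)
    ultimately show "\<exists>f'. (\<forall>t. (f has_vector_derivative f' t) (at t)) \<and>
        smooth (\<lambda>t. f' t $ 1) \<and> smooth (\<lambda>t. f' t $ 2)" by (intro exI[of _ ?d]) simp
  qed (use f in blast)
qed

lemma smooth_vec_nth [smooth_intros]:
  "smooth (f :: real \<Rightarrow> real^2) \<Longrightarrow> smooth (\<lambda>t. f t $ i)"
  using smooth_vec2[of f] exhaust_2[of i] by auto

lemma smooth_vec_compose:
  fixes f :: "real \<Rightarrow> real^2"
  shows "smooth f \<Longrightarrow> smooth g \<Longrightarrow> smooth (\<lambda>x. f (g x))"
  unfolding smooth_vec2[of f] smooth_vec2[of "\<lambda>x. f (g x)"]
  using smooth_compose[of "\<lambda>t. f t $ 1" g] smooth_compose[of "\<lambda>t. f t $ 2" g] by simp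

lemma smooth_vec_add [smooth_intros]:
  fixes f g :: "real \<Rightarrow> real^2"
  shows "smooth f \<Longrightarrow> smooth g \<Longrightarrow> smooth (\<lambda>x. f x + g x)"
  by (simp add: smooth_vec2[of f] smooth_vec2[of g] smooth_vec2[of "\<lambda>x. f x + g x"] smooth_add)

lemma smooth_vec_scaleR [smooth_intros]:
  fixes g :: "real \<Rightarrow> real^2"
  shows "smooth f \<Longrightarrow> smooth g \<Longrightarrow> smooth (\<lambda>x. f x *\<^sub>R g x)"
  by (simp add: smooth_vec2[of g] smooth_vec2[of "\<lambda>x. f x *\<^sub>R g x"] smooth_mult)

lemma smooth_vec_const [smooth_intros]: "smooth (\<lambda>_. c :: real^2)"
  by (simp add: smooth_vec2[of "\<lambda>_. c"] smooth_const)

lemma smooth_vec_diff [smooth_intros]: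
  fixes f g :: "real \<Rightarrow> real^2"
  shows "smooth f \<Longrightarrow> smooth g \<Longrightarrow> smooth (\<lambda>x. f x - g x)"
  by (simp add: smooth_vec2[of f] smooth_vec2[of g] smooth_vec2[of "\<lambda>x. f x - g x"] smooth_diff)

lemma smooth_vec_shift:
  "smooth (f :: real \<Rightarrow> real^2) \<Longrightarrow> smooth (\<lambda>x. f (x + c))"
  by (rule smooth_vec_compose[of f]) (assumption | intro smooth_intros)+

lemma smooth_inner [smooth_intros]:
  fixes f g :: "real \<Rightarrow> real^2"
  shows "smooth f \<Longrightarrow> smooth g \<Longrightarrow> smooth (\<lambda>x. f x \<bullet> g x)"
  by (simp add: inner2_eq smooth_intros)

lemma smooth_cross2 [smooth_intros]:
  fixes f g :: "real \<Rightarrow> real^2"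
  shows "smooth f \<Longrightarrow> smooth g \<Longrightarrow> smooth (\<lambda>x. cross2 (f x) (g x))"
  by (simp add: cross2_eq smooth_intros)

lemma cross2_has_real_derivative:
  assumes "(f has_vector_derivative f') (at t within S)" "(g has_vector_derivative g') (at t within S)"
  shows "((\<lambda>x. cross2 (f x) (g x)) has_real_derivative cross2 f' (g t) + cross2 (f t) g') (at t within S)"
  using assms unfolding has_real_derivative_vec2 cross2_eq
  by (auto intro!: derivative_eq_intros simp: algebra_simps)

lemma inner2_has_real_derivative:
  fixes f g :: "real \<Rightarrow> real^2"
  assumes "(f has_vector_derivative f') (at t within S)" "(g has_vector_derivative g') (at t within S)"
  shows "((\<lambda>x. f x \<bullet> g x) has_real_derivative f' \<bullet> g t + f t \<bullet> g') (at t within S)"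
  using assms unfolding has_real_derivative_vec2 inner2_eq
  by (auto intro!: derivative_eq_intros simp: algebra_simps)

lemma cross2_both_zero:
  assumes "cross2 v y = 0" "cross2 w y = 0" "cross2 v w \<noteq> 0"
  shows "y = 0"
proof -
  have "cross2 v w * y $ 1 = 0" "cross2 v w * y $ 2 = 0"
    using assms(1,2) unfolding cross2_eq by algebra+
  then show ?thesis using assms(3) by (simp add: vec2_eq_iff)
qed

definition unit_dir :: "real \<Rightarrow> real^2" where
  "unit_dir \<theta> = vector [cos \<theta>, sin \<theta>]"

lemma unit_dir_nth [simp]: "unit_dir \<theta> $ 1 = cos \<theta>" "unit_dir \<theta> $ 2 = sin \<theta>"
  by (simp_all add: unit_dir_def)

lemma unit_dir_pi [simp]: "unit_dir (\<theta> + pi) = - unit_dir \<theta>"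
  by (simp add: vec2_eq_iff)

lemma unit_dir_2pi [simp]: "unit_dir (\<theta> + 2 * pi) = unit_dir \<theta>"
  by (simp add: vec2_eq_iff)

lemma cross2_unit_dir: "cross2 (unit_dir a) (unit_dir b) = sin (b - a)"
  by (simp add: cross2_eq sin_diff algebra_simps)

lemma inner_unit_dir: "unit_dir a \<bullet> unit_dir b = cos (b - a)"
  by (simp add: inner2_eq cos_diff algebra_simps)

lemma norm_unit_dir [simp]: "norm (unit_dir a) = 1"
  by (simp add: norm_eq_sqrt_inner inner_unit_dir)

lemma unit_dir_nonzero [simp]: "unit_dir a \<noteq> 0"
  using norm_unit_dir[of a] by force

lemma smooth_unit_dir [smooth_intros]: "smooth f \<Longrightarrow> smooth (\<lambda>x. unit_dir (f x))"
  by (simp add: smooth_vec2[of "\<lambda>x. unit_dir (f x)"] smooth_intros)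

lemma unit_dir_has_vector_derivative:
  "(f has_real_derivative f') (at t within S) \<Longrightarrow>
   ((\<lambda>x. unit_dir (f x)) has_vector_derivative f' *\<^sub>R unit_dir (f t + pi / 2)) (at t within S)"
  unfolding has_real_derivative_vec2
  by (auto intro!: derivative_eq_intros simp: cos_add sin_add)

section \<open>Smooth loops and their topology\<close>

lemma periodic_int_multiple:
  fixes f :: "real \<Rightarrow> 'b"
  assumes "\<And>t. f (t + P) = f t"
  shows "f (t + of_int k * P) = f t"
proof -
  have nat: "f (t + real n * P) = f t" for n t
  proof (induction n)
    case (Suc n)
    have "f (t + real (Suc n) * P) = f ((t + real n * P) + P)" by (simp add: algebra_simps)
    then show ?case using assms Suc by simp
  qed simp
  show ?thesis
  proof (cases "0 \<le> k")
    case True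
    then show ?thesis using nat[of t "nat k"] by simp
  next
    case False
    then show ?thesis using nat[of "t + of_int k * P" "nat (- k)"] by (simp add: algebra_simps)
  qed
qed

lemma shift_into_period:
  fixes t P a :: real
  assumes "0 < P"
  obtains k :: int where "a \<le> t + of_int k * P" "t + of_int k * P < a + P"
proof
  let ?k = "- \<lfloor>(t - a) / P\<rfloor>"
  have "of_int \<lfloor>(t - a) / P\<rfloor> \<le> (t - a) / P" "(t - a) / P < of_int \<lfloor>(t - a) / P\<rfloor> + 1"
    by linarith+
  then have "of_int \<lfloor>(t - a) / P\<rfloor> * P \<le> t - a" "t - a < (of_int \<lfloor>(t - a) / P\<rfloor> + 1) * P"
    unfolding pos_le_divide_eq[OF assms] pos_divide_less_eq[OF assms] .
  then show "a \<le> t + of_int ?k * P" "t + of_int ?k * P < a + P"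
    by (simp_all add: algebra_simps)
qed

lemma periodic_bounded:
  fixes f :: "real \<Rightarrow> 'b::real_normed_vector"
  assumes "0 < P" "\<And>t. f (t + P) = f t" "continuous_on UNIV f"
  obtains B where "0 < B" "\<And>t. norm (f t) \<le> B"
proof -
  have "compact (f ` {0..P})"
    using assms(3) continuous_on_subset by (intro compact_continuous_image) auto
  then obtain B where B: "0 < B" "\<And>t. t \<in> {0..P} \<Longrightarrow> norm (f t) \<le> B"
    using compact_imp_bounded[of "f ` {0..P}"] by (auto simp: bounded_pos)
  have "norm (f t) \<le> B" for t
  proof -
    obtain k :: int where "0 \<le> t + of_int k * P" "t + of_int k * P < 0 + P"
      using shift_into_period[OF assms(1)] by blast
    then show ?thesis using B(2)[of "t + of_int k * P"] periodic_int_multiple[of f P t k] assms(2)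
      by auto
  qed
  then show ?thesis using B that by blast
qed

lemma vderiv_periodic:
  assumes "smooth f" "\<And>t. f (t + P) = f t"
  shows "vderiv f (t + P) = vderiv f t"
proof -
  have "((\<lambda>x. f (x + P)) has_vector_derivative vderiv f (t + P)) (at t)"
    using vector_diff_chain_at[of "\<lambda>x. x + P" 1 t f "vderiv f (t + P)"]
      smooth_has_vderiv[OF assms(1), of "t + P"]
    by (simp add: o_def has_vector_derivative_add_const)
  then have "(f has_vector_derivative vderiv f (t + P)) (at t)" using assms(2) by simp
  then show ?thesis by (rule vderiv_at[symmetric])
qed

lemma funpow_vderiv_periodic:
  assumes "smooth f" "\<And>t. f (t + P) = f t"
  shows "(vderiv ^^ k) f (t + P) = (vderiv ^^ k) f t"
proof (induction k arbitrary: t)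
  case (Suc k)
  then show ?case
    using vderiv_periodic[OF smooth_funpow_vderiv[OF assms(1), of k] Suc.IH, of t] by simp
qed (simp add: assms)

lemma smooth_loop_smooth: "smooth_loop \<gamma> \<Longrightarrow> smooth \<gamma>"
  by (simp add: smooth_loop_def)

lemma smooth_loop_bounded:
  assumes "smooth_loop \<gamma>"
  obtains B where "0 < B" "\<And>t. norm ((vderiv ^^ k) \<gamma> t) \<le> B"
proof (rule periodic_bounded[of 1 "(vderiv ^^ k) \<gamma>"])
  show "(vderiv ^^ k) \<gamma> (t + 1) = (vderiv ^^ k) \<gamma> t" for t
    using assms funpow_vderiv_periodic[of \<gamma> 1] by (simp add: smooth_loop_def)
  show "continuous_on UNIV ((vderiv ^^ k) \<gamma>)"
    using assms smooth_continuous smooth_funpow_vderiv smooth_loop_smooth by blast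
qed (auto intro: that)

lemma vderiv_lincomb:
  fixes f g h :: "real \<Rightarrow> real^2"
  assumes "smooth f" "smooth g" "smooth h"
  shows "(vderiv ^^ k) (\<lambda>t. f t + x *\<^sub>R g t + y *\<^sub>R h t) =
    (\<lambda>t. (vderiv ^^ k) f t + x *\<^sub>R (vderiv ^^ k) g t + y *\<^sub>R (vderiv ^^ k) h t)"
proof (induction k)
  case (Suc k)
  have *: "((\<lambda>t. (vderiv ^^ k) f t + x *\<^sub>R (vderiv ^^ k) g t + y *\<^sub>R (vderiv ^^ k) h t) has_vector_derivative
      vderiv ((vderiv ^^ k) f) t + x *\<^sub>R vderiv ((vderiv ^^ k) g) t + y *\<^sub>R vderiv ((vderiv ^^ k) h) t) (at t)" for t
    using smooth_has_vderiv[OF smooth_funpow_vderiv[OF assms(1)]]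
      smooth_has_vderiv[OF smooth_funpow_vderiv[OF assms(2)]]
      smooth_has_vderiv[OF smooth_funpow_vderiv[OF assms(3)]]
    by (intro has_vector_derivative_add
        bounded_linear.has_vector_derivative[OF bounded_linear_scaleR_right]) auto
  show ?case using vderiv_eqI[OF *] Suc by simp
qed simp

lemma smooth_loop_lincomb:
  assumes "smooth_loop f" "smooth_loop g" "smooth_loop h"
  shows "smooth_loop (\<lambda>t. f t + x *\<^sub>R g t + y *\<^sub>R h t)"
  using assms unfolding smooth_loop_def by (auto intro!: smooth_vec_add smooth_vec_scaleR smooth_const)

lemma Ck_ball_perturbation:
  assumes "smooth_loop f" "smooth_loop g" "smooth_loop h" "0 < e"
  obtains d where "0 < d"
    "\<And>x y. \<bar>x\<bar> < d \<Longrightarrow> \<bar>y\<bar> < d \<Longrightarrow> (\<lambda>t. f t + x *\<^sub>R g t + y *\<^sub>R h t) \<in> Ck_ball f n e"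
proof -
  have "\<exists>B>0. \<forall>t. norm ((vderiv ^^ k) g t) \<le> B \<and> norm ((vderiv ^^ k) h t) \<le> B" for k
  proof -
    obtain B where "0 < B" "\<And>t. norm ((vderiv ^^ k) g t) \<le> B"
      using smooth_loop_bounded[OF assms(2)] by blast
    moreover obtain B' where "0 < B'" "\<And>t. norm ((vderiv ^^ k) h t) \<le> B'"
      using smooth_loop_bounded[OF assms(3)] by blast
    ultimately show ?thesis
      by (intro exI[of _ "max B B'"]) (auto simp: le_max_iff_disj)
  qed
  then obtain B where B: "\<And>k. B k > 0" "\<And>k t. norm ((vderiv ^^ k) g t) \<le> B k"
    "\<And>k t. norm ((vderiv ^^ k) h t) \<le> B k" by metis
  define C where "C = (\<Sum>k\<le>n. B k)"
  have C: "B k \<le> C" if "k \<le> n" for k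
    unfolding C_def using that B(1) by (intro member_le_sum) (auto simp: less_imp_le)
  have "0 < C" using C[of 0] B(1)[of 0] by linarith
  show ?thesis
  proof
    show "0 < e / (2 * C)" using assms(4) \<open>0 < C\<close> by simp
    fix x y :: real
    assume xy: "\<bar>x\<bar> < e / (2 * C)" "\<bar>y\<bar> < e / (2 * C)"
    have "dist ((vderiv ^^ k) (\<lambda>t. f t + x *\<^sub>R g t + y *\<^sub>R h t) t) ((vderiv ^^ k) f t) < e"
      if "k \<le> n" for k t
    proof -
      have "dist ((vderiv ^^ k) (\<lambda>t. f t + x *\<^sub>R g t + y *\<^sub>R h t) t) ((vderiv ^^ k) f t)
          = norm (x *\<^sub>R (vderiv ^^ k) g t + y *\<^sub>R (vderiv ^^ k) h t)"
        using assms by (simp add: vderiv_lincomb smooth_loop_smooth dist_norm)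
      also have "\<dots> \<le> \<bar>x\<bar> * norm ((vderiv ^^ k) g t) + \<bar>y\<bar> * norm ((vderiv ^^ k) h t)"
        by (metis norm_scaleR norm_triangle_ineq)
      also have "\<dots> \<le> \<bar>x\<bar> * C + \<bar>y\<bar> * C"
        using order_trans[OF B(2)[of k t] C[OF that]] order_trans[OF B(3)[of k t] C[OF that]]
        by (intro add_mono mult_left_mono) auto
      also have "\<dots> < e"
        using xy \<open>0 < C\<close> by (simp add: field_simps)
      finally show ?thesis .
    qed
    then show "(\<lambda>t. f t + x *\<^sub>R g t + y *\<^sub>R h t) \<in> Ck_ball f n e"
      unfolding Ck_ball_def using smooth_loop_lincomb assms by blast
  qed
qed

lemma Ck_ball_center: "smooth_loop \<gamma> \<Longrightarrow> 0 < e \<Longrightarrow> \<gamma> \<in> Ck_ball \<gamma> n e"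
  by (simp add: Ck_ball_def)

lemma Ck_ball_mono: "n' \<le> n \<Longrightarrow> e \<le> e' \<Longrightarrow> Ck_ball \<gamma> n e \<subseteq> Ck_ball \<gamma> n' e'"
  unfolding Ck_ball_def using less_le_trans le_trans by blast

lemma Ck_ball_trans:
  "\<eta> \<in> Ck_ball \<gamma> n d \<Longrightarrow> \<zeta> \<in> Ck_ball \<eta> n d' \<Longrightarrow> d + d' \<le> e \<Longrightarrow> \<zeta> \<in> Ck_ball \<gamma> n e"
proof -
  assume a: "\<eta> \<in> Ck_ball \<gamma> n d" "\<zeta> \<in> Ck_ball \<eta> n d'" "d + d' \<le> e"
  have "dist ((vderiv ^^ k) \<zeta> t) ((vderiv ^^ k) \<gamma> t) < e" if "k \<le> n" for k t
  proof -
    have "dist ((vderiv ^^ k) \<eta> t) ((vderiv ^^ k) \<gamma> t) < d"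
      "dist ((vderiv ^^ k) \<zeta> t) ((vderiv ^^ k) \<eta> t) < d'"
      using a that by (auto simp: Ck_ball_def)
    then show ?thesis
      using dist_triangle[of "(vderiv ^^ k) \<zeta> t" "(vderiv ^^ k) \<gamma> t" "(vderiv ^^ k) \<eta> t"] a(3)
      by linarith
  qed
  then show ?thesis using a(2) by (simp add: Ck_ball_def)
qed

text \<open>
  The pointwise strict inequalities in the definition of a ball are uniform by periodicity, so
  every ball is a neighbourhood of each of its points.
\<close>

lemma Ck_ball_nbhd:
  assumes "smooth_loop \<gamma>" "smooth_loop \<eta>" "\<eta> \<in> Ck_ball \<gamma> n e"
  obtains d where "0 < d" "Ck_ball \<eta> n d \<subseteq> Ck_ball \<gamma> n e"
proof -
  have "\<exists>r<e. \<forall>t. dist ((vderiv ^^ k) \<eta> t) ((vderiv ^^ k) \<gamma> t) \<le> r" if "k \<le> n" for k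
  proof -
    let ?f = "\<lambda>t. dist ((vderiv ^^ k) \<eta> t) ((vderiv ^^ k) \<gamma> t)"
    have "continuous_on {0..1} ?f"
      using assms smooth_loop_smooth smooth_funpow_vderiv smooth_continuous
      by (intro continuous_on_dist) blast+
    then obtain s where s: "s \<in> {0..1}" "\<And>t. t \<in> {0..1} \<Longrightarrow> ?f t \<le> ?f s"
      using continuous_attains_sup[of "{0..1::real}" ?f] by auto
    have "?f t \<le> ?f s" for t
    proof -
      have "?f (t + 1) = ?f t" for t
        using assms(1,2) funpow_vderiv_periodic[of \<gamma> 1 k t] funpow_vderiv_periodic[of \<eta> 1 k t]
        by (simp add: smooth_loop_def)
      then show ?thesis
        using shift_into_period[of 1 0 t] s(2) periodic_int_multiple[of ?f 1 t]
        by (smt (verit) atLeastAtMost_iff)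
    qed
    moreover have "?f s < e" using assms(3) that by (simp add: Ck_ball_def)
    ultimately show ?thesis by blast
  qed
  then obtain r where r: "\<And>k. k \<le> n \<Longrightarrow> r k < e"
    "\<And>k t. k \<le> n \<Longrightarrow> dist ((vderiv ^^ k) \<eta> t) ((vderiv ^^ k) \<gamma> t) \<le> r k" by metis
  define R where "R = Max (r ` {..n})"
  have R: "R < e" "\<And>k. k \<le> n \<Longrightarrow> r k \<le> R"
    unfolding R_def using r(1) by (auto intro: Max_ge)
  have "Ck_ball \<eta> n (e - R) \<subseteq> Ck_ball \<gamma> n e"
  proof
    fix \<zeta> assume z: "\<zeta> \<in> Ck_ball \<eta> n (e - R)"
    have "dist ((vderiv ^^ k) \<zeta> t) ((vderiv ^^ k) \<gamma> t) < e" if "k \<le> n" for k t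
    proof -
      have "dist ((vderiv ^^ k) \<zeta> t) ((vderiv ^^ k) \<eta> t) < e - R"
        using z that by (auto simp: Ck_ball_def)
      then show ?thesis
        using dist_triangle[of "(vderiv ^^ k) \<zeta> t" "(vderiv ^^ k) \<gamma> t" "(vderiv ^^ k) \<eta> t"]
          r(2)[OF that, of t] R(2)[OF that] by linarith
    qed
    then show "\<zeta> \<in> Ck_ball \<gamma> n e" using z by (simp add: Ck_ball_def)
  qed
  then show ?thesis using that[of "e - R"] R(1) by simp
qed

lemma openin_smooth_loops_nbhd:
  assumes "openin smooth_loops U" "\<gamma> \<in> U" "smooth_loop \<gamma>"
  shows "\<exists>n e. 0 < e \<and> Ck_ball \<gamma> n e \<subseteq> U"
proof -
  have "generate_topology_on {Ck_ball \<gamma> n e |\<gamma> n e. smooth_loop \<gamma> \<and> 0 < e} U"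
    using assms(1) unfolding smooth_loops_def by (simp add: openin_topology_generated_by_iff)
  then show ?thesis using assms(2)
  proof (induction rule: generate_topology_on.induct)
    case (Int a b)
    then obtain n e n' e' where "0 < e" "Ck_ball \<gamma> n e \<subseteq> a" "0 < e'" "Ck_ball \<gamma> n' e' \<subseteq> b" by blast
    then show ?case
      using Ck_ball_mono[of n "max n n'" "min e e'" e \<gamma>] Ck_ball_mono[of n' "max n n'" "min e e'" e' \<gamma>]
      by (intro exI[of _ "max n n'"] exI[of _ "min e e'"]) auto
  next
    case (UN K)
    then show ?case by blast
  next
    case (Basis s)
    then obtain \<beta> n e where "s = Ck_ball \<beta> n e" "smooth_loop \<beta>" "0 < e" by blast
    then show ?case using Ck_ball_nbhd[of \<beta> \<gamma> n e] Basis assms(3) by metis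
  qed simp
qed

lemma convex_curve_smooth_loop: "convex_curve \<gamma> \<Longrightarrow> smooth_loop \<gamma>"
  by (simp add: convex_curve_def)

lemma openin_Ck_ball: "smooth_loop \<gamma> \<Longrightarrow> 0 < e \<Longrightarrow> openin smooth_loops (Ck_ball \<gamma> n e)"
  unfolding smooth_loops_def by (rule topology_generated_by_Basis) blast

lemma topspace_convex_curves: "topspace convex_curves = {\<gamma>. convex_curve \<gamma>}"
proof -
  have "{\<gamma>. convex_curve \<gamma>} \<subseteq> topspace smooth_loops"
    using openin_Ck_ball[of _ 1 0] openin_subset Ck_ball_center convex_curve_smooth_loop
    by (smt (verit) mem_Collect_eq subset_iff)
  then show ?thesis unfolding convex_curves_def by (auto simp: topspace_subtopology)
qed

text \<open>
  Balls are neighbourhoods of their points in the topology that they generate, so openness and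
  density only have to be tested on balls.
\<close>

lemma residual_in_convex_curvesI:
  assumes "countable \<U>"
    and sub: "\<And>U. U \<in> \<U> \<Longrightarrow> U \<subseteq> {\<gamma>. convex_curve \<gamma>}"
    and op: "\<And>U \<gamma>. U \<in> \<U> \<Longrightarrow> \<gamma> \<in> U \<Longrightarrow>
      \<exists>n e. 0 < e \<and> Ck_ball \<gamma> n e \<inter> {\<gamma>. convex_curve \<gamma>} \<subseteq> U"
    and dense: "\<And>U \<gamma> n e. U \<in> \<U> \<Longrightarrow> convex_curve \<gamma> \<Longrightarrow> 0 < e \<Longrightarrow> \<exists>\<eta>\<in>U. \<eta> \<in> Ck_ball \<gamma> n e"
  shows "residual_in convex_curves ({\<gamma>. convex_curve \<gamma>} \<inter> \<Inter>\<U>)"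
  unfolding residual_in_def topspace_convex_curves
proof (intro conjI exI[of _ \<U>] ballI)
  fix U assume U: "U \<in> \<U>"
  show "openin convex_curves U"
  proof (subst openin_subopen, intro ballI)
    fix \<gamma> assume g: "\<gamma> \<in> U"
    then obtain n e where ne: "0 < e" "Ck_ball \<gamma> n e \<inter> {\<gamma>. convex_curve \<gamma>} \<subseteq> U" using op U by blast
    have sl: "smooth_loop \<gamma>" using g sub[OF U] convex_curve_smooth_loop by blast
    have "openin convex_curves (Ck_ball \<gamma> n e \<inter> {\<gamma>. convex_curve \<gamma>})"
      unfolding convex_curves_def openin_subtopology using openin_Ck_ball[OF sl ne(1)] by blast
    moreover have "\<gamma> \<in> Ck_ball \<gamma> n e \<inter> {\<gamma>. convex_curve \<gamma>}"
      using g sub[OF U] Ck_ball_center[OF sl ne(1)] by blast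
    ultimately show "\<exists>T. openin convex_curves T \<and> \<gamma> \<in> T \<and> T \<subseteq> U" using ne by blast
  qed
  show "convex_curves closure_of U = {\<gamma>. convex_curve \<gamma>}"
  proof
    show "convex_curves closure_of U \<subseteq> {\<gamma>. convex_curve \<gamma>}"
      using closure_of_subset_topspace[of convex_curves U] topspace_convex_curves by simp
    show "{\<gamma>. convex_curve \<gamma>} \<subseteq> convex_curves closure_of U"
    proof
      fix \<gamma> assume g: "\<gamma> \<in> {\<gamma>. convex_curve \<gamma>}"
      have "\<exists>y. y \<in> U \<and> y \<in> T" if T: "\<gamma> \<in> T" "openin convex_curves T" for T
      proof -
        obtain T' where T': "openin smooth_loops T'" "T = T' \<inter> {\<gamma>. convex_curve \<gamma>}"
          using T(2) unfolding convex_curves_def openin_subtopology by blast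
        obtain n e where "0 < e" "Ck_ball \<gamma> n e \<subseteq> T'"
          using openin_smooth_loops_nbhd[OF T'(1), of \<gamma>] T(1) T'(2) g convex_curve_smooth_loop by blast
        moreover then obtain \<eta> where "\<eta> \<in> U" "\<eta> \<in> Ck_ball \<gamma> n e" using dense[OF U] g by blast
        ultimately show ?thesis using T'(2) sub[OF U] by blast
      qed
      then show "\<gamma> \<in> convex_curves closure_of U"
        unfolding in_closure_of topspace_convex_curves using g by blast
    qed
  qed
qed (use assms(1) in auto)

text \<open>
  Convergence of all derivatives, made locally uniform in the parameter by admitting convergent
  sequences of parameters.
\<close>

definition jet_tendsto :: "(nat \<Rightarrow> real \<Rightarrow> real^2) \<Rightarrow> (real \<Rightarrow> real^2) \<Rightarrow> bool" where
  "jet_tendsto H \<gamma> \<longleftrightarrow> (\<forall>k s t. s \<longlonglongrightarrow> t \<longrightarrow> (\<lambda>m. (vderiv ^^ k) (H m) (s m)) \<longlonglongrightarrow> (vderiv ^^ k) \<gamma> t)"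

text \<open>
  If violations occurred in arbitrarily small balls, then their parameters would accumulate in the
  compact set \<open>K\<close>, at a violation by the centre of the balls.
\<close>

lemma stable_avoidance:
  fixes K :: "'p::metric_space set"
  assumes "smooth_loop \<gamma>" "compact K"
    and closed: "\<And>H q p. jet_tendsto H \<gamma> \<Longrightarrow> q \<longlonglongrightarrow> p \<Longrightarrow> (\<And>m. bad (H m) (q m)) \<Longrightarrow> bad \<gamma> p"
    and avoid: "\<And>p. p \<in> K \<Longrightarrow> \<not> bad \<gamma> p"
  obtains n e where "0 < e" "\<And>\<eta> p. \<eta> \<in> Ck_ball \<gamma> n e \<Longrightarrow> p \<in> K \<Longrightarrow> \<not> bad \<eta> p"
proof (rule ccontr)
  assume "\<not> thesis"
  then have "\<exists>\<eta> p. \<eta> \<in> Ck_ball \<gamma> m (1 / real (Suc m)) \<and> p \<in> K \<and> bad \<eta> p" for m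
    using that[of "1 / real (Suc m)" m] by force
  then obtain H q where H: "\<And>m. H m \<in> Ck_ball \<gamma> m (1 / real (Suc m))"
    and q: "\<And>m. q m \<in> K" "\<And>m. bad (H m) (q m)" by metis
  obtain p r where pr: "p \<in> K" "strict_mono r" "(q \<circ> r) \<longlonglongrightarrow> p"
    using assms(2) q(1) unfolding compact_def by metis
  have "jet_tendsto (H \<circ> r) \<gamma>"
    unfolding jet_tendsto_def
  proof (intro allI impI)
    fix k and s :: "nat \<Rightarrow> real" and t assume s: "s \<longlonglongrightarrow> t"
    have "(\<lambda>m. (vderiv ^^ k) ((H \<circ> r) m) (s m) - (vderiv ^^ k) \<gamma> (s m)) \<longlonglongrightarrow> 0"
    proof (rule Lim_null_comparison)
      have "norm ((vderiv ^^ k) ((H \<circ> r) m) (s m) - (vderiv ^^ k) \<gamma> (s m)) \<le> 1 / real (Suc m)"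
        if "k \<le> m" for m
      proof -
        have "m \<le> r m" using pr(2) by (rule seq_suble)
        then have "dist ((vderiv ^^ k) (H (r m)) (s m)) ((vderiv ^^ k) \<gamma> (s m)) < 1 / real (Suc (r m))"
          using H[of "r m"] that by (simp add: Ck_ball_def)
        also have "\<dots> \<le> 1 / real (Suc m)" using \<open>m \<le> r m\<close> by (simp add: field_simps)
        finally show ?thesis by (simp add: dist_norm)
      qed
      then show "\<forall>\<^sub>F m in sequentially. norm ((vderiv ^^ k) ((H \<circ> r) m) (s m) - (vderiv ^^ k) \<gamma> (s m))
          \<le> 1 / real (Suc m)"
        using eventually_sequentially by blast
      show "(\<lambda>m. 1 / real (Suc m)) \<longlonglongrightarrow> 0" by (rule LIMSEQ_Suc[OF lim_1_over_n])
    qed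
    moreover have "(\<lambda>m. (vderiv ^^ k) \<gamma> (s m)) \<longlonglongrightarrow> (vderiv ^^ k) \<gamma> t"
      using smooth_isCont[OF smooth_funpow_vderiv] assms(1) s smooth_loop_smooth isCont_tendsto_compose
      by blast
    ultimately show "(\<lambda>m. (vderiv ^^ k) ((H \<circ> r) m) (s m)) \<longlonglongrightarrow> (vderiv ^^ k) \<gamma> t"
      using tendsto_add by fastforce
  qed
  then have "bad \<gamma> p"
    using closed[of "H \<circ> r" "q \<circ> r" p] pr q by simp
  then show False using avoid pr(1) by blast
qed

section \<open>Convex curves parametrised by their tangent angle\<close>

definition rot :: "real^2 \<Rightarrow> real^2" where
  "rot v = vector [- v $ 2, v $ 1]"

lemma rot_nth [simp]: "rot v $ 1 = - v $ 2" "rot v $ 2 = v $ 1"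
  by (simp_all add: rot_def)

lemma cross2_rot: "cross2 v w = rot v \<bullet> w"
  by (simp add: cross2_eq inner2_eq)

lemma cross2_rot_diff: "cross2 v (w - u) = rot v \<bullet> w - rot v \<bullet> u"
  by (simp add: cross2_rot inner_diff_right)

lemma rot_eq_0_iff [simp]: "rot v = 0 \<longleftrightarrow> v = 0"
  by (auto simp: vec2_eq_iff)

lemma polar_form:
  fixes v :: "real^2"
  obtains \<theta> where "v = norm v *\<^sub>R unit_dir \<theta>"
proof (cases "v = 0")
  case False
  have "(v $ 1 / norm v)\<^sup>2 + (v $ 2 / norm v)\<^sup>2 = (v \<bullet> v) / (norm v)\<^sup>2"
    by (simp add: inner2_eq power2_eq_square add_divide_distrib)
  also have "\<dots> = 1" using False by (simp add: power2_norm_eq_inner)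
  finally obtain t where "v $ 1 / norm v = cos t" "v $ 2 / norm v = sin t"
    using sincos_total_2pi by blast
  then have "v $ 1 = norm v * cos t" "v $ 2 = norm v * sin t"
    using False by (auto simp: field_simps)
  then show ?thesis using that[of t] by (simp add: vec2_eq_iff)
qed (use that in simp)

lemma halfplane_interior:
  assumes "v \<noteq> 0" "\<And>y. y \<in> K \<Longrightarrow> 0 \<le> cross2 v (y - p)" "x \<in> interior K"
  shows "0 < cross2 v (x - p)"
proof -
  have "K \<subseteq> {y. rot v \<bullet> p \<le> rot v \<bullet> y}" using assms(2) cross2_rot_diff by force
  then have "x \<in> interior {y. rot v \<bullet> p \<le> rot v \<bullet> y}" using assms(3) interior_mono by blast
  then show ?thesis using assms(1) interior_halfspace_ge[of "rot v" "rot v \<bullet> p"] cross2_rot_diff by simp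
qed

lemma halfplane_hull:
  assumes "\<And>y. y \<in> S \<Longrightarrow> 0 \<le> cross2 v (y - p)" "x \<in> convex hull S"
  shows "0 \<le> cross2 v (x - p)"
proof -
  have "S \<subseteq> {y. rot v \<bullet> p \<le> rot v \<bullet> y}" using assms(1) cross2_rot_diff by force
  then have "convex hull S \<subseteq> {y. rot v \<bullet> p \<le> rot v \<bullet> y}"
    using convex_halfspace_ge[of "rot v \<bullet> p" "rot v"] hull_minimal by blast
  then show ?thesis using assms(2) cross2_rot_diff by auto
qed

text \<open>
  The radius of curvature \<open>\<rho>\<close> as a function of the tangent angle determines the whole geometry of
  parallel pairs; the angle \<open>\<phi> t\<close> at the parameter \<open>t\<close> of a given curve increases or decreases
  according to the orientation of the curve.
\<close>

definition angle_form :: "(real \<Rightarrow> real^2) \<Rightarrow> (real \<Rightarrow> real) \<Rightarrow> bool" where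
  "angle_form \<Gamma> \<rho> \<longleftrightarrow> smooth \<Gamma> \<and> smooth \<rho> \<and> (\<forall>\<theta>. \<Gamma> (\<theta> + 2 * pi) = \<Gamma> \<theta>) \<and> (\<forall>\<theta>. 0 < \<rho> \<theta>) \<and>
     (\<forall>\<theta>. (\<Gamma> has_vector_derivative \<rho> \<theta> *\<^sub>R unit_dir \<theta>) (at \<theta>))"

definition angle_change :: "(real \<Rightarrow> real) \<Rightarrow> bool" where
  "angle_change \<phi> \<longleftrightarrow> smooth \<phi> \<and> (\<forall>t. vderiv \<phi> t \<noteq> 0) \<and>
     ((\<forall>t. \<phi> (t + 1) = \<phi> t + 2 * pi) \<or> (\<forall>t. \<phi> (t + 1) = \<phi> t - 2 * pi))"

lemma angle_formD:
  assumes "angle_form \<Gamma> \<rho>"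
  shows "smooth \<Gamma>" "smooth \<rho>" "\<Gamma> (\<theta> + 2 * pi) = \<Gamma> \<theta>" "0 < \<rho> \<theta>"
    "(\<Gamma> has_vector_derivative \<rho> \<theta> *\<^sub>R unit_dir \<theta>) (at \<theta>)" "\<rho> (\<theta> + 2 * pi) = \<rho> \<theta>"
    "vderiv \<Gamma> = (\<lambda>\<theta>. \<rho> \<theta> *\<^sub>R unit_dir \<theta>)"
proof -
  show *: "smooth \<Gamma>" "smooth \<rho>" "\<Gamma> (\<theta> + 2 * pi) = \<Gamma> \<theta>" "0 < \<rho> \<theta>"
    "(\<Gamma> has_vector_derivative \<rho> \<theta> *\<^sub>R unit_dir \<theta>) (at \<theta>)" for \<theta>
    using assms unfolding angle_form_def by blast+
  then show eq: "vderiv \<Gamma> = (\<lambda>\<theta>. \<rho> \<theta> *\<^sub>R unit_dir \<theta>)"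
    by (intro vderiv_eqI)
  have "\<rho> (\<theta> + 2 * pi) *\<^sub>R unit_dir \<theta> = \<rho> \<theta> *\<^sub>R unit_dir \<theta>"
    using vderiv_periodic[of \<Gamma> "2 * pi" \<theta>] * by (simp add: eq)
  then show "\<rho> (\<theta> + 2 * pi) = \<rho> \<theta>" by simp
qed

lemma angle_changeD:
  assumes "angle_change \<phi>"
  obtains \<sigma> :: real where "\<sigma> = 1 \<or> \<sigma> = -1" "\<And>t. \<phi> (t + 1) = \<phi> t + \<sigma> * (2 * pi)"
    "\<And>t. 0 < \<sigma> * vderiv \<phi> t"
proof -
  have sm: "smooth \<phi>" using assms by (simp add: angle_change_def)
  obtain \<sigma> :: real where s: "\<sigma> = 1 \<or> \<sigma> = -1" "\<And>t. \<phi> (t + 1) = \<phi> t + \<sigma> * (2 * pi)"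
    using assms unfolding angle_change_def
    by (metis add_uminus_conv_diff mult_1 mult_minus1)
  obtain z where z: "\<phi> 1 - \<phi> 0 = vderiv \<phi> z"
    using MVT2[of 0 1 \<phi> "vderiv \<phi>"] smooth_has_real_derivative[OF sm] by auto
  have "0 < \<sigma> * vderiv \<phi> z"
    using s(1) s(2)[of 0] pi_gt_zero by (auto simp flip: z)
  have "0 < \<sigma> * vderiv \<phi> t" for t
  proof (rule ccontr)
    assume "\<not> 0 < \<sigma> * vderiv \<phi> t"
    moreover have "connected (range (\<lambda>t. \<sigma> * vderiv \<phi> t))"
      using smooth_continuous[OF smooth_vderiv[OF sm]]
      by (intro connected_continuous_image continuous_intros) auto
    ultimately have "0 \<in> range (\<lambda>t. \<sigma> * vderiv \<phi> t)"
      using connectedD_interval[of "range (\<lambda>t. \<sigma> * vderiv \<phi> t)" "\<sigma> * vderiv \<phi> t" "\<sigma> * vderiv \<phi> z" 0]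
        \<open>0 < \<sigma> * vderiv \<phi> z\<close> by (smt (verit) rangeI)
    then show False using assms s(1) unfolding angle_change_def by auto
  qed
  then show ?thesis using that s by blast
qed

text \<open>
  The inverse solves the autonomous differential equation \<open>\<tau>' = 1 / \<phi>' (\<tau>)\<close> and is therefore smooth.
\<close>

lemma angle_change_inverse:
  assumes "angle_change \<phi>"
  obtains \<tau> where "smooth \<tau>" "\<And>x. \<phi> (\<tau> x) = x" "\<And>t. \<tau> (\<phi> t) = t"
    "\<And>x. (\<tau> has_real_derivative inverse (vderiv \<phi> (\<tau> x))) (at x)"
proof -
  obtain \<sigma> :: real where s: "\<sigma> = 1 \<or> \<sigma> = -1" "\<And>t. \<phi> (t + 1) = \<phi> t + \<sigma> * (2 * pi)"
    "\<And>t. 0 < \<sigma> * vderiv \<phi> t" using angle_changeD[OF assms] by blast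
  have sm: "smooth \<phi>" and nz: "\<And>t. vderiv \<phi> t \<noteq> 0" using assms by (simp_all add: angle_change_def)
  have incr: "\<sigma> * \<phi> s < \<sigma> * \<phi> t" if "s < t" for s t
    using that
  proof (rule DERIV_pos_imp_increasing)
    show "\<exists>y. ((\<lambda>t. \<sigma> * \<phi> t) has_real_derivative y) (at x) \<and> 0 < y" for x
      using s(3)[of x] smooth_has_real_derivative[OF sm, of x] by (metis DERIV_cmult)
  qed
  have inj: "\<phi> s = \<phi> t \<Longrightarrow> s = t" for s t
    using incr[of s t] incr[of t s] by (metis linorder_less_linear order_less_irrefl)
  have surj: "\<exists>t. \<phi> t = y" for y
  proof -
    have shift: "\<sigma> * (\<phi> t - \<sigma> * (2 * pi) * t) = \<sigma> * (\<phi> (t + of_int k * 1) - \<sigma> * (2 * pi) * (t + of_int k * 1))" for t :: real and k :: int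
      by (rule periodic_int_multiple[symmetric]) (use s(2) in \<open>simp add: algebra_simps\<close>)
    have ss: "\<sigma> * \<sigma> = 1" using s(1) by auto
    have val: "\<sigma> * \<phi> (of_int k) = \<sigma> * \<phi> 0 + 2 * pi * of_int k" for k :: int
      using shift[of 0 k] ss by (simp add: algebra_simps) (metis mult.assoc mult.left_commute mult_1)
    define N where "N = \<lceil>\<bar>\<sigma> * y - \<sigma> * \<phi> 0\<bar>\<rceil>"
    have N: "\<bar>\<sigma> * y - \<sigma> * \<phi> 0\<bar> \<le> of_int N" "0 \<le> N" unfolding N_def by linarith+
    have "of_int N \<le> 2 * pi * of_int N"
      using N(2) pi_ge_two by (simp add: mult_le_cancel_right1)
    then have "\<sigma> * \<phi> (of_int (-N)) \<le> \<sigma> * y" "\<sigma> * y \<le> \<sigma> * \<phi> (of_int N)"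
      using N(1) unfolding val by auto
    moreover have "connected (range (\<lambda>t. \<sigma> * \<phi> t))"
      using smooth_continuous[OF sm] by (intro connected_continuous_image continuous_intros) auto
    ultimately have "\<sigma> * y \<in> range (\<lambda>t. \<sigma> * \<phi> t)"
      using connectedD_interval[of "range (\<lambda>t. \<sigma> * \<phi> t)"] by blast
    then show ?thesis using s(1) by auto
  qed
  define \<tau> where "\<tau> = inv \<phi>"
  have inv: "\<phi> (\<tau> x) = x" "\<tau> (\<phi> t) = t" for x t
    using surj inj unfolding \<tau>_def by (auto simp: surj_f_inv_f surj_def inv_f_f inj_def, metis surj_def surj_f_inv_f)
  have "isCont \<tau> x" for x
    using isCont_inverse_function[where d = 1 and x = "\<tau> x" and g = \<tau> and f = \<phi>] inv smooth_isCont[OF sm] by simp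
  then have der: "(\<tau> has_real_derivative inverse (vderiv \<phi> (\<tau> x))) (at x)" for x
    using DERIV_inverse_function[where f = \<phi> and g = \<tau> and x = x and a = "x - 1" and b = "x + 1"]
      smooth_has_real_derivative[OF sm] nz inv by simp
  have "smooth (\<lambda>x. 1 / vderiv \<phi> x)"
    using nz sm by (intro smooth_intros)
  then have "smooth \<tau>"
    by (rule smooth_ode) (use der in \<open>simp add: inverse_eq_divide\<close>)
  then show ?thesis using that inv der by blast
qed

text \<open>
  With tangent angle \<open>\<theta>\<close>, the height above the tangent at \<open>\<theta>\<close> has derivative
  \<open>\<rho> (\<theta> + d) * sin d\<close>: it rises for half a turn and then falls back to zero.
\<close>

lemma angle_form_support:
  assumes "angle_form \<Gamma> \<rho>" "0 < d" "d < 2 * pi"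
  shows "0 < cross2 (unit_dir \<theta>) (\<Gamma> (\<theta> + d) - \<Gamma> \<theta>)"
proof -
  define h where "h d = cross2 (unit_dir \<theta>) (\<Gamma> (\<theta> + d) - \<Gamma> \<theta>)" for d
  have der: "(h has_real_derivative \<rho> (\<theta> + d) * sin d) (at d)" for d
  proof -
    have "((\<lambda>d. \<Gamma> (\<theta> + d)) has_vector_derivative \<rho> (\<theta> + d) *\<^sub>R unit_dir (\<theta> + d)) (at d)"
      using vector_diff_chain_at[of "\<lambda>d. d + \<theta>" 1 d \<Gamma>, OF _ angle_formD(5)[OF assms(1)]]
      by (simp add: o_def has_vector_derivative_add_const add.commute)
    then have "((\<lambda>d. cross2 (unit_dir \<theta>) (\<Gamma> (\<theta> + d) - \<Gamma> \<theta>)) has_real_derivative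
        cross2 0 (\<Gamma> (\<theta> + d) - \<Gamma> \<theta>) + cross2 (unit_dir \<theta>) (\<rho> (\<theta> + d) *\<^sub>R unit_dir (\<theta> + d) - 0)) (at d)"
      by (intro cross2_has_real_derivative has_vector_derivative_diff has_vector_derivative_const)
    moreover have "cross2 (unit_dir \<theta>) (\<rho> (\<theta> + d) *\<^sub>R unit_dir (\<theta> + d)) = \<rho> (\<theta> + d) * sin d"
      using cross2_unit_dir[of \<theta> "\<theta> + d"] by (simp add: cross2_rot)
    ultimately show ?thesis unfolding h_def by (simp add: cross2_eq)
  qed
  have cont: "continuous_on S h" for S
    using der by (meson DERIV_continuous continuous_at_imp_continuous_on)
  have pos: "0 < \<rho> x" for x using angle_formD(4)[OF assms(1)] .
  have "0 < h d"
  proof (cases "d \<le> pi")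
    case True
    have "h 0 < h d"
    proof (rule DERIV_pos_imp_increasing_open[OF assms(2) _ cont])
      fix x assume "0 < x" "x < d"
      then show "\<exists>y. (h has_real_derivative y) (at x) \<and> 0 < y"
        using der[of x] pos[of "\<theta> + x"] sin_gt_zero[of x] True by (intro exI[of _ "\<rho> (\<theta> + x) * sin x"]) auto
    qed
    then show ?thesis by (simp add: h_def cross2_eq)
  next
    case False
    have "h (2 * pi) < h d"
    proof (rule DERIV_neg_imp_decreasing_open[OF assms(3) _ cont])
      fix x assume "d < x" "x < 2 * pi"
      then show "\<exists>y. (h has_real_derivative y) (at x) \<and> y < 0"
        using der[of x] pos[of "\<theta> + x"] sin_lt_zero[of x] False
        by (intro exI[of _ "\<rho> (\<theta> + x) * sin x"]) (auto simp: mult_pos_neg)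
    qed
    moreover have "h (2 * pi) = 0"
      unfolding h_def using angle_formD(3)[OF assms(1)] by (simp add: cross2_eq)
    ultimately show ?thesis by simp
  qed
  then show ?thesis by (simp add: h_def)
qed

lemma angle_form_int:
  assumes "angle_form \<Gamma> \<rho>"
  shows "\<Gamma> (\<theta> + of_int k * (2 * pi)) = \<Gamma> \<theta>" "\<rho> (\<theta> + of_int k * (2 * pi)) = \<rho> \<theta>"
  using angle_formD(3,6)[OF assms] by (intro periodic_int_multiple; simp)+

lemma angle_form_support_all:
  assumes "angle_form \<Gamma> \<rho>"
  shows "\<Gamma> x = \<Gamma> \<theta> \<and> (\<exists>k::int. x = \<theta> + of_int k * (2 * pi)) \<or> 0 < cross2 (unit_dir \<theta>) (\<Gamma> x - \<Gamma> \<theta>)"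
proof -
  obtain k :: int where k: "0 \<le> x - \<theta> + of_int k * (2 * pi)" "x - \<theta> + of_int k * (2 * pi) < 0 + 2 * pi"
    using shift_into_period[of "2 * pi" 0 "x - \<theta>"] pi_gt_zero by auto
  let ?d = "x - \<theta> + of_int k * (2 * pi)"
  have G: "\<Gamma> (\<theta> + ?d) = \<Gamma> x"
    using angle_form_int(1)[OF assms, of x k] by (simp add: algebra_simps)
  show ?thesis
  proof (cases "?d = 0")
    case True
    then have "x = \<theta> + of_int (- k) * (2 * pi)" by simp
    moreover have "\<Gamma> x = \<Gamma> \<theta>" using G True by simp
    ultimately show ?thesis by blast
  next
    case False
    then show ?thesis using angle_form_support[OF assms, of ?d \<theta>] k G by simp
  qed
qed

lemma angle_form_inj:
  assumes "angle_form \<Gamma> \<rho>" "\<Gamma> x = \<Gamma> \<theta>"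
  shows "\<exists>k::int. x = \<theta> + of_int k * (2 * pi)"
  using angle_form_support_all[OF assms(1), of x \<theta>] assms(2) by (auto simp: cross2_eq)

lemma angle_change_int:
  fixes \<phi> :: "real \<Rightarrow> real"
  assumes "\<And>t. \<phi> (t + 1) = \<phi> t + \<sigma> * (2 * pi)"
  shows "\<phi> (t + of_int k) = \<phi> t + \<sigma> * of_int k * (2 * pi)"
proof -
  have "\<phi> (t + of_int k * 1) - \<sigma> * (2 * pi) * (t + of_int k * 1) = \<phi> t - \<sigma> * (2 * pi) * t"
    by (rule periodic_int_multiple) (use assms in \<open>simp add: algebra_simps\<close>)
  then show ?thesis by (simp add: algebra_simps)
qed

lemma angle_form_compose_deriv:
  assumes "angle_form \<Gamma> \<rho>" "angle_change \<phi>"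
  shows "smooth (\<lambda>t. \<Gamma> (\<phi> t))"
    "vderiv (\<lambda>t. \<Gamma> (\<phi> t)) = (\<lambda>t. (vderiv \<phi> t * \<rho> (\<phi> t)) *\<^sub>R unit_dir (\<phi> t))"
proof -
  have sm: "smooth \<phi>" using assms(2) by (simp add: angle_change_def)
  show "smooth (\<lambda>t. \<Gamma> (\<phi> t))"
    using angle_formD(1)[OF assms(1)] sm by (rule smooth_vec_compose)
  show "vderiv (\<lambda>t. \<Gamma> (\<phi> t)) = (\<lambda>t. (vderiv \<phi> t * \<rho> (\<phi> t)) *\<^sub>R unit_dir (\<phi> t))"
  proof (rule vderiv_eqI)
    fix t
    show "((\<lambda>t. \<Gamma> (\<phi> t)) has_vector_derivative (vderiv \<phi> t * \<rho> (\<phi> t)) *\<^sub>R unit_dir (\<phi> t)) (at t)"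
      using vector_diff_chain_at[OF smooth_has_vderiv[OF sm] angle_formD(5)[OF assms(1)]]
      by (simp add: o_def)
  qed
qed

lemma smooth_loop_compose:
  assumes "smooth f" "\<And>\<theta>. f (\<theta> + 2 * pi) = f \<theta>" "angle_change \<phi>"
  shows "smooth_loop (\<lambda>t. f (\<phi> t))"
proof -
  obtain \<sigma> :: real where s: "\<sigma> = 1 \<or> \<sigma> = -1" "\<And>t. \<phi> (t + 1) = \<phi> t + \<sigma> * (2 * pi)"
    using angle_changeD[OF assms(3)] by metis
  have "f (\<phi> (t + 1)) = f (\<phi> t)" for t
    using s assms(2)[of "\<phi> t"] assms(2)[of "\<phi> t - 2 * pi"] by auto
  then show ?thesis
    using assms smooth_vec_compose by (auto simp: smooth_loop_def angle_change_def)
qed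

text \<open>
  At a frontier point of the hull there is a supporting line. The tangent of the same direction
  touches the curve in a single point and leaves the rest of it strictly on one side, so the frontier
  point is that point of contact.
\<close>

lemma angle_form_frontier:
  assumes "angle_form \<Gamma> \<rho>"
  shows "range \<Gamma> = frontier (convex hull (range \<Gamma>))"
proof -
  let ?K = "convex hull (range \<Gamma>)"
  have "range \<Gamma> = \<Gamma> ` {0..2 * pi}"
  proof
    show "range \<Gamma> \<subseteq> \<Gamma> ` {0..2 * pi}"
    proof
      fix y assume "y \<in> range \<Gamma>"
      then obtain x where x: "y = \<Gamma> x" by blast
      obtain k :: int where k: "0 \<le> x + of_int k * (2 * pi)" "x + of_int k * (2 * pi) < 0 + 2 * pi"
        using shift_into_period[of "2 * pi" 0 x] pi_gt_zero by auto
      then show "y \<in> \<Gamma> ` {0..2 * pi}"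
        using angle_form_int(1)[OF assms, of x k] x by (intro image_eqI[of _ _ "x + of_int k * (2 * pi)"]) auto
    qed
  qed auto
  moreover have "compact (\<Gamma> ` {0..2 * pi})"
    using smooth_continuous[OF angle_formD(1)[OF assms]] by (intro compact_continuous_image) auto
  ultimately have K: "compact ?K" "convex ?K" "closed ?K"
    using compact_convex_hull compact_imp_closed convex_convex_hull by metis+
  have supp: "0 \<le> cross2 (unit_dir \<theta>) (y - \<Gamma> \<theta>)" if "y \<in> range \<Gamma>" for y \<theta>
  proof -
    have "cross2 (unit_dir \<theta>) (\<Gamma> \<theta> - \<Gamma> \<theta>) = 0" by (simp add: cross2_eq)
    then show ?thesis using that angle_form_support_all[OF assms, of _ \<theta>] by (metis less_imp_le order_refl rangeE)
  qed
  show ?thesis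
  proof
    show "range \<Gamma> \<subseteq> frontier ?K"
    proof
      fix y assume "y \<in> range \<Gamma>"
      then obtain \<theta> where y: "y = \<Gamma> \<theta>" by blast
      have "y \<notin> interior ?K"
        using halfplane_interior[of "unit_dir \<theta>" ?K "\<Gamma> \<theta>" y] halfplane_hull[of "range \<Gamma>" "unit_dir \<theta>" "\<Gamma> \<theta>"]
          supp y by (fastforce simp: cross2_eq)
      then show "y \<in> frontier ?K"
        using K(3) y hull_inc[of y "range \<Gamma>"] by (simp add: frontier_def)
    qed
  next
    show "frontier ?K \<subseteq> range \<Gamma>"
    proof
      fix x assume "x \<in> frontier ?K"
      then have x: "x \<in> ?K" "x \<notin> interior ?K" using K(3) by (auto simp: frontier_def)
      obtain a where a: "a \<noteq> 0" "\<And>y. y \<in> ?K \<Longrightarrow> a \<bullet> x \<le> a \<bullet> y"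
      proof (cases "interior ?K = {}")
        case True
        then obtain a b where ab: "a \<noteq> 0" "?K \<subseteq> {x. a \<bullet> x = b}"
          using empty_interior_subset_hyperplane[OF K(2)] by metis
        then have "a \<bullet> y = b" if "y \<in> ?K" for y using that by blast
        then show ?thesis using x(1) ab(1) that[of a] by simp
      next
        case False
        then have "rel_interior ?K = interior ?K" by (rule rel_interior_nonempty_interior)
        then have "x \<notin> rel_interior ?K" using x by simp
        then show ?thesis
          using supporting_hyperplane_rel_boundary[OF K(2) x(1)] that by metis
      qed
      obtain \<theta> where th: "- rot a = norm (- rot a) *\<^sub>R unit_dir \<theta>" by (rule polar_form)
      have "a = rot (- rot a)" by (simp add: vec2_eq_iff)
      also have "\<dots> = norm (- rot a) *\<^sub>R rot (unit_dir \<theta>)" by (subst th) (simp add: vec2_eq_iff)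
      finally have a': "a = norm (- rot a) *\<^sub>R rot (unit_dir \<theta>)" .
      have r: "0 < norm (- rot a)" using a(1) by simp
      have "a \<bullet> x \<le> a \<bullet> \<Gamma> \<theta>" using a(2) hull_inc[of "\<Gamma> \<theta>" "range \<Gamma>"] by blast
      then have le: "cross2 (unit_dir \<theta>) (x - \<Gamma> \<theta>) \<le> 0"
        using r by (subst (asm) (1 2) a') (simp add: cross2_rot_diff)
      let ?C = "{y. y = \<Gamma> \<theta> \<or> 0 < cross2 (unit_dir \<theta>) (y - \<Gamma> \<theta>)}"
      have "convex ?C"
      proof (rule convexI)
        fix y z :: "real^2" and u v :: real
        assume yz: "y \<in> ?C" "z \<in> ?C" and uv: "0 \<le> u" "0 \<le> v" "u + v = 1"
        let ?l = "\<lambda>y. cross2 (unit_dir \<theta>) (y - \<Gamma> \<theta>)"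
        have lin: "?l (u *\<^sub>R y + v *\<^sub>R z) = u * ?l y + v * ?l z"
        proof -
          have "v = 1 - u" using uv by simp
          show ?thesis unfolding \<open>v = 1 - u\<close> by (simp add: cross2_eq algebra_simps)
        qed
        have l0: "?l (\<Gamma> \<theta>) = 0" by (simp add: cross2_eq)
        show "u *\<^sub>R y + v *\<^sub>R z \<in> ?C"
        proof (cases "u = 0 \<or> v = 0 \<or> (y = \<Gamma> \<theta> \<and> z = \<Gamma> \<theta>)")
          case True
          then show ?thesis using yz uv by (auto simp flip: scaleR_add_left)
        next
          case False
          then have uv': "0 < u" "0 < v" using uv by auto
          have "0 \<le> ?l y" "0 \<le> ?l z" "0 < ?l y \<or> 0 < ?l z" using yz l0 False by auto
          then have "0 < u * ?l y + v * ?l z"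
            using uv' by (metis add_nonneg_pos add_pos_nonneg less_imp_le mult_nonneg_nonneg mult_pos_pos)
          then show ?thesis using lin by simp
        qed
      qed
      moreover have "range \<Gamma> \<subseteq> ?C" using angle_form_support_all[OF assms] by blast
      ultimately have "?K \<subseteq> ?C" by (rule hull_minimal[rotated])
      then have "x = \<Gamma> \<theta>" using x(1) le by force
      then show "x \<in> range \<Gamma>" by blast
    qed
  qed
qed

theorem convex_curve_of_angle_form:
  assumes "angle_form \<Gamma> \<rho>" "angle_change \<phi>"
  shows "convex_curve (\<lambda>t. \<Gamma> (\<phi> t))"
proof -
  obtain \<sigma> :: real where s: "\<sigma> = 1 \<or> \<sigma> = -1" "\<And>t. \<phi> (t + 1) = \<phi> t + \<sigma> * (2 * pi)"
    using angle_changeD[OF assms(2)] by metis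
  obtain \<tau> where t: "\<And>x. \<phi> (\<tau> x) = x" "\<And>t. \<tau> (\<phi> t) = t" using angle_change_inverse[OF assms(2)] by metis
  have "vderiv (\<lambda>t. \<Gamma> (\<phi> t)) t \<noteq> 0" for t
    using angle_formD(4)[OF assms(1), of "\<phi> t"] assms(2)
    by (simp add: angle_form_compose_deriv[OF assms] angle_change_def)
  moreover have "inj_on (\<lambda>t. \<Gamma> (\<phi> t)) {0..<1}"
  proof (rule inj_onI)
    fix x y :: real assume xy: "x \<in> {0..<1}" "y \<in> {0..<1}" "\<Gamma> (\<phi> x) = \<Gamma> (\<phi> y)"
    obtain k :: int where k: "\<phi> x = \<phi> y + of_int k * (2 * pi)" using angle_form_inj[OF assms(1) xy(3)] by blast
    have "\<phi> x = \<phi> (y + of_int (if \<sigma> = 1 then k else - k))"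
      using s(1) angle_change_int[of \<phi> \<sigma> y k, OF s(2)] angle_change_int[of \<phi> \<sigma> y "-k", OF s(2)] k by auto
    then have "x = y + of_int (if \<sigma> = 1 then k else - k)" using t(2) by metis
    then show "x = y" using xy(1,2) by auto
  qed
  moreover have "range (\<lambda>t. \<Gamma> (\<phi> t)) = range \<Gamma>"
    using t(1) by (metis (no_types, lifting) image_cong image_image surjI)
  ultimately show ?thesis
    unfolding convex_curve_def
    using smooth_loop_compose[OF angle_formD(1,3)[OF assms(1)] assms(2)] angle_form_frontier[OF assms(1)]
    by simp
qed

section \<open>The tangent angle of a convex curve\<close>

abbreviation curv :: "(real \<Rightarrow> real^2) \<Rightarrow> real \<Rightarrow> real" where
  "curv \<gamma> t \<equiv> cross2 (vderiv \<gamma> t) (vderiv (vderiv \<gamma>) t)"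

definition has_angle_form :: "(real \<Rightarrow> real^2) \<Rightarrow> bool" where
  "has_angle_form \<gamma> \<longleftrightarrow> (\<exists>\<Gamma> \<rho> \<phi>. angle_form \<Gamma> \<rho> \<and> angle_change \<phi> \<and> \<gamma> = (\<lambda>t. \<Gamma> (\<phi> t)))"

definition reverse :: "(real \<Rightarrow> real^2) \<Rightarrow> real \<Rightarrow> real^2" where
  "reverse \<gamma> t = \<gamma> (- t)"

lemma reverse_reverse [simp]: "reverse (reverse \<gamma>) = \<gamma>"
  by (simp add: reverse_def fun_eq_iff)

lemma smooth_reverse: "smooth \<gamma> \<Longrightarrow> smooth (reverse \<gamma>)"
  unfolding reverse_def by (rule smooth_vec_compose, assumption, intro smooth_intros)

lemma vderiv_funpow_reverse:
  assumes "smooth \<gamma>"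
  shows "(vderiv ^^ k) (reverse \<gamma>) = (\<lambda>t. (- 1) ^ k *\<^sub>R (vderiv ^^ k) \<gamma> (- t))"
proof (induction k)
  case (Suc k)
  have "((\<lambda>t. (- 1) ^ k *\<^sub>R (vderiv ^^ k) \<gamma> (- t)) has_vector_derivative
      (- 1) ^ Suc k *\<^sub>R vderiv ((vderiv ^^ k) \<gamma>) (- t)) (at t)" for t
  proof -
    have "((\<lambda>t. - t) has_vector_derivative - 1) (at t)" by (auto intro!: derivative_eq_intros)
    then have "((\<lambda>t. (vderiv ^^ k) \<gamma> (- t)) has_vector_derivative - vderiv ((vderiv ^^ k) \<gamma>) (- t)) (at t)"
      using vector_diff_chain_at[of uminus "-1" t "(vderiv ^^ k) \<gamma>",
          OF _ smooth_has_vderiv[OF smooth_funpow_vderiv[OF assms]]]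
      by (simp add: o_def)
    then show ?thesis
      using bounded_linear.has_vector_derivative[OF bounded_linear_scaleR_right, of _ _ _ "(- 1) ^ k"] by fastforce
  qed
  from vderiv_eqI[OF this] show ?case using Suc by simp
qed (simp add: reverse_def)

lemma vderiv_reverse: "smooth \<gamma> \<Longrightarrow> vderiv (reverse \<gamma>) t = - vderiv \<gamma> (- t)"
  using vderiv_funpow_reverse[of \<gamma> 1] by simp

lemma smooth_loop_reverse: "smooth_loop \<gamma> \<Longrightarrow> smooth_loop (reverse \<gamma>)"
  unfolding smooth_loop_def
  by (metis add.inverse_distrib_swap diff_add_cancel group_cancel.sub1 reverse_def smooth_reverse uminus_add_conv_diff)

lemma Ck_ball_reverse:
  assumes "smooth_loop \<gamma>" "\<eta> \<in> Ck_ball \<gamma> n e"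
  shows "reverse \<eta> \<in> Ck_ball (reverse \<gamma>) n e"
proof -
  have "smooth_loop \<eta>" using assms(2) by (simp add: Ck_ball_def)
  then have "dist ((vderiv ^^ k) (reverse \<eta>) t) ((vderiv ^^ k) (reverse \<gamma>) t)
      = dist ((vderiv ^^ k) \<eta> (- t)) ((vderiv ^^ k) \<gamma> (- t))" for k t
    using assms(1)
    by (simp add: vderiv_funpow_reverse smooth_loop_smooth dist_norm power_abs
        flip: scaleR_diff_right)
  then show ?thesis using assms smooth_loop_reverse by (simp add: Ck_ball_def)
qed

lemma has_angle_form_reverse:
  assumes "has_angle_form \<gamma>"
  shows "has_angle_form (reverse \<gamma>)"
proof -
  obtain \<Gamma> \<rho> \<phi> where g: "angle_form \<Gamma> \<rho>" "angle_change \<phi>" "\<gamma> = (\<lambda>t. \<Gamma> (\<phi> t))"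
    using assms has_angle_form_def by blast
  have sm: "smooth \<phi>" using g(2) by (simp add: angle_change_def)
  have "((\<lambda>t. \<phi> (- t)) has_real_derivative - vderiv \<phi> (- t)) (at t)" for t
  proof -
    have "(uminus has_real_derivative - 1) (at t)" by (auto intro!: derivative_eq_intros)
    then show ?thesis
      using DERIV_chain2[OF smooth_has_real_derivative[OF sm], of uminus "-1" t UNIV] by simp
  qed
  then have 1: "vderiv (\<lambda>t. \<phi> (- t)) = (\<lambda>t. - vderiv \<phi> (- t))" by (rule vderiv_real_eqI)
  have 2: "smooth (\<lambda>t. \<phi> (- t))"
    using sm by (rule smooth_compose) (intro smooth_intros)
  have shift: "- (t + 1) + 1 = - t" for t :: real by simp
  have "\<phi> (- (t + 1)) = \<phi> (- t) - 2 * pi" if "\<forall>t. \<phi> (t + 1) = \<phi> t + 2 * pi" for t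
    using that[rule_format, of "- (t + 1)"] unfolding shift by linarith
  moreover have "\<phi> (- (t + 1)) = \<phi> (- t) + 2 * pi" if "\<forall>t. \<phi> (t + 1) = \<phi> t - 2 * pi" for t
    using that[rule_format, of "- (t + 1)"] unfolding shift by linarith
  ultimately have "angle_change (\<lambda>t. \<phi> (- t))"
    using g(2) 1 2 unfolding angle_change_def by auto
  then show ?thesis
    unfolding has_angle_form_def using g(1,3)
    by (intro exI[of _ \<Gamma>] exI[of _ \<rho>] exI[of _ "\<lambda>t. \<phi> (- t)"]) (simp add: reverse_def fun_eq_iff)
qed

text \<open>
  The angle is obtained by integrating its speed. With \<open>Q = \<gamma>' \<times> e(\<theta>)\<close> and \<open>\<theta>' = \<gamma>' \<times> \<gamma>'' / |\<gamma>'|\<^sup>2\<close> the quotient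
  \<open>Q\<^sup>2 / |\<gamma>'|\<^sup>2\<close> has derivative zero, so that \<open>Q\<close> vanishes once it vanishes initially.
\<close>

lemma tangent_angle:
  assumes "smooth \<gamma>" "\<And>t. vderiv \<gamma> t \<noteq> 0"
  obtains \<theta> where "smooth \<theta>" "\<And>t. vderiv \<gamma> t = norm (vderiv \<gamma> t) *\<^sub>R unit_dir (\<theta> t)"
    "\<And>t. (\<theta> has_real_derivative curv \<gamma> t / (vderiv \<gamma> t \<bullet> vderiv \<gamma> t)) (at t)"
proof -
  define g where "g = vderiv \<gamma>"
  define g' where "g' = vderiv g"
  have g: "smooth g" "smooth g'" "\<And>t. g t \<noteq> 0" "\<And>t. (g has_vector_derivative g' t) (at t)"
    unfolding g_def g'_def using assms smooth_vderiv smooth_has_vderiv by blast+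
  define w where "w t = cross2 (g t) (g' t) / (g t \<bullet> g t)" for t
  have w: "smooth w"
    unfolding w_def using g by (intro smooth_intros) auto
  obtain \<theta>0 where th0: "g 0 = norm (g 0) *\<^sub>R unit_dir \<theta>0" by (rule polar_form)
  obtain \<theta> where th: "\<And>t. (\<theta> has_real_derivative w t) (at t)" "\<theta> 0 = \<theta>0"
    using antiderivative_exists[OF smooth_continuous[OF w]] by blast
  have sm: "smooth \<theta>" using w th(1) by (rule smooth_antideriv)
  define Q where "Q t = cross2 (g t) (unit_dir (\<theta> t))" for t
  define P where "P t = g t \<bullet> unit_dir (\<theta> t)" for t
  have PQ: "P t * P t + Q t * Q t = g t \<bullet> g t" for t
  proof -
    have "P t * P t + Q t * Q t = (g t \<bullet> g t) * ((sin (\<theta> t))\<^sup>2 + (cos (\<theta> t))\<^sup>2)"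
      unfolding P_def Q_def cross2_eq inner2_eq unit_dir_nth by algebra
    then show ?thesis by simp
  qed
  have "((\<lambda>t. Q t * Q t / (g t \<bullet> g t)) has_real_derivative 0) (at t)" for t
  proof -
    have "(Q has_real_derivative cross2 (g' t) (unit_dir (\<theta> t)) +
        cross2 (g t) (w t *\<^sub>R unit_dir (\<theta> t + pi / 2))) (at t)"
      unfolding Q_def
      by (intro cross2_has_real_derivative g unit_dir_has_vector_derivative th)
    moreover have nz: "g t \<bullet> g t \<noteq> 0" using g(3) by simp
    moreover have "cross2 (g' t) (unit_dir (\<theta> t)) + cross2 (g t) (w t *\<^sub>R unit_dir (\<theta> t + pi / 2))
        = (g t \<bullet> g' t) / (g t \<bullet> g t) * Q t"
    proof -
      have "(g t \<bullet> g t) * (cross2 (g' t) (unit_dir (\<theta> t)) + w t * cross2 (g t) (unit_dir (\<theta> t + pi / 2)))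
        = (g t \<bullet> g t) * cross2 (g' t) (unit_dir (\<theta> t)) + cross2 (g t) (g' t) * cross2 (g t) (unit_dir (\<theta> t + pi / 2))"
        unfolding w_def using nz by (simp add: field_simps)
      also have "\<dots> = (g t \<bullet> g' t) * Q t"
        unfolding Q_def by (simp add: cross2_eq inner2_eq cos_add sin_add) algebra
      finally show ?thesis using nz by (simp add: field_simps cross2_eq)
    qed
    ultimately have Q': "(Q has_real_derivative (g t \<bullet> g' t) / (g t \<bullet> g t) * Q t) (at t)" by simp
    have n': "((\<lambda>t. g t \<bullet> g t) has_real_derivative g' t \<bullet> g t + g t \<bullet> g' t) (at t)"
      by (intro inner2_has_real_derivative g)
    show ?thesis
      using DERIV_divide[OF DERIV_mult[OF Q' Q'] n' nz] nz
      by (simp add: inner_commute[of "g' t"] field_simps)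
  qed
  then have "Q t * Q t / (g t \<bullet> g t) = Q 0 * Q 0 / (g 0 \<bullet> g 0)" for t
    using DERIV_isconst_all[of "\<lambda>t. Q t * Q t / (g t \<bullet> g t)" t 0] by blast
  moreover have "Q 0 = 0"
    unfolding Q_def th(2) by (subst th0) (simp add: cross2_eq)
  ultimately have Q0: "Q t = 0" for t using g(3)[of t] by (metis divide_eq_0_iff inner_eq_zero_iff mult_eq_0_iff)
  have Pn: "\<bar>P t\<bar> = norm (g t)" for t
    using PQ[of t] Q0[of t] by (simp add: norm_eq_sqrt_inner real_sqrt_abs2[symmetric])
  have P0: "0 < P 0"
  proof -
    have "P 0 = norm (g 0)" unfolding P_def th(2) by (subst th0) (simp add: inner_unit_dir)
    then show ?thesis using g(3) by simp
  qed
  have Ppos: "0 < P t" for t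
  proof (rule ccontr)
    assume "\<not> 0 < P t"
    moreover have "connected (range P)"
      unfolding P_def using smooth_continuous[OF g(1)] smooth_continuous[OF smooth_unit_dir[OF sm]]
      by (intro connected_continuous_image continuous_intros) auto
    ultimately have "0 \<in> range P"
      using connectedD_interval[of "range P" "P t" "P 0" 0] P0 by (smt (verit) rangeI)
    then show False using Pn g(3) by (metis abs_zero norm_eq_zero rangeE)
  qed
  have "g t = norm (g t) *\<^sub>R unit_dir (\<theta> t)" for t
  proof -
    have "g t = P t *\<^sub>R unit_dir (\<theta> t)"
    proof -
      let ?c = "cos (\<theta> t)" and ?s = "sin (\<theta> t)"
      have q: "g t $ 1 * ?s = g t $ 2 * ?c" using Q0[of t] by (simp add: Q_def cross2_eq)
      have sc: "?s * ?s + ?c * ?c = 1" using sin_cos_squared_add[of "\<theta> t"] by (simp add: power2_eq_square)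
      have "g t $ 1 = P t * ?c" "g t $ 2 = P t * ?s"
        unfolding P_def inner2_eq unit_dir_nth using q sc by algebra+
      then show ?thesis by (simp add: vec2_eq_iff)
    qed
    then show ?thesis using Pn[of t] Ppos[of t] by simp
  qed
  then show ?thesis using that sm th(1) unfolding w_def g'_def g_def by blast
qed

text \<open>
  The speed of the tangent angle has period \<open>1\<close>, so the angle gains the same amount in every
  period, a multiple of a full turn because the direction of the tangent is the same.
\<close>

lemma tangent_angle_turns:
  assumes "smooth_loop \<gamma>" "\<And>t. vderiv \<gamma> t \<noteq> 0"
    and th: "\<And>t. vderiv \<gamma> t = norm (vderiv \<gamma> t) *\<^sub>R unit_dir (\<theta> t)"
    "\<And>t. (\<theta> has_real_derivative curv \<gamma> t / (vderiv \<gamma> t \<bullet> vderiv \<gamma> t)) (at t)"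
  obtains k :: int where "\<And>t. \<theta> (t + 1) = \<theta> t + of_int k * (2 * pi)"
proof -
  have per: "vderiv \<gamma> (t + 1) = vderiv \<gamma> t" "vderiv (vderiv \<gamma>) (t + 1) = vderiv (vderiv \<gamma>) t" for t
    using assms(1) funpow_vderiv_periodic[of \<gamma> 1 1 t] funpow_vderiv_periodic[of \<gamma> 1 2 t]
    by (simp_all add: smooth_loop_def numeral_2_eq_2)
  have "((\<lambda>t. \<theta> (t + 1) - \<theta> t) has_real_derivative 0) (at t)" for t
    using DERIV_diff[OF DERIV_shift[THEN iffD1, OF th(2)[of "t + 1"]] th(2)[of t]]
    by (simp add: per)
  then have const: "\<theta> (t + 1) - \<theta> t = \<theta> (0 + 1) - \<theta> 0" for t
    using DERIV_isconst_all[of "\<lambda>t. \<theta> (t + 1) - \<theta> t" t 0] by blast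
  have "norm (vderiv \<gamma> 0) *\<^sub>R unit_dir (\<theta> (0 + 1)) = norm (vderiv \<gamma> 0) *\<^sub>R unit_dir (\<theta> 0)"
    using th(1)[of 0] th(1)[of "0 + 1"] per(1)[of 0] by simp
  then have "unit_dir (\<theta> (0 + 1)) = unit_dir (\<theta> 0)" using assms(2) by simp
  then obtain k :: int where "\<theta> (0 + 1) = \<theta> 0 + 2 * pi * of_int k"
    using sin_cos_eq_iff[of "\<theta> (0 + 1)" "\<theta> 0"] by (auto simp: vec2_eq_iff)
  then have "\<theta> (t + 1) = \<theta> t + of_int k * (2 * pi)" for t
    using const[of t] by (simp add: algebra_simps)
  then show ?thesis using that by blast
qed

text \<open>
  Positive curvature makes the tangent angle a regular parameter of the curve.
\<close>

lemma angle_form_of_tangent_angle: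
  assumes "smooth_loop \<gamma>" "\<And>t. 0 < curv \<gamma> t" "smooth \<theta>"
    and th: "\<And>t. vderiv \<gamma> t = norm (vderiv \<gamma> t) *\<^sub>R unit_dir (\<theta> t)"
    "\<And>t. (\<theta> has_real_derivative curv \<gamma> t / (vderiv \<gamma> t \<bullet> vderiv \<gamma> t)) (at t)"
    "\<And>t. \<theta> (t + 1) = \<theta> t + 2 * pi"
  shows "has_angle_form \<gamma>"
proof -
  have sm: "smooth \<gamma>" using assms(1) by (rule smooth_loop_smooth)
  have nz: "vderiv \<gamma> t \<noteq> 0" for t using assms(2)[of t] by (auto simp: cross2_eq)
  have pos: "0 < curv \<gamma> t / (vderiv \<gamma> t \<bullet> vderiv \<gamma> t)" for t
    using assms(2)[of t] nz by simp
  have th': "vderiv \<theta> = (\<lambda>t. curv \<gamma> t / (vderiv \<gamma> t \<bullet> vderiv \<gamma> t))"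
    using th(2) by (rule vderiv_real_eqI)
  have ch: "angle_change \<theta>"
    unfolding angle_change_def using assms(3) pos th(3) by (auto simp: th' less_le)
  obtain \<tau> where tau: "smooth \<tau>" "\<And>x. \<theta> (\<tau> x) = x" "\<And>t. \<tau> (\<theta> t) = t"
    "\<And>x. (\<tau> has_real_derivative inverse (vderiv \<theta> (\<tau> x))) (at x)"
    using angle_change_inverse[OF ch] by blast
  define \<Gamma> where "\<Gamma> x = \<gamma> (\<tau> x)" for x
  define \<rho> where "\<rho> x = (vderiv \<gamma> (\<tau> x) \<bullet> unit_dir x) / vderiv \<theta> (\<tau> x)" for x
  have P: "vderiv \<gamma> (\<tau> x) \<bullet> unit_dir x = norm (vderiv \<gamma> (\<tau> x))" for x
    by (subst th(1)) (simp add: tau(2) inner_unit_dir)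
  have "angle_form \<Gamma> \<rho>"
    unfolding angle_form_def
  proof (intro conjI allI)
    show "smooth \<Gamma>" unfolding \<Gamma>_def using sm tau(1) by (rule smooth_vec_compose)
    show "smooth \<rho>"
      unfolding \<rho>_def using ch
      by (intro smooth_divide smooth_inner smooth_vec_compose[OF smooth_vderiv[OF sm] tau(1)]
          smooth_compose[OF smooth_vderiv[OF assms(3)] tau(1)] smooth_unit_dir smooth_ident)
        (auto simp: angle_change_def)
    fix x
    have "\<tau> (x + 2 * pi) = \<tau> x + 1"
      using th(3)[of "\<tau> x"] tau(2,3) by metis
    then show "\<Gamma> (x + 2 * pi) = \<Gamma> x" using assms(1) by (simp add: \<Gamma>_def smooth_loop_def)
    show "0 < \<rho> x" unfolding \<rho>_def P using nz pos[of "\<tau> x"] by (intro divide_pos_pos) (simp_all only: th' zero_less_norm_iff not_False_eq_True)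
    have "(\<Gamma> has_vector_derivative inverse (vderiv \<theta> (\<tau> x)) *\<^sub>R vderiv \<gamma> (\<tau> x)) (at x)"
      using vector_diff_chain_at[of \<tau> "inverse (vderiv \<theta> (\<tau> x))" x \<gamma>] tau(4)[of x] smooth_has_vderiv[OF sm]
      by (simp add: \<Gamma>_def[abs_def] o_def has_real_derivative_iff_has_vector_derivative)
    moreover have "vderiv \<gamma> (\<tau> x) = norm (vderiv \<gamma> (\<tau> x)) *\<^sub>R unit_dir x"
      using th(1)[of "\<tau> x"] tau(2) by simp
    then have "inverse (vderiv \<theta> (\<tau> x)) *\<^sub>R vderiv \<gamma> (\<tau> x)
        = inverse (vderiv \<theta> (\<tau> x)) *\<^sub>R (norm (vderiv \<gamma> (\<tau> x)) *\<^sub>R unit_dir x)"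
      by (rule arg_cong)
    moreover have "inverse (vderiv \<theta> (\<tau> x)) *\<^sub>R (norm (vderiv \<gamma> (\<tau> x)) *\<^sub>R unit_dir x) = \<rho> x *\<^sub>R unit_dir x"
      unfolding \<rho>_def P by (simp add: divide_inverse)
    ultimately show "(\<Gamma> has_vector_derivative \<rho> x *\<^sub>R unit_dir x) (at x)" by metis
  qed
  moreover have "\<gamma> = (\<lambda>t. \<Gamma> (\<theta> t))" by (simp add: \<Gamma>_def tau)
  ultimately show ?thesis using ch unfolding has_angle_form_def by blast
qed

lemma periodic_positive_lower_bound:
  fixes f :: "real \<Rightarrow> real"
  assumes "0 < P" "\<And>t. f (t + P) = f t" "continuous_on UNIV f" "\<And>t. 0 < f t"
  obtains c where "0 < c" "\<And>t. c \<le> f t"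
proof -
  have "continuous_on UNIV (\<lambda>t. inverse (f t))"
    using assms(3,4) by (intro continuous_on_inverse) (metis less_irrefl)+
  then obtain B where B: "0 < B" "\<And>t. norm (inverse (f t)) \<le> B"
    using periodic_bounded[of P "\<lambda>t. inverse (f t)"] assms(1,2) by metis
  have "inverse B \<le> f t" for t
  proof -
    have "inverse (f t) \<le> B" using B(2)[of t] assms(4)[of t] by simp
    then show ?thesis using assms(4)[of t] by (metis inverse_inverse_eq inverse_positive_iff_positive le_imp_inverse_le)
  qed
  then show ?thesis using that[of "inverse B"] B(1) by simp
qed

lemma connected_sign:
  fixes f :: "real \<Rightarrow> real"
  assumes "continuous_on UNIV f" "\<And>t. f t \<noteq> 0"
  shows "(\<forall>t. 0 < f t) \<or> (\<forall>t. f t < 0)"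
proof (rule ccontr)
  assume "\<not> ?thesis"
  then obtain s t where "f s \<le> 0" "0 \<le> f t" by (meson linorder_not_less)
  then have "0 \<in> range f"
    using connectedD_interval[of "range f" "f s" "f t" 0] connected_continuous_image[OF assms(1)] by auto
  then show False using assms(2) by force
qed

text \<open>
  A convex curve that has its region on the left; \<open>p\<close> is a point in the interior of the region.
\<close>

definition left_convex :: "(real \<Rightarrow> real^2) \<Rightarrow> real^2 \<Rightarrow> bool" where
  "left_convex \<gamma> p \<longleftrightarrow> smooth_loop \<gamma> \<and> (\<forall>t. vderiv \<gamma> t \<noteq> 0) \<and> (\<forall>s t. \<gamma> s = \<gamma> t \<longrightarrow> s - t \<in> \<int>) \<and>
     (\<forall>t. 0 < cross2 (vderiv \<gamma> t) (p - \<gamma> t)) \<and> (\<forall>s t. 0 \<le> cross2 (vderiv \<gamma> t) (\<gamma> s - \<gamma> t))"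

text \<open>
  A hull without interior points would lie in a line, and the curve could not be regular at its
  extreme point in the direction of that line. A supporting line at a point of the curve is the
  tangent, since the distance from it has a minimum there.
\<close>

lemma convex_curve_tangent_support:
  assumes "convex_curve \<gamma>"
  shows "interior (convex hull (range \<gamma>)) \<noteq> {}"
    "\<exists>c. c \<noteq> 0 \<and> (\<forall>y \<in> convex hull (range \<gamma>). 0 \<le> c * cross2 (vderiv \<gamma> t) (y - \<gamma> t))"
proof -
  let ?K = "convex hull (range \<gamma>)"
  have sl: "smooth_loop \<gamma>" and nz: "\<And>t. vderiv \<gamma> t \<noteq> 0" and fr: "range \<gamma> = frontier ?K"
    using assms by (auto simp: convex_curve_def)
  have sm: "smooth \<gamma>" using sl by (rule smooth_loop_smooth)
  have dot: "((\<lambda>s. a \<bullet> \<gamma> s) has_real_derivative a \<bullet> vderiv \<gamma> t) (at t)" for a t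
  proof -
    have "((\<lambda>s. a \<bullet> \<gamma> s) has_real_derivative 0 \<bullet> \<gamma> t + a \<bullet> vderiv \<gamma> t) (at t)"
      by (intro inner2_has_real_derivative has_vector_derivative_const smooth_has_vderiv sm)
    then show ?thesis by simp
  qed
  have crit: "a \<bullet> vderiv \<gamma> t = 0" if "\<And>s. a \<bullet> \<gamma> t \<le> a \<bullet> \<gamma> s" for a t
    by (rule DERIV_local_min[OF dot, where d = 1]) (use that in auto)
  have orth: "v = 0" if "a \<bullet> v = 0" "rot a \<bullet> v = 0" "a \<noteq> 0" for a v :: "real^2"
  proof -
    have "(a \<bullet> a) * v $ 1 = 0" "(a \<bullet> a) * v $ 2 = 0"
      using that(1,2) unfolding inner2_eq rot_nth by algebra+
    then show ?thesis using that(3) by (simp add: vec2_eq_iff[of v])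
  qed
  show int: "interior ?K \<noteq> {}"
  proof
    assume "interior ?K = {}"
    then obtain a b where a: "a \<noteq> 0" "?K \<subseteq> {x. a \<bullet> x = b}"
      using empty_interior_subset_hyperplane[OF convex_convex_hull] by metis
    have "a \<bullet> \<gamma> s = b" for s using a(2) hull_inc[of "\<gamma> s" "range \<gamma>"] by blast
    then have 1: "a \<bullet> vderiv \<gamma> t = 0" for t by (intro crit) simp
    have cont: "continuous_on {0..1} (\<lambda>t. rot a \<bullet> \<gamma> t)"
      using smooth_continuous[OF sm] by (intro continuous_intros)
    have "\<exists>t\<in>{0..1}. \<forall>s\<in>{0..1}. rot a \<bullet> \<gamma> t \<le> rot a \<bullet> \<gamma> s"
      using continuous_attains_inf[OF compact_Icc _ cont] by simp
    then obtain t where t: "\<And>s. s \<in> {0..1} \<Longrightarrow> rot a \<bullet> \<gamma> t \<le> rot a \<bullet> \<gamma> s" by blast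
    have "rot a \<bullet> \<gamma> t \<le> rot a \<bullet> \<gamma> s" for s
    proof -
      obtain k :: int where k: "0 \<le> s + of_int k * 1" "s + of_int k * 1 < 0 + 1"
        using shift_into_period[of 1 0 s] by auto
      then have "\<gamma> (s + of_int k * 1) = \<gamma> s"
        using sl by (intro periodic_int_multiple) (simp add: smooth_loop_def)
      then show ?thesis using t[of "s + of_int k * 1"] k by simp
    qed
    then have "rot a \<bullet> vderiv \<gamma> t = 0" by (rule crit)
    then show False using orth 1 a(1) nz by blast
  qed
  have "\<gamma> t \<in> frontier ?K" using fr by blast
  then have "\<gamma> t \<notin> rel_interior ?K"
    using rel_interior_nonempty_interior[OF int] by (simp add: frontier_def)
  moreover have "\<gamma> t \<in> ?K" by (simp add: hull_inc)
  ultimately obtain a where a: "a \<noteq> 0" "\<And>y. y \<in> ?K \<Longrightarrow> a \<bullet> \<gamma> t \<le> a \<bullet> y"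
    using supporting_hyperplane_rel_boundary[OF convex_convex_hull] by metis
  have perp: "a \<bullet> vderiv \<gamma> t = 0"
    using a(2) hull_inc[of _ "range \<gamma>"] by (intro crit) blast
  let ?v = "vderiv \<gamma> t"
  define c where "c = (rot ?v \<bullet> a)"
  have eq: "(?v \<bullet> ?v) * (a \<bullet> (y - \<gamma> t)) = c * cross2 ?v (y - \<gamma> t)" for y
    using perp unfolding c_def inner2_eq cross2_eq rot_nth by algebra
  have "c \<noteq> 0"
    using orth[of ?v a] perp nz[of t] a(1) unfolding c_def by (auto simp: inner_commute)
  moreover have "0 \<le> c * cross2 ?v (y - \<gamma> t)" if "y \<in> ?K" for y
    using a(2)[OF that] unfolding eq[symmetric] by (simp add: inner_diff_right)
  ultimately show "\<exists>c. c \<noteq> 0 \<and> (\<forall>y \<in> ?K. 0 \<le> c * cross2 (vderiv \<gamma> t) (y - \<gamma> t))" by blast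
qed

text \<open>
  The cross product of the tangent vector with the direction to an interior point never vanishes;
  its sign decides on which side of all tangents the region lies.
\<close>

lemma convex_curve_left_convex:
  assumes "convex_curve \<gamma>"
  obtains p where "left_convex \<gamma> p \<or> left_convex (reverse \<gamma>) p"
proof -
  let ?K = "convex hull (range \<gamma>)"
  have sl: "smooth_loop \<gamma>" and nz: "\<And>t. vderiv \<gamma> t \<noteq> 0" and inj: "inj_on \<gamma> {0..<1}"
    using assms by (auto simp: convex_curve_def)
  have sm: "smooth \<gamma>" using sl by (rule smooth_loop_smooth)
  obtain p where p: "p \<in> interior ?K" using convex_curve_tangent_support(1)[OF assms] by blast
  have supp: "\<exists>c. c \<noteq> 0 \<and> (\<forall>y \<in> ?K. 0 \<le> c * cross2 (vderiv \<gamma> t) (y - \<gamma> t)) \<and>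
      0 < c * cross2 (vderiv \<gamma> t) (p - \<gamma> t)" for t
  proof -
    obtain c where c: "c \<noteq> 0" "\<And>y. y \<in> ?K \<Longrightarrow> 0 \<le> c * cross2 (vderiv \<gamma> t) (y - \<gamma> t)"
      using convex_curve_tangent_support(2)[OF assms] by blast
    have lin: "cross2 (c *\<^sub>R v) w = c * cross2 v w" for v w by (simp add: cross2_eq algebra_simps)
    have "0 < cross2 (c *\<^sub>R vderiv \<gamma> t) (p - \<gamma> t)"
      by (rule halfplane_interior[of _ ?K]) (use c nz p lin in auto)
    then have "0 < c * cross2 (vderiv \<gamma> t) (p - \<gamma> t)" unfolding lin .
    then show ?thesis using c by (intro exI[of _ c] conjI ballI)
  qed
  let ?f = "\<lambda>t. cross2 (vderiv \<gamma> t) (p - \<gamma> t)"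
  have "continuous_on UNIV ?f"
    using sm by (intro smooth_continuous smooth_intros smooth_vderiv)
  then have sign: "(\<forall>t. 0 < ?f t) \<or> (\<forall>t. ?f t < 0)"
    by (rule connected_sign) (use supp in \<open>metis mult_zero_right less_irrefl\<close>)
  have inK: "\<gamma> s \<in> ?K" for s using hull_inc[of "\<gamma> s" "range \<gamma>"] by blast
  have injZ: "s - t \<in> \<int>" if "\<gamma> s = \<gamma> t" for s t
  proof -
    obtain j :: int where j: "0 \<le> s + of_int j * 1" "s + of_int j * 1 < 0 + 1"
      using shift_into_period[of 1 0 s] by auto
    obtain k :: int where k: "0 \<le> t + of_int k * 1" "t + of_int k * 1 < 0 + 1"
      using shift_into_period[of 1 0 t] by auto
    have "\<gamma> (r + of_int l * 1) = \<gamma> r" for r l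
      using sl by (intro periodic_int_multiple) (simp add: smooth_loop_def)
    then have "\<gamma> (s + of_int j * 1) = \<gamma> (t + of_int k * 1)" using that by metis
    then have "s + of_int j * 1 = t + of_int k * 1" using j k by (intro inj_onD[OF inj]) auto
    then have "s - t = of_int (k - j)" by simp
    then show ?thesis by (metis Ints_of_int)
  qed
  have "left_convex \<gamma> p \<or> left_convex (reverse \<gamma>) p"
    using sign
  proof
    assume pos: "\<forall>t. 0 < ?f t"
    have "0 \<le> cross2 (vderiv \<gamma> t) (\<gamma> s - \<gamma> t)" for s t
      using supp[of t] pos inK[of s] by (metis zero_less_mult_pos2 zero_le_mult_iff not_less)
    then show "left_convex \<gamma> p \<or> left_convex (reverse \<gamma>) p"
      using sl nz injZ pos unfolding left_convex_def by blast
  next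
    assume neg: "\<forall>t. ?f t < 0"
    have le: "cross2 (vderiv \<gamma> t) (\<gamma> s - \<gamma> t) \<le> 0" for s t
    proof -
      obtain c where c: "0 \<le> c * cross2 (vderiv \<gamma> t) (\<gamma> s - \<gamma> t)" "0 < c * ?f t"
        using supp[of t] inK[of s] by blast
      then have "c < 0" using neg[rule_format, of t] by (simp add: zero_less_mult_iff)
      then show ?thesis using c(1) by (simp add: zero_le_mult_iff)
    qed
    have minus: "cross2 (- v) w = - cross2 v w" for v w by (simp add: cross2_eq)
    have "left_convex (reverse \<gamma>) p"
      unfolding left_convex_def vderiv_reverse[OF sm] minus
      using smooth_loop_reverse[OF sl] nz neg le
    proof (intro conjI allI impI)
      fix s t assume "reverse \<gamma> s = reverse \<gamma> t"
      then have "- t - - s \<in> \<int>" using injZ[of "- t" "- s"] by (simp add: reverse_def)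
      then show "s - t \<in> \<int>" by simp
    qed (auto simp: reverse_def)
    then show "left_convex \<gamma> p \<or> left_convex (reverse \<gamma>) p" by blast
  qed
  then show ?thesis by (rule that)
qed

text \<open>
  Where the curvature is negative the curve passes to the wrong side of its tangent.
\<close>

lemma left_convex_curv_nonneg:
  assumes "left_convex \<gamma> p"
  shows "0 \<le> curv \<gamma> t"
proof (rule ccontr)
  assume neg: "\<not> 0 \<le> curv \<gamma> t"
  have sm: "smooth \<gamma>" and supp: "\<And>s. 0 \<le> cross2 (vderiv \<gamma> t) (\<gamma> s - \<gamma> t)"
    using assms by (auto simp: left_convex_def smooth_loop_def)
  define h where "h s = cross2 (vderiv \<gamma> t) (\<gamma> s - \<gamma> t)" for s
  define h' where "h' s = cross2 (vderiv \<gamma> t) (vderiv \<gamma> s)" for s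
  have h: "(h has_real_derivative h' s) (at s)" for s
  proof -
    have "(h has_real_derivative cross2 0 (\<gamma> s - \<gamma> t) + cross2 (vderiv \<gamma> t) (vderiv \<gamma> s - 0)) (at s)"
      unfolding h_def by (intro cross2_has_real_derivative has_vector_derivative_diff
          has_vector_derivative_const smooth_has_vderiv sm)
    then show ?thesis by (simp add: h'_def cross2_eq)
  qed
  have "(h' has_real_derivative curv \<gamma> t) (at t)"
  proof -
    have "(h' has_real_derivative cross2 0 (vderiv \<gamma> t) + curv \<gamma> t) (at t)"
      unfolding h'_def by (intro cross2_has_real_derivative has_vector_derivative_const
          smooth_has_vderiv smooth_vderiv sm)
    then show ?thesis by (simp add: cross2_eq)
  qed
  then obtain d where d: "0 < d" "\<And>x. 0 < x \<Longrightarrow> x < d \<Longrightarrow> h' (t + x) < h' t"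
    using DERIV_neg_dec_right neg by (metis not_le)
  have "h (t + d / 2) < h t"
  proof (rule DERIV_neg_imp_decreasing_open[where f = h and a = t and b = "t + d / 2"])
    show "t < t + d / 2" using d(1) by simp
    show "continuous_on {t..t + d / 2} h"
      using h by (meson DERIV_continuous continuous_at_imp_continuous_on)
    fix x assume "t < x" "x < t + d / 2"
    then have "h' x < h' t" using d(2)[of "x - t"] d(1) by simp
    then show "\<exists>y. (h has_real_derivative y) (at x) \<and> y < 0"
      using h[of x] by (auto simp: h'_def cross2_eq)
  qed
  then show False using supp[of "t + d / 2"] by (simp add: h_def cross2_eq)
qed

text \<open>
  If the curve turned more than once, two of its points would have the same tangent direction,
  the first of them with positive curvature. Both tangents support the curve
  on the same side, so the height of the second point above the tangent lines attains its
  minimum \<open>0\<close> at the first point. Its derivative there is a multiple of the curvature, the factor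
  being proportional to the distance of the two points, which therefore coincide.
\<close>

lemma left_convex_turns_once:
  assumes lc: "left_convex \<gamma> p" and sm\<theta>: "smooth \<theta>"
    and th: "\<And>t. vderiv \<gamma> t = norm (vderiv \<gamma> t) *\<^sub>R unit_dir (\<theta> t)"
    "\<And>t. (\<theta> has_real_derivative curv \<gamma> t / (vderiv \<gamma> t \<bullet> vderiv \<gamma> t)) (at t)"
  shows "\<theta> (t + 1) = \<theta> t + 2 * pi"
proof -
  have sl: "smooth_loop \<gamma>" and nz: "\<And>t. vderiv \<gamma> t \<noteq> 0" and inj: "\<And>s t. \<gamma> s = \<gamma> t \<Longrightarrow> s - t \<in> \<int>"
    and supp: "\<And>s t. 0 \<le> cross2 (vderiv \<gamma> t) (\<gamma> s - \<gamma> t)"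
    using lc by (auto simp: left_convex_def)
  have sm: "smooth \<gamma>" using sl by (rule smooth_loop_smooth)
  obtain k :: int where k: "\<And>t. \<theta> (t + 1) = \<theta> t + of_int k * (2 * pi)"
    using tangent_angle_turns[OF sl nz th] by blast
  let ?w = "\<lambda>t. curv \<gamma> t / (vderiv \<gamma> t \<bullet> vderiv \<gamma> t)"
  have w: "0 \<le> ?w t" for t using left_convex_curv_nonneg[OF lc, of t] by simp
  have mono: "\<theta> s \<le> \<theta> t" if "s \<le> t" for s t
    using that by (rule DERIV_nonneg_imp_nondecreasing) (use th(2) w in blast)
  have contth: "continuous_on S \<theta>" for S using sm\<theta> by (rule smooth_continuous)
  have "k = 1"
  proof (rule ccontr)
    assume "k \<noteq> 1"
    have "0 \<le> of_int k * (2 * pi)" using mono[of 0 1] k[of 0] by simp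
    then have "0 \<le> k" using pi_gt_zero by (simp add: zero_le_mult_iff)
    then consider "k = 0" | "2 \<le> k" using \<open>k \<noteq> 1\<close> by linarith
    then show False
    proof cases
      case 1
      then have const: "\<theta> s = \<theta> 0" if "0 \<le> s" "s \<le> 1" for s
        using mono[of 0 s] mono[of s 1] k[of 0] that by simp
      have "unit_dir (\<theta> 0) \<bullet> \<gamma> 0 < unit_dir (\<theta> 0) \<bullet> \<gamma> 1"
      proof (rule DERIV_pos_imp_increasing[where f = "\<lambda>s. unit_dir (\<theta> 0) \<bullet> \<gamma> s" and a = 0 and b = 1])
        fix x :: real assume x: "0 \<le> x" "x \<le> 1"
        have "((\<lambda>s. unit_dir (\<theta> 0) \<bullet> \<gamma> s) has_real_derivative unit_dir (\<theta> 0) \<bullet> vderiv \<gamma> x) (at x)"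
        proof -
          have "((\<lambda>s. unit_dir (\<theta> 0) \<bullet> \<gamma> s) has_real_derivative 0 \<bullet> \<gamma> x + unit_dir (\<theta> 0) \<bullet> vderiv \<gamma> x) (at x)"
            by (intro inner2_has_real_derivative has_vector_derivative_const smooth_has_vderiv sm)
          then show ?thesis by simp
        qed
        moreover have "unit_dir (\<theta> 0) \<bullet> vderiv \<gamma> x = norm (vderiv \<gamma> x)"
          using const[OF x] by (subst th(1)) (simp add: inner_unit_dir)
        ultimately show "\<exists>y. ((\<lambda>s. unit_dir (\<theta> 0) \<bullet> \<gamma> s) has_real_derivative y) (at x) \<and> 0 < y"
          using nz[of x] by auto
      qed simp
      moreover have "\<gamma> 1 = \<gamma> (0 + 1)" by simp
      then have "\<gamma> 1 = \<gamma> 0" using sl unfolding smooth_loop_def by metis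
      ultimately show False by simp
    next
      case 2
      then have "2 * (2 * pi) \<le> of_int k * (2 * pi)" by (intro mult_right_mono) auto
      then have four: "\<theta> 0 + 4 * pi \<le> \<theta> 1" using k[of 0] by simp
      then obtain u where u: "0 \<le> u" "u \<le> 1" "\<theta> u = \<theta> 0 + 2 * pi"
        using IVT'[of \<theta> 0 "\<theta> 0 + 2 * pi" 1] contth pi_gt_zero by auto
      have "u \<noteq> 0" using u(3) pi_gt_zero by auto
      then have "0 < u" using u(1) by simp
      then obtain t1 where t1: "0 < t1" "t1 < u" "\<theta> u - \<theta> 0 = (u - 0) * ?w t1"
        using MVT2[of 0 u \<theta> ?w] th(2) by auto
      have "u * ?w t1 = 2 * pi" using t1(3) u(3) by (metis add_diff_cancel_left' diff_zero)
      then have "0 < u * ?w t1" using pi_gt_zero by linarith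
      then have "0 < ?w t1" using \<open>0 < u\<close> by (rule zero_less_mult_pos)
      then have curv: "curv \<gamma> t1 \<noteq> 0" by auto
      have "\<theta> t1 + 2 * pi \<le> \<theta> 1" using mono[of t1 u] t1 u four by simp
      then obtain t2 where t2: "t1 \<le> t2" "t2 \<le> 1" "\<theta> t2 = \<theta> t1 + 2 * pi"
        using IVT'[of \<theta> t1 "\<theta> t1 + 2 * pi" 1] contth pi_gt_zero t1 u by auto
      have "t1 \<noteq> t2" using t2(3) pi_gt_zero by auto
      have dir: "vderiv \<gamma> t2 = (norm (vderiv \<gamma> t2) / norm (vderiv \<gamma> t1)) *\<^sub>R vderiv \<gamma> t1"
        using th(1)[of t2] nz[of t1] t2(3)
        by (subst th(1)[of t1]) simp
      have scal: "cross2 (c *\<^sub>R v) (x - y) = - (c * cross2 v (y - x))" for c v x y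
        by (simp add: cross2_eq algebra_simps)
      have "0 \<le> - ((norm (vderiv \<gamma> t2) / norm (vderiv \<gamma> t1)) * cross2 (vderiv \<gamma> t1) (\<gamma> t2 - \<gamma> t1))"
        using supp[of t2 t1] dir scal by metis
      moreover have "0 < norm (vderiv \<gamma> t2) / norm (vderiv \<gamma> t1)" using nz by simp
      ultimately have "cross2 (vderiv \<gamma> t1) (\<gamma> t2 - \<gamma> t1) \<le> 0"
        by (metis mult_pos_pos neg_0_le_iff_le not_less)
      then have zero: "cross2 (vderiv \<gamma> t1) (\<gamma> t2 - \<gamma> t1) = 0" using supp[of t1 t2] by linarith
      have der: "((\<lambda>s. cross2 (vderiv \<gamma> s) (\<gamma> t2 - \<gamma> s)) has_real_derivative
          cross2 (vderiv (vderiv \<gamma>) t1) (\<gamma> t2 - \<gamma> t1) + cross2 (vderiv \<gamma> t1) (0 - vderiv \<gamma> t1)) (at t1)"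
        by (intro cross2_has_real_derivative has_vector_derivative_diff smooth_has_vderiv
            has_vector_derivative_const smooth_vderiv sm)
      have "cross2 (vderiv (vderiv \<gamma>) t1) (\<gamma> t2 - \<gamma> t1) + cross2 (vderiv \<gamma> t1) (0 - vderiv \<gamma> t1) = 0"
        by (rule DERIV_local_min[OF der, where d = 1]) (use zero supp in auto)
      then have "cross2 (vderiv (vderiv \<gamma>) t1) (\<gamma> t2 - \<gamma> t1) = 0" by (simp add: cross2_eq)
      then have "\<gamma> t2 - \<gamma> t1 = 0" using cross2_both_zero[OF zero] curv by blast
      then have "t2 - t1 \<in> \<int>" using inj by simp
      then obtain j :: int where "t2 - t1 = of_int j" by (auto elim: Ints_cases)
      moreover have "0 < t2 - t1" "t2 - t1 < 1" using t1(1) t2(1,2) \<open>t1 \<noteq> t2\<close> by auto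
      ultimately show False by simp
    qed
  qed
  then show ?thesis using k by simp
qed

text \<open>
  Curves of positive curvature are dense: pulling every point towards an interior point by an
  amount that grows with the distance makes straight lines bend.
\<close>

lemma left_convex_approx:
  assumes lc: "left_convex \<gamma> p" and "0 < e"
  shows "\<exists>\<eta> \<in> Ck_ball \<gamma> n e. has_angle_form \<eta>"
proof -
  have sl: "smooth_loop \<gamma>" and nz: "\<And>t. vderiv \<gamma> t \<noteq> 0"
    and inner: "\<And>t. 0 < cross2 (vderiv \<gamma> t) (p - \<gamma> t)"
    using lc by (auto simp: left_convex_def)
  have sm: "smooth \<gamma>" using sl by (rule smooth_loop_smooth)
  define g where "g = vderiv \<gamma>"
  define g' where "g' = vderiv g"
  define x where "x t = \<gamma> t - p" for t
  have g: "smooth g" "smooth g'" "\<And>t. (g has_vector_derivative g' t) (at t)" "\<And>t. g t \<noteq> 0"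
    unfolding g_def g'_def using sm nz smooth_vderiv smooth_has_vderiv by blast+
  have x: "smooth x" "\<And>t. (x has_vector_derivative g t) (at t)"
    unfolding x_def g_def using sm by (auto intro!: smooth_intros simp: has_vector_derivative_diff_const smooth_has_vderiv)
  have per: "x (t + 1) = x t" "g (t + 1) = g t" "g' (t + 1) = g' t" for t
    using sl funpow_vderiv_periodic[of \<gamma> 1 1 t] funpow_vderiv_periodic[of \<gamma> 1 2 t]
    by (simp_all add: smooth_loop_def numeral_2_eq_2 x_def g_def g'_def)
  define F where "F t = (- (x t \<bullet> x t)) *\<^sub>R x t" for t
  define F' where "F' t = (- (x t \<bullet> x t)) *\<^sub>R g t + (- (2 * (x t \<bullet> g t))) *\<^sub>R x t" for t
  define F'' where "F'' t = (- (x t \<bullet> x t)) *\<^sub>R g' t + (- (4 * (x t \<bullet> g t))) *\<^sub>R g t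
      + (- (2 * (g t \<bullet> g t + x t \<bullet> g' t))) *\<^sub>R x t" for t
  have xx: "((\<lambda>t. x t \<bullet> x t) has_real_derivative 2 * (x t \<bullet> g t)) (at t)" for t
    using inner2_has_real_derivative[OF x(2) x(2)] by (simp add: inner_commute)
  have xg: "((\<lambda>t. x t \<bullet> g t) has_real_derivative g t \<bullet> g t + x t \<bullet> g' t) (at t)" for t
    using inner2_has_real_derivative[OF x(2) g(3)] by simp
  have F: "(F has_vector_derivative F' t) (at t)" for t
    unfolding F_def F'_def
    using has_vector_derivative_scaleR[OF DERIV_minus[OF xx] x(2)] by simp
  have F': "(F' has_vector_derivative F'' t) (at t)" for t
  proof -
    have "(F' has_vector_derivative ((- (x t \<bullet> x t)) *\<^sub>R g' t + (- (2 * (x t \<bullet> g t))) *\<^sub>R g t) +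
       ((- (2 * (x t \<bullet> g t))) *\<^sub>R g t + (- (2 * (g t \<bullet> g t + x t \<bullet> g' t))) *\<^sub>R x t)) (at t)"
      unfolding F'_def
      by (intro has_vector_derivative_add has_vector_derivative_scaleR DERIV_minus DERIV_cmult xx xg x g)
    moreover have "((- (x t \<bullet> x t)) *\<^sub>R g' t + (- (2 * (x t \<bullet> g t))) *\<^sub>R g t) +
       ((- (2 * (x t \<bullet> g t))) *\<^sub>R g t + (- (2 * (g t \<bullet> g t + x t \<bullet> g' t))) *\<^sub>R x t) = F'' t"
      unfolding F''_def by (simp add: vec2_eq_iff algebra_simps)
    ultimately show ?thesis by simp
  qed
  have smF: "smooth F" "smooth F'" "smooth F''"
    unfolding F_def F'_def F''_def using x g by (intro smooth_intros; simp)+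
  have slF: "smooth_loop F" using smF per by (simp add: smooth_loop_def F_def)
  \<comment> \<open>The cross product of the first two derivatives is a quadratic polynomial in the perturbation
    parameter; \<open>h\<close> is its leading coefficient.\<close>
  define h where "h t = cross2 (F' t) (F'' t)" for t
  have quad: "cross2 (g t + \<epsilon> *\<^sub>R F' t) (g' t + \<epsilon> *\<^sub>R F'' t) =
      (1 - 4 * \<epsilon> * (x t \<bullet> x t)) * cross2 (g t) (g' t)
      - 2 * \<epsilon> * ((g t \<bullet> g t) * cross2 (g t) (x t)) + \<epsilon>\<^sup>2 * h t" for t \<epsilon>
  proof -
    have "cross2 (g t + \<epsilon> *\<^sub>R F' t) (g' t + \<epsilon> *\<^sub>R F'' t) =
        cross2 (g t) (g' t) + \<epsilon> * (cross2 (g t) (F'' t) + cross2 (F' t) (g' t)) + \<epsilon>\<^sup>2 * h t"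
      unfolding h_def by (simp add: cross2_eq algebra_simps power2_eq_square)
    also have "cross2 (g t) (F'' t) + cross2 (F' t) (g' t)
        = - 4 * (x t \<bullet> x t) * cross2 (g t) (g' t) - 2 * ((g t \<bullet> g t) * cross2 (g t) (x t))"
      unfolding F'_def F''_def by (simp add: cross2_eq inner2_eq algebra_simps)
    finally show ?thesis by (simp add: algebra_simps)
  qed
  obtain B where B: "0 < B" "\<And>t. norm (x t \<bullet> x t) \<le> B"
    by (rule periodic_bounded[of 1 "\<lambda>t. x t \<bullet> x t"])
      (use per smooth_continuous[OF x(1)] in \<open>auto intro!: continuous_intros\<close>)
  obtain H where H: "0 < H" "\<And>t. norm (h t) \<le> H"
  proof (rule periodic_bounded[of 1 h])
    show "continuous_on UNIV h" unfolding h_def using smF by (intro smooth_continuous smooth_intros)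
  qed (use per in \<open>auto simp: h_def F'_def F''_def\<close>)
  have posC: "0 < (g t \<bullet> g t) * cross2 (g t) (p - \<gamma> t)" for t
    using inner[of t] g(4)[of t] by (intro mult_pos_pos) (auto simp: g_def)
  have negx: "cross2 (g t) (p - \<gamma> t) = - cross2 (g t) (x t)" for t
    by (simp add: x_def cross2_eq algebra_simps)
  obtain c where c: "0 < c" "\<And>t. c \<le> - ((g t \<bullet> g t) * cross2 (g t) (x t))"
  proof (rule periodic_positive_lower_bound[of 1 "\<lambda>t. - ((g t \<bullet> g t) * cross2 (g t) (x t))"])
    show "continuous_on UNIV (\<lambda>t. - ((g t \<bullet> g t) * cross2 (g t) (x t)))"
      using g x by (intro smooth_continuous smooth_intros)
  qed (use per posC negx in auto)
  obtain d where d: "0 < d" "\<And>u v. \<bar>u\<bar> < d \<Longrightarrow> \<bar>v\<bar> < d \<Longrightarrow> (\<lambda>t. \<gamma> t + u *\<^sub>R F t + v *\<^sub>R F t) \<in> Ck_ball \<gamma> n e"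
    by (rule Ck_ball_perturbation[OF sl slF slF assms(2), of n]) blast
  \<comment> \<open>The bound by \<open>1 / (8 * B)\<close> keeps the first term nonnegative and the new tangents close to the old ones;
    the bound by \<open>c / H\<close> makes the second term dominate the third.\<close>
  define \<epsilon> where "\<epsilon> = min (d / 2) (min (1 / (8 * B)) (c / H))"
  have eps: "0 < \<epsilon>" "\<epsilon> < d" "\<epsilon> * B \<le> 1 / 8" "\<epsilon> * H \<le> c"
  proof -
    show "0 < \<epsilon>" "\<epsilon> < d" unfolding \<epsilon>_def using d(1) B(1) H(1) c(1) by auto
    have "\<epsilon> \<le> 1 / (8 * B)" "\<epsilon> \<le> c / H" unfolding \<epsilon>_def by auto
    then show "\<epsilon> * B \<le> 1 / 8" "\<epsilon> * H \<le> c" using B(1) H(1) by (simp_all add: field_simps)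
  qed
  have exx: "\<epsilon> * (x t \<bullet> x t) \<le> 1 / 8" for t
  proof -
    have "\<epsilon> * (x t \<bullet> x t) \<le> \<epsilon> * B" using B(2)[of t] eps(1) by (intro mult_left_mono) auto
    then show ?thesis using eps(3) by simp
  qed
  define \<eta> where "\<eta> t = \<gamma> t + \<epsilon> *\<^sub>R F t" for t
  have ball: "\<eta> \<in> Ck_ball \<gamma> n e" using d(2)[of \<epsilon> 0] eps d(1) by (simp add: \<eta>_def[abs_def])
  then have sl\<eta>: "smooth_loop \<eta>" by (simp add: Ck_ball_def)
  have d1: "vderiv \<eta> = (\<lambda>t. g t + \<epsilon> *\<^sub>R F' t)"
    unfolding \<eta>_def
    by (intro vderiv_eqI has_vector_derivative_add F
        bounded_linear.has_vector_derivative[OF bounded_linear_scaleR_right])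
      (simp add: g_def smooth_has_vderiv[OF sm])
  have d2: "vderiv (vderiv \<eta>) = (\<lambda>t. g' t + \<epsilon> *\<^sub>R F'' t)"
    unfolding d1
    by (intro vderiv_eqI has_vector_derivative_add F' g
        bounded_linear.has_vector_derivative[OF bounded_linear_scaleR_right])
  have cpos: "0 < curv \<eta> t" for t
  proof -
    have k: "0 \<le> cross2 (g t) (g' t)"
      using left_convex_curv_nonneg[OF lc, of t] by (simp add: g_def g'_def)
    have "0 \<le> (1 - 4 * \<epsilon> * (x t \<bullet> x t)) * cross2 (g t) (g' t)"
      using exx[of t] k by (intro mult_nonneg_nonneg) auto
    moreover have "2 * \<epsilon> * c \<le> - (2 * \<epsilon> * ((g t \<bullet> g t) * cross2 (g t) (x t)))"
      using mult_left_mono[OF c(2)[of t], of "2 * \<epsilon>"] eps(1) by simp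
    moreover have "- (\<epsilon> * c) \<le> \<epsilon>\<^sup>2 * h t"
    proof -
      have "\<epsilon> * (\<epsilon> * \<bar>h t\<bar>) \<le> \<epsilon> * (\<epsilon> * H)"
        using H(2)[of t] eps(1) by (intro mult_left_mono) auto
      also have "\<dots> \<le> \<epsilon> * c" using eps by (intro mult_left_mono) auto
      finally have "\<bar>\<epsilon>\<^sup>2 * h t\<bar> \<le> \<epsilon> * c" by (simp add: abs_mult power2_eq_square mult.assoc)
      then show ?thesis by linarith
    qed
    moreover have "0 < \<epsilon> * c" using eps(1) c(1) by simp
    ultimately have "0 < cross2 (g t + \<epsilon> *\<^sub>R F' t) (g' t + \<epsilon> *\<^sub>R F'' t)"
      unfolding quad by linarith
    then show ?thesis by (simp only: fun_cong[OF d1] fun_cong[OF d2])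
  qed
  have nz\<eta>: "vderiv \<eta> t \<noteq> 0" for t using cpos[of t] by (auto simp: cross2_eq)
  have acute: "0 < vderiv \<eta> t \<bullet> vderiv \<gamma> t" for t
  proof -
    have "(x t \<bullet> g t)\<^sup>2 \<le> (x t \<bullet> x t) * (g t \<bullet> g t)" by (rule Cauchy_Schwarz_ineq)
    then have "\<epsilon> * (x t \<bullet> g t)\<^sup>2 \<le> \<epsilon> * ((x t \<bullet> x t) * (g t \<bullet> g t))"
      using eps(1) by (intro mult_left_mono) auto
    moreover have gg: "0 < g t \<bullet> g t" using g(4)[of t] by simp
    then have "\<epsilon> * (x t \<bullet> x t) * (g t \<bullet> g t) \<le> 1 / 8 * (g t \<bullet> g t)"
      using exx[of t] by (intro mult_right_mono) auto
    moreover have "vderiv \<eta> t \<bullet> vderiv \<gamma> t = g t \<bullet> g t - \<epsilon> * (x t \<bullet> x t) * (g t \<bullet> g t) - 2 * (\<epsilon> * (x t \<bullet> g t)\<^sup>2)"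
      unfolding d1 F'_def g_def[symmetric]
      by (simp add: inner_add_left power2_eq_square algebra_simps)
    ultimately show ?thesis using gg unfolding mult.assoc by linarith
  qed
  obtain \<theta> where th: "smooth \<theta>" "\<And>t. vderiv \<gamma> t = norm (vderiv \<gamma> t) *\<^sub>R unit_dir (\<theta> t)"
    "\<And>t. (\<theta> has_real_derivative curv \<gamma> t / (vderiv \<gamma> t \<bullet> vderiv \<gamma> t)) (at t)"
    using tangent_angle[OF sm nz] by blast
  obtain \<psi> where ps: "smooth \<psi>" "\<And>t. vderiv \<eta> t = norm (vderiv \<eta> t) *\<^sub>R unit_dir (\<psi> t)"
    "\<And>t. (\<psi> has_real_derivative curv \<eta> t / (vderiv \<eta> t \<bullet> vderiv \<eta> t)) (at t)"
    using tangent_angle[OF smooth_loop_smooth[OF sl\<eta>] nz\<eta>] by blast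
  obtain k :: int where k: "\<And>t. \<psi> (t + 1) = \<psi> t + of_int k * (2 * pi)"
    using tangent_angle_turns[OF sl\<eta> nz\<eta> ps(2,3)] by blast
  have th1: "\<theta> (t + 1) = \<theta> t + 2 * pi" for t
    using left_convex_turns_once[OF lc th] .
  \<comment> \<open>Tangents of the two curves always form an acute angle. If the numbers of turns were different, the
    tangents would have opposite directions somewhere.\<close>
  have cospos: "0 < cos (\<psi> t - \<theta> t)" for t
  proof -
    have "vderiv \<eta> t \<bullet> vderiv \<gamma> t = norm (vderiv \<eta> t) * norm (vderiv \<gamma> t) * cos (\<psi> t - \<theta> t)"
      by (subst ps(2), subst th(2)) (simp add: inner_unit_dir cos_diff mult.commute)
    moreover have "0 < norm (vderiv \<eta> t) * norm (vderiv \<gamma> t)" using nz[of t] nz\<eta>[of t] by simp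
    ultimately show ?thesis using acute[of t] zero_less_mult_pos by metis
  qed
  have "k = 1"
  proof (rule ccontr)
    assume "k \<noteq> 1"
    let ?D = "\<lambda>t. \<psi> t - \<theta> t"
    have D1: "?D 1 = ?D 0 + of_int (k - 1) * (2 * pi)"
      using k[of 0] th1[of 0] by (simp add: algebra_simps)
    have conn: "connected (range ?D)"
      using smooth_continuous[OF th(1)] smooth_continuous[OF ps(1)]
      by (intro connected_continuous_image continuous_intros) simp_all
    have "?D 0 + pi \<in> range ?D \<or> ?D 0 - pi \<in> range ?D"
    proof (cases "2 \<le> k")
      case True
      then have "1 * (2 * pi) \<le> of_int (k - 1) * (2 * pi)" by (intro mult_right_mono) auto
      then have "?D 0 + pi \<le> ?D 1" using D1 pi_gt_zero by linarith
      then have "?D 0 + pi \<in> range ?D"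
        using pi_ge_zero by (intro connectedD_interval[OF conn rangeI[of ?D 0] rangeI[of ?D 1]]) linarith+
      then show ?thesis ..
    next
      case False
      then have "k - 1 \<le> - 1" using \<open>k \<noteq> 1\<close> by simp
      then have "of_int (k - 1) * (2 * pi) \<le> - 1 * (2 * pi)" by (intro mult_right_mono) (linarith | simp)+
      then have "?D 1 \<le> ?D 0 - pi" using D1 pi_gt_zero by linarith
      then have "?D 0 - pi \<in> range ?D"
        using pi_ge_zero by (intro connectedD_interval[OF conn rangeI[of ?D 1] rangeI[of ?D 0]]) linarith+
      then show ?thesis ..
    qed
    then obtain s where "?D s = ?D 0 + pi \<or> ?D s = ?D 0 - pi" by fastforce
    then have "cos (?D s) = - cos (?D 0)" using cos_minus_pi[of "?D 0"] by auto
    then show False using cospos[of s] cospos[of 0] by simp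
  qed
  then have "has_angle_form \<eta>"
    using angle_form_of_tangent_angle[OF sl\<eta> cpos ps] k by simp
  then show ?thesis using ball by blast
qed

lemma has_angle_form_dense:
  assumes "convex_curve \<gamma>" "0 < e"
  shows "\<exists>\<eta> \<in> Ck_ball \<gamma> n e. has_angle_form \<eta>"
proof -
  obtain p where "left_convex \<gamma> p \<or> left_convex (reverse \<gamma>) p"
    using convex_curve_left_convex[OF assms(1)] by blast
  then show ?thesis
  proof
    assume "left_convex (reverse \<gamma>) p"
    then obtain \<eta> where e: "\<eta> \<in> Ck_ball (reverse \<gamma>) n e" "has_angle_form \<eta>"
      using left_convex_approx assms(2) by blast
    have "smooth_loop (reverse \<gamma>)"
      using assms(1) smooth_loop_reverse by (simp add: convex_curve_def)
    then have "reverse \<eta> \<in> Ck_ball \<gamma> n e" using Ck_ball_reverse[OF _ e(1)] by simp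
    then show ?thesis using has_angle_form_reverse[OF e(2)] by blast
  qed (use left_convex_approx assms(2) in blast)
qed

lemma convex_curve_has_angle_form:
  assumes "convex_curve \<gamma>" "\<And>t. curv \<gamma> t \<noteq> 0"
  shows "has_angle_form \<gamma>"
proof -
  have pos: "has_angle_form \<beta>" if lc: "left_convex \<beta> p" and nz: "\<And>t. curv \<beta> t \<noteq> 0" for \<beta> p
  proof -
    have sl: "smooth_loop \<beta>" and reg: "\<And>t. vderiv \<beta> t \<noteq> 0" using lc by (auto simp: left_convex_def)
    obtain \<theta> where th: "smooth \<theta>" "\<And>t. vderiv \<beta> t = norm (vderiv \<beta> t) *\<^sub>R unit_dir (\<theta> t)"
      "\<And>t. (\<theta> has_real_derivative curv \<beta> t / (vderiv \<beta> t \<bullet> vderiv \<beta> t)) (at t)"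
      using tangent_angle[OF smooth_loop_smooth[OF sl] reg] by blast
    have "0 < curv \<beta> t" for t
      using left_convex_curv_nonneg[OF lc, of t] nz[of t] by simp
    then show ?thesis
      using angle_form_of_tangent_angle[OF sl _ th left_convex_turns_once[OF lc th]] by blast
  qed
  have sm: "smooth \<gamma>" using assms(1) by (simp add: convex_curve_def smooth_loop_def)
  have "curv (reverse \<gamma>) t = - curv \<gamma> (- t)" for t
    using vderiv_funpow_reverse[OF sm, of 1] vderiv_funpow_reverse[OF sm, of 2]
    by (simp add: numeral_2_eq_2 cross2_eq)
  then have rev: "curv (reverse \<gamma>) t \<noteq> 0" for t using assms(2)[of "- t"] by simp
  obtain p where "left_convex \<gamma> p \<or> left_convex (reverse \<gamma>) p"
    using convex_curve_left_convex[OF assms(1)] by blast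
  then show ?thesis
    using pos[OF _ assms(2)] pos[OF _ rev] has_angle_form_reverse[of "reverse \<gamma>"] by auto
qed

section \<open>Cusps of fronts and their number\<close>

lemma vderiv_funpow_shift:
  assumes "smooth f"
  shows "(vderiv ^^ k) (\<lambda>t. f (t + c)) = (\<lambda>t. (vderiv ^^ k) f (t + c))"
proof (induction k)
  case (Suc k)
  have "((\<lambda>t. (vderiv ^^ k) f (t + c)) has_vector_derivative vderiv ((vderiv ^^ k) f) (t + c)) (at t)" for t
    using vector_diff_chain_at[of "\<lambda>t. t + c" 1 t "(vderiv ^^ k) f"]
      smooth_has_vderiv[OF smooth_funpow_vderiv[OF assms]]
    by (simp add: o_def has_vector_derivative_add_const)
  from vderiv_eqI[OF this] show ?case using Suc by simp
qed simp

lemma vderiv_funpow_inner: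
  fixes \<delta> :: "real \<Rightarrow> real^2"
  assumes "smooth \<delta>"
  shows "(vderiv ^^ k) (\<lambda>t. u \<bullet> \<delta> t) = (\<lambda>t. u \<bullet> (vderiv ^^ k) \<delta> t)"
proof (induction k)
  case (Suc k)
  have "((\<lambda>t. u \<bullet> (vderiv ^^ k) \<delta> t) has_vector_derivative u \<bullet> vderiv ((vderiv ^^ k) \<delta>) t) (at t)" for t
    using bounded_linear.has_vector_derivative[OF bounded_linear_inner_right
        smooth_has_vderiv[OF smooth_funpow_vderiv[OF assms]]] .
  from vderiv_eqI[OF this] show ?case using Suc by simp
qed simp

lemma taylor_inner:
  fixes \<delta> :: "real \<Rightarrow> real^2"
  assumes "smooth \<delta>"
  obtains M where "0 < M"
    "\<And>s. \<bar>s\<bar> \<le> 1 \<Longrightarrow> \<bar>u \<bullet> \<delta> (s + a) - (\<Sum>m<n. u \<bullet> (vderiv ^^ m) \<delta> a / fact m * s ^ m)\<bar> \<le> M * \<bar>s\<bar> ^ n"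
proof -
  define h where "h s = u \<bullet> \<delta> (s + a)" for s
  have sma: "smooth (\<lambda>s. \<delta> (s + a))" using assms by (rule smooth_vec_shift)
  then have smh: "smooth h" unfolding h_def by (intro smooth_intros)
  have vh: "(vderiv ^^ m) h = (\<lambda>s. u \<bullet> (vderiv ^^ m) \<delta> (s + a))" for m
    unfolding h_def vderiv_funpow_inner[OF sma] vderiv_funpow_shift[OF assms] ..
  have "compact ((vderiv ^^ n) h ` {-1..1})"
    using smooth_continuous[OF smooth_funpow_vderiv[OF smh]] by (intro compact_continuous_image) auto
  then obtain B where B: "0 < B" "\<And>t. t \<in> {-1..1} \<Longrightarrow> \<bar>(vderiv ^^ n) h t\<bar> \<le> B"
    using compact_imp_bounded[of "(vderiv ^^ n) h ` {-1..1}"] by (auto simp: bounded_pos)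
  show ?thesis
  proof
    show "0 < B" by fact
    fix s :: real assume s: "\<bar>s\<bar> \<le> 1"
    obtain t where t: "\<bar>t\<bar> \<le> \<bar>s\<bar>"
      "h s = (\<Sum>m<n. (vderiv ^^ m) h 0 / fact m * s ^ m) + (vderiv ^^ n) h t / fact n * s ^ n"
      using Maclaurin_all_le[of "\<lambda>m. (vderiv ^^ m) h" h s n]
        smooth_has_real_derivative[OF smooth_funpow_vderiv[OF smh]] by auto
    have "\<bar>(vderiv ^^ n) h t / fact n * s ^ n\<bar> \<le> B * \<bar>s\<bar> ^ n"
    proof -
      have "\<bar>(vderiv ^^ n) h t\<bar> \<le> B" using t(1) s by (intro B(2)) auto
      moreover have "\<bar>(vderiv ^^ n) h t\<bar> / fact n \<le> \<bar>(vderiv ^^ n) h t\<bar> / 1"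
        by (intro divide_left_mono) auto
      ultimately have "\<bar>(vderiv ^^ n) h t\<bar> / fact n \<le> B" by simp
      then have "\<bar>(vderiv ^^ n) h t\<bar> / fact n * \<bar>s\<bar> ^ n \<le> B * \<bar>s\<bar> ^ n" by (intro mult_right_mono) auto
      then show ?thesis by (simp add: abs_mult power_abs)
    qed
    then show "\<bar>u \<bullet> \<delta> (s + a) - (\<Sum>m<n. u \<bullet> (vderiv ^^ m) \<delta> a / fact m * s ^ m)\<bar> \<le> B * \<bar>s\<bar> ^ n"
      using t(2) unfolding vh h_def by simp
  qed
qed

text \<open>
  A semicubical cusp cannot lie on regular arcs: its points at parameter \<open>t\<close> are at distance
  \<open>O(t\<^sup>2)\<close> from the cusp, hence at distance \<open>O(t\<^sup>4)\<close> from the tangent of an arc that contains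
  infinitely many of them. Then both the second and the third derivative of the cusp point in
  the direction of that tangent.
\<close>

lemma cusp_on_periodic_curve:
  fixes f :: "real \<Rightarrow> real^2"
  assumes f: "smooth f" "0 < P" "\<And>\<theta>. f (\<theta> + P) = f \<theta>"
    and \<delta>: "smooth \<delta>" "\<forall>\<^sub>F t in nhds 0. \<delta> t \<in> range f" "vderiv \<delta> 0 = 0"
      "cross2 ((vderiv ^^ 2) \<delta> 0) ((vderiv ^^ 3) \<delta> 0) \<noteq> 0"
  shows "\<exists>\<theta>. f \<theta> = \<delta> 0 \<and> vderiv f \<theta> = 0"
proof -
  define t where "t n = 1 / real (Suc n)" for n
  have t: "t \<longlonglongrightarrow> 0" unfolding t_def by (rule LIMSEQ_Suc[OF lim_1_over_n])
  have tpos: "0 < t n" "t n \<le> 1" for n by (auto simp: t_def)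
  have "\<forall>\<^sub>F n in sequentially. \<delta> (t n) \<in> range f"
    using filterlim_iff[THEN iffD1, OF t] \<delta>(2) by blast
  then obtain N where N: "\<And>n. N \<le> n \<Longrightarrow> \<delta> (t n) \<in> range f"
    by (auto simp: eventually_sequentially)
  have "\<exists>\<theta>\<in>{0..P}. \<delta> (t (n + N)) = f \<theta>" for n
  proof -
    obtain \<theta> where th: "\<delta> (t (n + N)) = f \<theta>" using N[of "n + N"] by auto
    obtain k :: int where k: "0 \<le> \<theta> + of_int k * P" "\<theta> + of_int k * P < 0 + P"
      using shift_into_period[OF f(2)] by blast
    then show ?thesis
      using th periodic_int_multiple[of f P \<theta> k] f(3) by (intro bexI[of _ "\<theta> + of_int k * P"]) auto
  qed
  then obtain \<theta> where th: "\<And>n. \<theta> n \<in> {0..P}" "\<And>n. \<delta> (t (n + N)) = f (\<theta> n)" by metis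
  obtain z r where r: "strict_mono r" "(\<theta> \<circ> r) \<longlonglongrightarrow> z"
    using compact_Icc[of 0 P] th(1) unfolding compact_def by metis
  define \<tau> where "\<tau> n = t (r n + N)" for n
  define s where "s n = \<theta> (r n) - z" for n
  have tau: "\<tau> \<longlonglongrightarrow> 0"
  proof -
    have "(t \<circ> (\<lambda>n. r n + N)) \<longlonglongrightarrow> 0"
      using r(1) by (intro LIMSEQ_subseq_LIMSEQ[OF t]) (simp add: strict_mono_def)
    then show ?thesis by (simp add: \<tau>_def[abs_def] o_def)
  qed
  have taupos: "0 < \<tau> n" "\<tau> n \<le> 1" for n using tpos by (auto simp: \<tau>_def)
  have s0: "s \<longlonglongrightarrow> 0" unfolding s_def using r(2) LIM_zero by (fastforce simp: o_def)
  have eq: "\<delta> (\<tau> n + 0) = f (s n + z)" for n by (simp add: \<tau>_def s_def th(2))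
  have fz: "f z = \<delta> 0"
  proof (rule LIMSEQ_unique)
    show "(\<lambda>n. \<delta> (\<tau> n)) \<longlonglongrightarrow> \<delta> 0" using smooth_isCont[OF \<delta>(1)] tau by (rule isCont_tendsto_compose)
    have "(\<lambda>n. f (\<theta> (r n))) \<longlonglongrightarrow> f z"
      using smooth_isCont[OF f(1)] r(2) by (intro isCont_tendsto_compose[of z f]) (auto simp: o_def)
    then show "(\<lambda>n. \<delta> (\<tau> n)) \<longlonglongrightarrow> f z" using eq by (simp add: s_def)
  qed
  have "vderiv f z = 0"
  proof (rule ccontr)
    assume "vderiv f z \<noteq> 0"
    define v where "v = vderiv f z"
    have vv: "0 < v \<bullet> v" using \<open>vderiv f z \<noteq> 0\<close> by (simp add: v_def)
    have rv: "rot v \<bullet> v = 0" by (simp add: inner2_eq)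
    have sum2: "(\<Sum>m<2. g m) = g 0 + g 1" for g :: "nat \<Rightarrow> real" by (simp add: numeral_2_eq_2)
    have sum4: "(\<Sum>m<4. g m) = g 0 + g 1 + g 2 + g 3" for g :: "nat \<Rightarrow> real"
      by (simp add: numeral_nat)
    obtain M1 where M1: "0 < M1" "\<And>s. \<bar>s\<bar> \<le> 1 \<Longrightarrow> \<bar>v \<bullet> f (s + z) - (\<Sum>m<2. v \<bullet> (vderiv ^^ m) f z / fact m * s ^ m)\<bar> \<le> M1 * \<bar>s\<bar> ^ 2"
      by (rule taylor_inner[OF f(1), where u = v and a = z and n = 2]) blast
    obtain M2 where M2: "0 < M2" "\<And>s. \<bar>s\<bar> \<le> 1 \<Longrightarrow> \<bar>rot v \<bullet> f (s + z) - (\<Sum>m<2. rot v \<bullet> (vderiv ^^ m) f z / fact m * s ^ m)\<bar> \<le> M2 * \<bar>s\<bar> ^ 2"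
      by (rule taylor_inner[OF f(1), where u = "rot v" and a = z and n = 2]) blast
    obtain M3 where M3: "0 < M3" "\<And>s. \<bar>s\<bar> \<le> 1 \<Longrightarrow> \<bar>v \<bullet> \<delta> (s + 0) - (\<Sum>m<2. v \<bullet> (vderiv ^^ m) \<delta> 0 / fact m * s ^ m)\<bar> \<le> M3 * \<bar>s\<bar> ^ 2"
      by (rule taylor_inner[OF \<delta>(1), where u = v and a = 0 and n = 2]) blast
    obtain M4 where M4: "0 < M4" "\<And>s. \<bar>s\<bar> \<le> 1 \<Longrightarrow> \<bar>rot v \<bullet> \<delta> (s + 0) - (\<Sum>m<4. rot v \<bullet> (vderiv ^^ m) \<delta> 0 / fact m * s ^ m)\<bar> \<le> M4 * \<bar>s\<bar> ^ 4"
      by (rule taylor_inner[OF \<delta>(1), where u = "rot v" and a = 0 and n = 4]) blast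
    \<comment> \<open>\<open>A\<close> and \<open>B\<close> measure the deviation of the two derivatives from the tangent \<open>v\<close> of the arc;
      \<open>C\<close> bounds the arc parameter of the point at \<open>t\<close> by \<open>C * t\<^sup>2\<close>.\<close>
    define A where "A = rot v \<bullet> (vderiv ^^ 2) \<delta> 0"
    define B where "B = rot v \<bullet> (vderiv ^^ 3) \<delta> 0"
    define C where "C = 2 * M3 / (v \<bullet> v)"
    have Cpos: "0 < C" using M3(1) vv by (simp add: C_def)
    define D where "D = M2 * C\<^sup>2 + M4"
    have "\<forall>\<^sub>F n in sequentially. \<bar>s n\<bar> < min 1 ((v \<bullet> v) / (2 * M1))"
      using order_tendstoD(2)[OF tendsto_rabs[OF s0], of "min 1 ((v \<bullet> v) / (2 * M1))"] vv M1(1) by simp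
    then have ev: "\<forall>\<^sub>F n in sequentially. \<bar>A / 2 + B / 6 * \<tau> n\<bar> \<le> D * (\<tau> n)\<^sup>2"
    proof (rule eventually_mono)
      fix n assume sn: "\<bar>s n\<bar> < min 1 ((v \<bullet> v) / (2 * M1))"
      then have s1: "\<bar>s n\<bar> \<le> 1" "\<bar>s n\<bar> * M1 \<le> (v \<bullet> v) / 2" using M1(1) by (auto simp: field_simps)
      let ?T = "\<tau> n"
      have T: "\<bar>?T\<bar> \<le> 1" using taupos[of n] by simp
      have 1: "\<bar>v \<bullet> f (s n + z) - (v \<bullet> f z + (v \<bullet> v) * s n)\<bar> \<le> M1 * \<bar>s n\<bar> ^ 2"
        using M1(2)[OF s1(1)] unfolding sum2 by (simp add: v_def)
      have 2: "\<bar>rot v \<bullet> f (s n + z) - rot v \<bullet> f z\<bar> \<le> M2 * \<bar>s n\<bar> ^ 2"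
        using M2(2)[OF s1(1)] rv unfolding sum2 by (simp add: v_def)
      have 3: "\<bar>v \<bullet> \<delta> (?T + 0) - v \<bullet> \<delta> 0\<bar> \<le> M3 * ?T ^ 2"
        using M3(2)[OF T] \<delta>(3) unfolding sum2 by simp
      have 4: "\<bar>rot v \<bullet> \<delta> (?T + 0) - (rot v \<bullet> \<delta> 0 + A / 2 * ?T ^ 2 + B / 6 * ?T ^ 3)\<bar> \<le> M4 * ?T ^ 4"
        using M4(2)[OF T] \<delta>(3) unfolding sum4 A_def B_def by (simp add: fact_numeral)
      have "(v \<bullet> v) * \<bar>s n\<bar> - M1 * \<bar>s n\<bar> ^ 2 \<le> M3 * ?T ^ 2"
      proof -
        have "\<bar>(v \<bullet> v) * s n\<bar> = (v \<bullet> v) * \<bar>s n\<bar>" using vv by (simp add: abs_mult)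
        then show ?thesis using 1 3 unfolding eq fz by linarith
      qed
      moreover have "M1 * \<bar>s n\<bar> ^ 2 \<le> (v \<bullet> v) / 2 * \<bar>s n\<bar>"
        using mult_right_mono[OF s1(2), of "\<bar>s n\<bar>"] by (simp add: power2_eq_square mult_ac)
      ultimately have "(v \<bullet> v) / 2 * \<bar>s n\<bar> \<le> M3 * ?T ^ 2" by simp
      then have "\<bar>s n\<bar> \<le> C * ?T ^ 2" unfolding C_def using vv by (simp add: field_simps)
      then have "\<bar>s n\<bar> ^ 2 \<le> (C * ?T ^ 2) ^ 2" by (intro power_mono) auto
      then have "M2 * \<bar>s n\<bar> ^ 2 \<le> M2 * (C * ?T ^ 2) ^ 2" using M2(1) by (intro mult_left_mono) auto
      moreover have "M2 * (C * ?T ^ 2) ^ 2 = M2 * C\<^sup>2 * ?T ^ 4" by (simp add: power_mult_distrib)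
      ultimately have 5: "\<bar>rot v \<bullet> \<delta> (?T + 0) - rot v \<bullet> \<delta> 0\<bar> \<le> M2 * C\<^sup>2 * ?T ^ 4"
        using 2 unfolding eq fz by linarith
      have "\<bar>A / 2 * ?T ^ 2 + B / 6 * ?T ^ 3\<bar> \<le> D * ?T ^ 4"
        using 4 5 unfolding D_def by (simp add: algebra_simps)
      moreover have "A / 2 * ?T ^ 2 + B / 6 * ?T ^ 3 = (A / 2 + B / 6 * ?T) * ?T ^ 2"
        by (simp add: algebra_simps power2_eq_square power3_eq_cube)
      moreover have "D * ?T ^ 4 = (D * ?T ^ 2) * ?T ^ 2" by (simp flip: power_add)
      ultimately have "\<bar>A / 2 + B / 6 * ?T\<bar> * ?T ^ 2 \<le> (D * ?T ^ 2) * ?T ^ 2"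
        by (simp add: abs_mult)
      then show "\<bar>A / 2 + B / 6 * ?T\<bar> \<le> D * ?T ^ 2" using taupos[of n] by simp
    qed
    have lim1: "(\<lambda>n. \<bar>A / 2 + B / 6 * \<tau> n\<bar>) \<longlonglongrightarrow> \<bar>A / 2 + B / 6 * 0\<bar>"
      by (intro tendsto_intros tau)
    have lim2: "(\<lambda>n. D * (\<tau> n)\<^sup>2) \<longlonglongrightarrow> D * 0\<^sup>2" by (intro tendsto_intros tau)
    have "\<bar>A / 2 + B / 6 * 0\<bar> \<le> D * 0\<^sup>2" by (rule tendsto_le[OF _ lim2 lim1 ev]) simp
    then have A0: "A = 0" by simp
    have ev': "\<forall>\<^sub>F n in sequentially. \<bar>B / 6\<bar> \<le> D * \<tau> n"
      using ev
    proof (rule eventually_mono)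
      fix n assume "\<bar>A / 2 + B / 6 * \<tau> n\<bar> \<le> D * (\<tau> n)\<^sup>2"
      then have "\<bar>B / 6\<bar> * \<tau> n \<le> (D * \<tau> n) * \<tau> n"
        using taupos[of n] A0 by (simp add: abs_mult power2_eq_square)
      then show "\<bar>B / 6\<bar> \<le> D * \<tau> n" using taupos[of n] by simp
    qed
    have lim3: "(\<lambda>n. D * \<tau> n) \<longlonglongrightarrow> D * 0" by (intro tendsto_intros tau)
    have "\<bar>B / 6\<bar> \<le> D * 0" by (rule tendsto_le[OF _ lim3 tendsto_const ev']) simp
    then have B0: "B = 0" by simp
    have "(v \<bullet> v) * cross2 ((vderiv ^^ 2) \<delta> 0) ((vderiv ^^ 3) \<delta> 0) = 0"
      using A0 B0 unfolding A_def B_def inner2_eq cross2_eq rot_nth by algebra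
    then show False using \<delta>(4) vv by simp
  qed
  then show ?thesis using fz by blast
qed

text \<open>
  At a simple zero of the speed \<open>\<omega>\<close> the second derivative of the front is a multiple of \<open>d\<close>, and the
  third one involves the derivative of \<open>d\<close>, which is independent of \<open>d\<close>. All other points are
  reached through regular arcs only.
\<close>

lemma cusps_of_front:
  fixes f d :: "real \<Rightarrow> real^2"
  assumes f: "0 < P" "\<And>\<theta>. f (\<theta> + P) = f \<theta>" "smooth f" "smooth \<omega>" "smooth d"
    "\<And>\<theta>. (f has_vector_derivative \<omega> \<theta> *\<^sub>R d \<theta>) (at \<theta>)"
    and front: "\<And>\<theta>. cross2 (d \<theta>) (vderiv d \<theta>) \<noteq> 0"
    and simple: "\<And>\<theta>. \<omega> \<theta> = 0 \<Longrightarrow> vderiv \<omega> \<theta> \<noteq> 0"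
  shows "cusps (range f) = f ` {\<theta>. \<omega> \<theta> = 0}"
proof
  have f': "vderiv f = (\<lambda>\<theta>. \<omega> \<theta> *\<^sub>R d \<theta>)" by (rule vderiv_eqI[OF f(6)])
  have dnz: "d \<theta> \<noteq> 0" for \<theta> using front[of \<theta>] by (auto simp: cross2_eq)
  show "cusps (range f) \<subseteq> f ` {\<theta>. \<omega> \<theta> = 0}"
  proof
    fix x assume "x \<in> cusps (range f)"
    then obtain \<delta> where "smooth \<delta>" "\<forall>\<^sub>F t in nhds 0. \<delta> t \<in> range f" "\<delta> 0 = x" "vderiv \<delta> 0 = 0"
      "cross2 ((vderiv ^^ 2) \<delta> 0) ((vderiv ^^ 3) \<delta> 0) \<noteq> 0" unfolding cusps_def by blast
    then obtain \<theta> where "f \<theta> = x" "vderiv f \<theta> = 0"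
      using cusp_on_periodic_curve[OF f(3,1,2)] by blast
    then show "x \<in> f ` {\<theta>. \<omega> \<theta> = 0}" using dnz[of \<theta>] by (auto simp: f')
  qed
  show "f ` {\<theta>. \<omega> \<theta> = 0} \<subseteq> cusps (range f)"
  proof
    fix x assume "x \<in> f ` {\<theta>. \<omega> \<theta> = 0}"
    then obtain z where z: "\<omega> z = 0" "x = f z" by blast
    have d': "(d has_vector_derivative vderiv d \<theta>) (at \<theta>)" "(vderiv d has_vector_derivative vderiv (vderiv d) \<theta>) (at \<theta>)" for \<theta>
      using f(5) smooth_vderiv smooth_has_vderiv by blast+
    have w': "(\<omega> has_real_derivative vderiv \<omega> \<theta>) (at \<theta>)" "(vderiv \<omega> has_real_derivative vderiv (vderiv \<omega>) \<theta>) (at \<theta>)" for \<theta>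
      using f(4) smooth_vderiv smooth_has_real_derivative by blast+
    have f'': "vderiv (vderiv f) = (\<lambda>\<theta>. \<omega> \<theta> *\<^sub>R vderiv d \<theta> + vderiv \<omega> \<theta> *\<^sub>R d \<theta>)"
      unfolding f' by (intro vderiv_eqI has_vector_derivative_scaleR w' d')
    have f''': "vderiv (vderiv (vderiv f)) = (\<lambda>\<theta>. (\<omega> \<theta> *\<^sub>R vderiv (vderiv d) \<theta> + vderiv \<omega> \<theta> *\<^sub>R vderiv d \<theta>) +
        (vderiv \<omega> \<theta> *\<^sub>R vderiv d \<theta> + vderiv (vderiv \<omega>) \<theta> *\<^sub>R d \<theta>))"
      unfolding f'' by (intro vderiv_eqI has_vector_derivative_add has_vector_derivative_scaleR w' d')
    let ?\<delta> = "\<lambda>t. f (t + z)"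
    have pow: "(vderiv ^^ k) ?\<delta> 0 = (vderiv ^^ k) f z" for k
      by (simp add: vderiv_funpow_shift[OF f(3)])
    have "cross2 ((vderiv ^^ 2) ?\<delta> 0) ((vderiv ^^ 3) ?\<delta> 0) = 2 * (vderiv \<omega> z)\<^sup>2 * cross2 (d z) (vderiv d z)"
      unfolding pow using z(1)
      by (simp add: numeral_2_eq_2 numeral_3_eq_3 fun_cong[OF f''] fun_cong[OF f''']) (simp add: cross2_eq algebra_simps)
    also have "\<dots> \<noteq> 0" using simple[OF z(1)] front by simp
    finally have "cross2 ((vderiv ^^ 2) ?\<delta> 0) ((vderiv ^^ 3) ?\<delta> 0) \<noteq> 0" .
    moreover have "vderiv ?\<delta> 0 = 0" using pow[of 1] z(1) by (simp add: f')
    ultimately show "x \<in> cusps (range f)"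
      unfolding cusps_def using smooth_vec_shift[OF f(3), of z] z(2)
      by (intro CollectI exI[of _ ?\<delta>]) simp
  qed
qed

subsection \<open>Zeros of antiperiodic functions\<close>

lemma simple_zero_quotient:
  fixes g :: "real \<Rightarrow> real"
  assumes "(g has_real_derivative c) (at z)" "g z = 0" "c \<noteq> 0"
  obtains e where "0 < e" "\<And>x. x \<noteq> z \<Longrightarrow> \<bar>x - z\<bar> < e \<Longrightarrow> 0 < c * ((x - z) * g x)"
proof -
  have "((\<lambda>x. c * (g x / (x - z))) \<longlongrightarrow> c * c) (at z)"
    using assms(1,2) by (intro tendsto_intros) (simp add: has_field_derivative_iff)
  then have "\<forall>\<^sub>F x in at z. 0 < c * (g x / (x - z))"
    using assms(3) by (intro order_tendstoD(1)) (auto simp: zero_less_mult_iff)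
  then obtain e where e: "0 < e" "\<And>x. x \<noteq> z \<Longrightarrow> dist x z < e \<Longrightarrow> 0 < c * (g x / (x - z))"
    by (auto simp: eventually_at)
  have "0 < c * ((x - z) * g x)" if "x \<noteq> z" "\<bar>x - z\<bar> < e" for x
  proof -
    have "0 < (c * (g x / (x - z))) * (x - z)\<^sup>2"
      using that by (intro mult_pos_pos e(2)) (auto simp: dist_real_def)
    also have "\<dots> = c * ((x - z) * g x)" using that(1) by (simp add: power2_eq_square)
    finally show ?thesis .
  qed
  then show ?thesis using that e(1) by blast
qed

lemma finite_simple_zeros:
  fixes g :: "real \<Rightarrow> real"
  assumes "smooth g" "\<And>x. g x = 0 \<Longrightarrow> vderiv g x \<noteq> 0"
  shows "finite {x \<in> {a..b}. g x = 0}"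
proof (rule ccontr)
  assume inf: "infinite {x \<in> {a..b}. g x = 0}"
  then obtain z where z: "z islimpt {x \<in> {a..b}. g x = 0}"
    using compact_Icc[of a b] by (auto simp: compact_eq_Bolzano_Weierstrass)
  have "closed {x. g x = 0}"
    using smooth_continuous[OF assms(1), of UNIV] continuous_closed_vimage[of "{0}" g] smooth_isCont[OF assms(1)]
    by (simp add: vimage_def)
  moreover have "z islimpt {x. g x = 0}" using z by (rule islimpt_subset) auto
  ultimately have gz: "g z = 0" by (simp add: closed_limpt)
  obtain e where e: "0 < e" "\<And>x. x \<noteq> z \<Longrightarrow> \<bar>x - z\<bar> < e \<Longrightarrow> 0 < vderiv g z * ((x - z) * g x)"
    using simple_zero_quotient[OF smooth_has_real_derivative[OF assms(1)] gz assms(2)[OF gz]] by blast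
  obtain y where "g y = 0" "y \<noteq> z" "dist y z < e"
    using z e(1) unfolding islimpt_approachable by blast
  then show False using e(2)[of y] by (simp add: dist_real_def)
qed

lemma no_zero_same_sign:
  fixes g :: "real \<Rightarrow> real"
  assumes "continuous_on {a..b} g" "a \<le> b" "\<And>x. a \<le> x \<Longrightarrow> x \<le> b \<Longrightarrow> g x \<noteq> 0"
  shows "0 < g a * g b"
proof (rule ccontr)
  assume "\<not> 0 < g a * g b"
  then have "(g a \<le> 0 \<and> 0 \<le> g b) \<or> (0 \<le> g a \<and> g b \<le> 0)" by (auto simp: zero_less_mult_iff not_less)
  then show False
    using IVT'[of g a 0 b] IVT2'[of g b 0 a] assms by blast
qed

text \<open>
  By induction on the number of zeros: the last zero is cut off together with the change of sign
  that it causes.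
\<close>

lemma parity_of_simple_zeros:
  fixes g :: "real \<Rightarrow> real"
  assumes "smooth g" "\<And>x. g x = 0 \<Longrightarrow> vderiv g x \<noteq> 0"
  shows "a < b \<Longrightarrow> g a \<noteq> 0 \<Longrightarrow> g b \<noteq> 0 \<Longrightarrow> odd (card {x \<in> {a..b}. g x = 0}) \<longleftrightarrow> g a * g b < 0"
proof (induction "card {x \<in> {a..b}. g x = 0}" arbitrary: b)
  case 0
  then have "{x \<in> {a..b}. g x = 0} = {}" using finite_simple_zeros[OF assms] by simp
  then have "0 < g a * g b"
    using 0 smooth_continuous[OF assms(1)] by (intro no_zero_same_sign[where g = g and a = a and b = b]) auto
  then show ?case using 0 by simp
next
  case (Suc n)
  let ?S = "{x \<in> {a..b}. g x = 0}"
  have fin: "finite ?S" by (rule finite_simple_zeros[OF assms])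
  have "card ?S \<noteq> 0" using Suc.hyps(2) by linarith
  then have "?S \<noteq> {}" by (metis card.empty)
  define z where "z = Max ?S"
  have z: "z \<in> ?S" "\<And>x. x \<in> ?S \<Longrightarrow> x \<le> z" unfolding z_def using fin \<open>?S \<noteq> {}\<close> Max_in by auto
  then have ab: "a < z" "z < b" using Suc.prems by (auto simp: less_le)
  obtain e where e: "0 < e" "\<And>x. x \<noteq> z \<Longrightarrow> \<bar>x - z\<bar> < e \<Longrightarrow> 0 < vderiv g z * ((x - z) * g x)"
    using simple_zero_quotient[OF smooth_has_real_derivative[OF assms(1)], of z] z(1) assms(2)[of z] by auto
  define m where "m = Max (insert a (?S - {z}))"
  have m: "m < z" "a \<le> m" "\<And>x. x \<in> ?S - {z} \<Longrightarrow> x \<le> m"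
  proof -
    have "m \<in> insert a (?S - {z})" unfolding m_def using fin by (intro Max_in) auto
    then show "m < z" using ab z(2) by (auto simp: less_le)
  qed (use fin in \<open>auto simp: m_def\<close>)
  \<comment> \<open>Test points on both sides of the last zero \<open>z\<close>, with no other zero between \<open>b'\<close> and \<open>b\<close>.\<close>
  define b' where "b' = max ((m + z) / 2) (z - e / 2)"
  have b': "m < b'" "b' < z" "z - e < b'" using m e(1) by (auto simp: b'_def max_def)
  define y where "y = min ((b + z) / 2) (z + e / 2)"
  have y: "z < y" "y < z + e" "y < b" using ab e(1) by (auto simp: y_def min_def)
  have S': "{x \<in> {a..b'}. g x = 0} = ?S - {z}"
    using b' m ab by force
  have gb': "vderiv g z * g b' < 0"
    using e(2)[of b'] b' by (simp add: mult_less_0_iff zero_less_mult_iff) 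
  have gy: "0 < vderiv g z * g y"
    using e(2)[of y] y by (auto simp: zero_less_mult_iff mult_less_0_iff)
  have "0 < g y * g b"
  proof (rule no_zero_same_sign[where g = g and a = y and b = b])
    show "continuous_on {y..b} g" by (rule smooth_continuous[OF assms(1)])
    show "g x \<noteq> 0" if "y \<le> x" "x \<le> b" for x using z(2)[of x] that y ab by force
  qed (use y in simp)
  then have opp: "g b' * g b < 0" "g b' \<noteq> 0"
    using gb' gy by (auto simp: mult_less_0_iff zero_less_mult_iff)
  have "odd (card {x \<in> {a..b'}. g x = 0}) \<longleftrightarrow> g a * g b' < 0"
  proof (rule Suc.hyps(1))
    show "n = card {x \<in> {a..b'}. g x = 0}" unfolding S' using Suc.hyps(2) z(1) fin by simp
  qed (use Suc.prems opp b' m in auto)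
  moreover have "card ?S = Suc (card {x \<in> {a..b'}. g x = 0})"
    unfolding S' using card_Suc_Diff1[OF fin z(1)] by simp
  ultimately show ?case
    using opp Suc.prems by (auto simp: mult_less_0_iff)
qed

lemma odd_zeros_of_antiperiodic:
  fixes g :: "real \<Rightarrow> real"
  assumes "smooth g" "\<And>x. g x = 0 \<Longrightarrow> vderiv g x \<noteq> 0" "\<And>x. g (x + pi) = - g x"
  shows "\<exists>a. odd (card {x \<in> {a..<a + pi}. g x = 0})"
proof -
  obtain a where a: "g a \<noteq> 0"
  proof (cases "g 0 = 0")
    case True
    obtain e where "0 < e" "\<And>x. x \<noteq> 0 \<Longrightarrow> \<bar>x - 0\<bar> < e \<Longrightarrow> 0 < vderiv g 0 * ((x - 0) * g x)"
      using simple_zero_quotient[OF smooth_has_real_derivative[OF assms(1)] True assms(2)[OF True]] by blast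
    then have "g (e / 2) \<noteq> 0" by (metis abs_of_pos diff_zero half_gt_zero less_irrefl linordered_field_class.half_gt_zero mult_zero_right field_sum_of_halves less_add_same_cancel1)
    then show ?thesis using that by blast
  qed (use that in blast)
  have "0 < g a * g a" using a by (simp add: zero_less_mult_iff) linarith
  then have "odd (card {x \<in> {a..a + pi}. g x = 0})"
    using parity_of_simple_zeros[OF assms(1,2), of a "a + pi"] a by (simp add: assms(3))
  moreover have "{x \<in> {a..a + pi}. g x = 0} = {x \<in> {a..<a + pi}. g x = 0}"
    using a assms(3)[of a] by (auto simp: less_le)
  ultimately show ?thesis by metis
qed

lemma rolle_injection:
  fixes g g' :: "real \<Rightarrow> real"
  assumes "finite A" "\<And>x. x \<in> A \<Longrightarrow> x < b" "\<And>x. x \<in> insert b A \<Longrightarrow> g x = 0"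
    and der: "\<And>x. (g has_real_derivative g' x) (at x)"
  obtains h where "inj_on h A" "\<And>x. x \<in> A \<Longrightarrow> x < h x \<and> h x < b \<and> g' (h x) = 0"
proof -
  define nx where "nx x = Min {y \<in> insert b A. x < y}" for x
  have nx: "nx x \<in> insert b A" "x < nx x" "\<And>y. y \<in> insert b A \<Longrightarrow> x < y \<Longrightarrow> nx x \<le> y" if "x \<in> A" for x
  proof -
    have "finite {y \<in> insert b A. x < y}" "{y \<in> insert b A. x < y} \<noteq> {}" using assms(1,2) that by auto
    then show "nx x \<in> insert b A" "x < nx x" "\<And>y. y \<in> insert b A \<Longrightarrow> x < y \<Longrightarrow> nx x \<le> y"
      unfolding nx_def using Min_in[of "{y \<in> insert b A. x < y}"] by auto
  qed
  have "\<exists>c. x < c \<and> c < nx x \<and> g' c = 0" if x: "x \<in> A" for x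
  proof -
    obtain c where "x < c" "c < nx x" "g (nx x) - g x = (nx x - x) * g' c"
      using MVT2[OF nx(2)[OF x], of g g'] der by blast
    moreover have "g (nx x) = 0" "g x = 0" using nx(1)[OF x] assms(3) x by auto
    ultimately show ?thesis using nx(2)[OF x] by auto
  qed
  then obtain h where h: "\<And>x. x \<in> A \<Longrightarrow> x < h x \<and> h x < nx x \<and> g' (h x) = 0" by metis
  have less: "h x < h y" if "x \<in> A" "y \<in> A" "x < y" for x y
    using h[OF that(1)] h[OF that(2)] nx(3)[of x y] that by force
  have "inj_on h A"
    by (rule inj_onI) (metis less linorder_neqE_linordered_idom less_irrefl)
  moreover have "h x < b" if "x \<in> A" for x
    using h[OF that] nx(3)[of x b] assms(2) that by force
  ultimately show ?thesis using that h by blast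
qed

text \<open>
  Injectivity on the zeros modulo half a turn makes the cusps correspond to the zeros per half turn,
  and these are odd in number because the speed changes its sign over half a turn.
\<close>

lemma card_cusps_of_front:
  fixes f d :: "real \<Rightarrow> real^2"
  assumes f: "\<And>\<theta>. f (\<theta> + pi) = f \<theta>" "smooth f" "smooth \<omega>" "smooth d"
    "\<And>\<theta>. (f has_vector_derivative \<omega> \<theta> *\<^sub>R d \<theta>) (at \<theta>)"
    and front: "\<And>\<theta>. cross2 (d \<theta>) (vderiv d \<theta>) \<noteq> 0"
    and simple: "\<And>\<theta>. \<omega> \<theta> = 0 \<Longrightarrow> vderiv \<omega> \<theta> \<noteq> 0"
    and anti: "\<And>\<theta>. \<omega> (\<theta> + pi) = - \<omega> \<theta>"
    and inj: "\<And>x y. \<omega> x = 0 \<Longrightarrow> \<omega> y = 0 \<Longrightarrow> f x = f y \<Longrightarrow> sin (x - y) = 0"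
  shows "finite (cusps (range f))" "odd (card (cusps (range f)))"
    "card (cusps (range f)) = card {x \<in> {a..<a + pi}. \<omega> x = 0}"
proof -
  have eq: "cusps (range f) = f ` {\<theta>. \<omega> \<theta> = 0}"
    by (rule cusps_of_front[OF pi_gt_zero f front simple])
  have fin: "finite {x \<in> {a..<a + pi}. \<omega> x = 0}" for a
    by (rule finite_subset[OF _ finite_simple_zeros[OF f(3) simple, of a "a + pi"]]) auto
  have shift: "f (x + of_int k * pi) = f x" for x k
    using f(1) by (intro periodic_int_multiple)
  have shift0: "\<omega> (x + of_int k * pi) = 0 \<longleftrightarrow> \<omega> x = 0" for x k
    by (rule periodic_int_multiple) (simp add: anti)
  have img: "cusps (range f) = f ` {x \<in> {a..<a + pi}. \<omega> x = 0}" for a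
  proof -
    have "f x \<in> f ` {x \<in> {a..<a + pi}. \<omega> x = 0}" if "\<omega> x = 0" for x
    proof -
      obtain k :: int where "a \<le> x + of_int k * pi" "x + of_int k * pi < a + pi"
        using shift_into_period[OF pi_gt_zero] by blast
      then show ?thesis
        using that shift[of x k] shift0[of x k] by (intro image_eqI[of _ _ "x + of_int k * pi"]) auto
    qed
    then show ?thesis unfolding eq by auto
  qed
  have "inj_on f {x \<in> {a..<a + pi}. \<omega> x = 0}" for a
  proof (rule inj_onI)
    fix x y assume xy: "x \<in> {x \<in> {a..<a + pi}. \<omega> x = 0}" "y \<in> {x \<in> {a..<a + pi}. \<omega> x = 0}" "f x = f y"
    then have "sin (x - y) = 0" using inj by blast
    moreover have "- pi < x - y" "x - y < pi" using xy by auto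
    ultimately show "x = y" using sin_eq_0_pi[of "x - y"] by auto
  qed
  then have card: "card (cusps (range f)) = card {x \<in> {a..<a + pi}. \<omega> x = 0}" for a
    unfolding img[of a] by (rule card_image)
  show "finite (cusps (range f))" unfolding img[of a] using fin by simp
  show "card (cusps (range f)) = card {x \<in> {a..<a + pi}. \<omega> x = 0}" by (rule card)
  show "odd (card (cusps (range f)))"
    using odd_zeros_of_antiperiodic[OF f(3) simple anti] card by metis
qed

section \<open>The Wigner caustic and the centre symmetry set as fronts\<close>

definition radius_gap :: "(real \<Rightarrow> real) \<Rightarrow> real \<Rightarrow> real" where
  "radius_gap \<rho> \<theta> = \<rho> \<theta> - \<rho> (\<theta> + pi)"

definition radius_sum :: "(real \<Rightarrow> real) \<Rightarrow> real \<Rightarrow> real" where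
  "radius_sum \<rho> \<theta> = \<rho> \<theta> + \<rho> (\<theta> + pi)"

text \<open>
  Its zeros are the critical points of the ratio of the two radii at a parallel pair.
\<close>

definition radius_wronskian :: "(real \<Rightarrow> real) \<Rightarrow> real \<Rightarrow> real" where
  "radius_wronskian \<rho> \<theta> = vderiv \<rho> \<theta> * \<rho> (\<theta> + pi) - \<rho> \<theta> * vderiv \<rho> (\<theta> + pi)"

definition mid_chord :: "(real \<Rightarrow> real^2) \<Rightarrow> real \<Rightarrow> real^2" where
  "mid_chord \<Gamma> \<theta> = (1 / 2) *\<^sub>R (\<Gamma> \<theta> + \<Gamma> (\<theta> + pi))"

text \<open>
  The point in which the chord touches the envelope of all chords.
\<close>

definition chord_contact :: "(real \<Rightarrow> real^2) \<Rightarrow> (real \<Rightarrow> real) \<Rightarrow> real \<Rightarrow> real^2" where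
  "chord_contact \<Gamma> \<rho> \<theta> = \<Gamma> \<theta> + (\<rho> \<theta> / radius_sum \<rho> \<theta>) *\<^sub>R (\<Gamma> (\<theta> + pi) - \<Gamma> \<theta>)"

lemma angle_form_shift_pi:
  assumes "angle_form \<Gamma> \<rho>"
  shows "((\<lambda>x. \<Gamma> (x + pi)) has_vector_derivative - \<rho> (\<theta> + pi) *\<^sub>R unit_dir \<theta>) (at \<theta>)"
    "((\<lambda>x. \<rho> (x + pi)) has_real_derivative vderiv \<rho> (\<theta> + pi)) (at \<theta>)"
    "\<Gamma> (\<theta> + pi + pi) = \<Gamma> \<theta>" "\<rho> (\<theta> + pi + pi) = \<rho> \<theta>"
    "vderiv \<rho> (\<theta> + pi + pi) = vderiv \<rho> \<theta>"
proof -
  note D = angle_formD[OF assms]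
  show "((\<lambda>x. \<Gamma> (x + pi)) has_vector_derivative - \<rho> (\<theta> + pi) *\<^sub>R unit_dir \<theta>) (at \<theta>)"
    using vector_diff_chain_at[of "\<lambda>x. x + pi" 1 \<theta> \<Gamma>, OF _ D(5)]
    by (simp add: o_def has_vector_derivative_add_const)
  show "((\<lambda>x. \<rho> (x + pi)) has_real_derivative vderiv \<rho> (\<theta> + pi)) (at \<theta>)"
    using smooth_has_real_derivative[OF D(2), of "\<theta> + pi"] by (simp add: DERIV_shift)
  show "\<Gamma> (\<theta> + pi + pi) = \<Gamma> \<theta>" "\<rho> (\<theta> + pi + pi) = \<rho> \<theta>"
    using D(3,6)[of \<theta>] by (simp_all add: add.assoc)
  show "vderiv \<rho> (\<theta> + pi + pi) = vderiv \<rho> \<theta>"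
    using vderiv_periodic[OF D(2), of "2 * pi" \<theta>] D(6) by (simp add: add.assoc)
qed

lemma radius_sum_pos: "angle_form \<Gamma> \<rho> \<Longrightarrow> 0 < radius_sum \<rho> \<theta>"
  unfolding radius_sum_def using angle_formD(4) by (intro add_pos_pos) blast+

lemma parallel_pair_angle_form:
  assumes "angle_form \<Gamma> \<rho>" "angle_change \<phi>"
  shows "parallel_pair (\<lambda>t. \<Gamma> (\<phi> t)) s t \<longleftrightarrow> (\<exists>k::int. \<phi> t = \<phi> s + pi + of_int k * (2 * pi))"
proof -
  let ?\<gamma> = "\<lambda>t. \<Gamma> (\<phi> t)"
  have \<gamma>': "vderiv ?\<gamma> t = (vderiv \<phi> t * \<rho> (\<phi> t)) *\<^sub>R unit_dir (\<phi> t)" for t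
    using angle_form_compose_deriv(2)[OF assms] by metis
  have c: "vderiv \<phi> t * \<rho> (\<phi> t) \<noteq> 0" for t
    using angle_formD(4)[OF assms(1), of "\<phi> t"] assms(2) by (simp add: angle_change_def)
  show ?thesis
  proof
    assume pp: "parallel_pair ?\<gamma> s t"
    then have "vderiv ?\<gamma> t \<in> span {vderiv ?\<gamma> s}" unfolding parallel_pair_def by (metis singletonI span_base)
    then obtain a where "vderiv ?\<gamma> t = a *\<^sub>R vderiv ?\<gamma> s" by (auto simp: span_singleton)
    then have "cross2 (vderiv ?\<gamma> s) (vderiv ?\<gamma> t) = 0" by (simp add: cross2_eq)
    moreover have "cross2 (vderiv ?\<gamma> s) (vderiv ?\<gamma> t)
        = (vderiv \<phi> s * \<rho> (\<phi> s)) * (vderiv \<phi> t * \<rho> (\<phi> t)) * cross2 (unit_dir (\<phi> s)) (unit_dir (\<phi> t))"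
      unfolding \<gamma>' by (simp add: cross2_eq algebra_simps)
    ultimately have "sin (\<phi> t - \<phi> s) = 0" using c[of s] c[of t] by (simp add: cross2_unit_dir)
    then obtain i :: int where i: "\<phi> t - \<phi> s = of_int i * pi" using sin_zero_iff_int2 by blast
    have "odd i"
    proof
      assume "even i"
      then obtain j where "i = 2 * j" by blast
      then have "\<phi> t = \<phi> s + of_int j * (2 * pi)" using i by simp
      then have "\<Gamma> (\<phi> t) = \<Gamma> (\<phi> s)" using angle_form_int(1)[OF assms(1)] by simp
      then show False using pp by (simp add: parallel_pair_def)
    qed
    then obtain j where "i = 2 * j + 1" by (rule oddE)
    then have "\<phi> t = \<phi> s + pi + of_int j * (2 * pi)" using i by (simp add: algebra_simps)
    then show "\<exists>k::int. \<phi> t = \<phi> s + pi + of_int k * (2 * pi)" by blast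
  next
    assume "\<exists>k::int. \<phi> t = \<phi> s + pi + of_int k * (2 * pi)"
    then obtain k :: int where k: "\<phi> t = \<phi> s + pi + of_int k * (2 * pi)" by blast
    have distinct: "\<Gamma> (\<phi> s) \<noteq> \<Gamma> (\<phi> t)"
    proof
      assume "\<Gamma> (\<phi> s) = \<Gamma> (\<phi> t)"
      then obtain j :: int where "\<phi> s = \<phi> t + of_int j * (2 * pi)" using angle_form_inj[OF assms(1)] by blast
      then have "pi * of_int (1 + 2 * (k + j)) = 0" using k by (simp add: algebra_simps)
      then have "1 + 2 * (k + j) = 0" by (metis mult_eq_0_iff of_int_eq_0_iff pi_neq_zero)
      then show False by presburger
    qed
    have dir: "unit_dir (\<phi> t) = - unit_dir (\<phi> s)"
      using periodic_int_multiple[of unit_dir "2 * pi" "\<phi> s + pi" k] k by simp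
    have "vderiv ?\<gamma> t \<in> span {vderiv ?\<gamma> s}"
    proof -
      have "vderiv ?\<gamma> t = (- (vderiv \<phi> t * \<rho> (\<phi> t)) / (vderiv \<phi> s * \<rho> (\<phi> s))) *\<^sub>R vderiv ?\<gamma> s"
        unfolding \<gamma>' dir using c[of s] by simp
      also have "\<dots> \<in> span {vderiv ?\<gamma> s}" by (intro span_scale span_base) simp
      finally show ?thesis .
    qed
    moreover have "vderiv ?\<gamma> s \<in> span {vderiv ?\<gamma> t}"
    proof -
      have "vderiv ?\<gamma> s = (- (vderiv \<phi> s * \<rho> (\<phi> s)) / (vderiv \<phi> t * \<rho> (\<phi> t))) *\<^sub>R vderiv ?\<gamma> t"
        unfolding \<gamma>' dir using c[of t] by simp
      also have "\<dots> \<in> span {vderiv ?\<gamma> t}" by (intro span_scale span_base) simp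
      finally show ?thesis .
    qed
    ultimately have "span {vderiv ?\<gamma> s} = span {vderiv ?\<gamma> t}"
      by (intro subset_antisym span_minimal) (simp_all add: subspace_span)
    then show "parallel_pair ?\<gamma> s t"
      using distinct unfolding parallel_pair_def by blast
  qed
qed

lemma wigner_caustic_angle_form:
  assumes "angle_form \<Gamma> \<rho>" "angle_change \<phi>"
  shows "wigner_caustic (\<lambda>t. \<Gamma> (\<phi> t)) = range (mid_chord \<Gamma>)"
proof -
  obtain \<tau> where tau: "\<And>x. \<phi> (\<tau> x) = x" using angle_change_inverse[OF assms(2)] by metis
  have mid: "midpoint a b = (1 / 2) *\<^sub>R (a + b)" for a b :: "real^2"
    by (simp add: midpoint_def inverse_eq_divide)
  show ?thesis
  proof
    show "wigner_caustic (\<lambda>t. \<Gamma> (\<phi> t)) \<subseteq> range (mid_chord \<Gamma>)"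
    proof
      fix x assume "x \<in> wigner_caustic (\<lambda>t. \<Gamma> (\<phi> t))"
      then obtain s t and k :: int where st: "x = midpoint (\<Gamma> (\<phi> s)) (\<Gamma> (\<phi> t))" "\<phi> t = \<phi> s + pi + of_int k * (2 * pi)"
        unfolding wigner_caustic_def parallel_pair_angle_form[OF assms] by blast
      then have "x = mid_chord \<Gamma> (\<phi> s)"
        using angle_form_int(1)[OF assms(1), of "\<phi> s + pi" k] by (simp add: mid mid_chord_def)
      then show "x \<in> range (mid_chord \<Gamma>)" by blast
    qed
    show "range (mid_chord \<Gamma>) \<subseteq> wigner_caustic (\<lambda>t. \<Gamma> (\<phi> t))"
    proof
      fix x assume "x \<in> range (mid_chord \<Gamma>)"
      then obtain \<theta> where "x = mid_chord \<Gamma> \<theta>" by blast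
      then have "x = midpoint (\<Gamma> (\<phi> (\<tau> \<theta>))) (\<Gamma> (\<phi> (\<tau> (\<theta> + pi))))" by (simp add: mid mid_chord_def tau)
      moreover have "parallel_pair (\<lambda>t. \<Gamma> (\<phi> t)) (\<tau> \<theta>) (\<tau> (\<theta> + pi))"
        unfolding parallel_pair_angle_form[OF assms] tau by (intro exI[of _ 0]) simp
      ultimately show "x \<in> wigner_caustic (\<lambda>t. \<Gamma> (\<phi> t))" unfolding wigner_caustic_def by blast
    qed
  qed
qed

lemma opposite_chord:
  assumes "angle_form \<Gamma> \<rho>"
  shows "0 < cross2 (unit_dir \<theta>) (\<Gamma> (\<theta> + pi) - \<Gamma> \<theta>)"
  using angle_form_support[OF assms, of pi \<theta>] pi_gt_zero by simp

text \<open>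
  The chord equation and its derivative along the family, solved for the point: they are
  independent because the chord is transversal to the two tangents.
\<close>

lemma chord_contact_iff:
  assumes "angle_form \<Gamma> \<rho>"
  shows "x = chord_contact \<Gamma> \<rho> \<theta> \<longleftrightarrow> cross2 (x - \<Gamma> \<theta>) (\<Gamma> (\<theta> + pi) - \<Gamma> \<theta>) = 0 \<and>
    radius_sum \<rho> \<theta> * cross2 (unit_dir \<theta>) (x - \<Gamma> \<theta>) = \<rho> \<theta> * cross2 (unit_dir \<theta>) (\<Gamma> (\<theta> + pi) - \<Gamma> \<theta>)"
    (is "_ \<longleftrightarrow> ?A \<and> ?B")
proof -
  let ?D = "\<Gamma> (\<theta> + pi) - \<Gamma> \<theta>" and ?S = "radius_sum \<rho> \<theta>" and ?e = "unit_dir \<theta>"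
  have S: "?S \<noteq> 0" using radius_sum_pos[OF assms, of \<theta>] by simp
  have eD: "cross2 ?e ?D \<noteq> 0" using opposite_chord[OF assms, of \<theta>] by simp
  show ?thesis
  proof
    assume x: "x = chord_contact \<Gamma> \<rho> \<theta>"
    have y: "x - \<Gamma> \<theta> = (\<rho> \<theta> / ?S) *\<^sub>R ?D" unfolding x chord_contact_def by simp
    have "cross2 (c *\<^sub>R v) v = 0" "cross2 w (c *\<^sub>R v) = c * cross2 w v" for c v w
      by (simp_all add: cross2_eq algebra_simps)
    then show "?A \<and> ?B" unfolding y using S by simp
  next
    assume AB: "?A \<and> ?B"
    let ?y = "(x - \<Gamma> \<theta>) - (\<rho> \<theta> / ?S) *\<^sub>R ?D"
    have lin: "cross2 v (a - c *\<^sub>R b) = cross2 v a - c * cross2 v b" for v a b c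
      by (simp add: cross2_eq algebra_simps)
    have "cross2 ?e ?y = 0" unfolding lin using AB S by (simp add: field_simps)
    moreover have "cross2 ?D ?y = 0" unfolding lin using AB by (simp add: cross2_eq algebra_simps)
    ultimately have "?y = 0" using cross2_both_zero eD by blast
    then show "x = chord_contact \<Gamma> \<rho> \<theta>" unfolding chord_contact_def by (simp add: algebra_simps)
  qed
qed

lemma chord_family_derivative:
  assumes "angle_form \<Gamma> \<rho>"
    and a: "(\<alpha> has_real_derivative a) (at 0)" and b: "(\<beta> has_real_derivative a) (at 0)"
    and opp: "\<beta> 0 = \<alpha> 0 + pi + of_int k * (2 * pi)"
  shows "((\<lambda>\<tau>. cross2 (x - \<Gamma> (\<alpha> \<tau>)) (\<Gamma> (\<beta> \<tau>) - \<Gamma> (\<alpha> \<tau>))) has_real_derivative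
    a * (radius_sum \<rho> (\<alpha> 0) * cross2 (unit_dir (\<alpha> 0)) (x - \<Gamma> (\<alpha> 0))
      - \<rho> (\<alpha> 0) * cross2 (unit_dir (\<alpha> 0)) (\<Gamma> (\<alpha> 0 + pi) - \<Gamma> (\<alpha> 0)))) (at 0)"
proof -
  have chain: "((\<lambda>\<tau>. \<Gamma> (f \<tau>)) has_vector_derivative c *\<^sub>R (\<rho> (f 0) *\<^sub>R unit_dir (f 0))) (at 0)"
    if "(f has_real_derivative c) (at 0)" for f c
    using vector_diff_chain_at[of f c 0 \<Gamma>, OF _ angle_formD(5)[OF assms(1)]] that
    by (simp add: o_def has_real_derivative_iff_has_vector_derivative)
  have e: "unit_dir (\<beta> 0) = - unit_dir (\<alpha> 0)"
    using periodic_int_multiple[of unit_dir "2 * pi" "\<alpha> 0 + pi" k] opp by simp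
  have G: "\<Gamma> (\<beta> 0) = \<Gamma> (\<alpha> 0 + pi)" "\<rho> (\<beta> 0) = \<rho> (\<alpha> 0 + pi)"
    unfolding opp using angle_form_int[OF assms(1)] by auto
  have "((\<lambda>\<tau>. cross2 (x - \<Gamma> (\<alpha> \<tau>)) (\<Gamma> (\<beta> \<tau>) - \<Gamma> (\<alpha> \<tau>))) has_real_derivative
      cross2 (0 - a *\<^sub>R (\<rho> (\<alpha> 0) *\<^sub>R unit_dir (\<alpha> 0))) (\<Gamma> (\<beta> 0) - \<Gamma> (\<alpha> 0)) +
      cross2 (x - \<Gamma> (\<alpha> 0)) (a *\<^sub>R (\<rho> (\<beta> 0) *\<^sub>R unit_dir (\<beta> 0)) - a *\<^sub>R (\<rho> (\<alpha> 0) *\<^sub>R unit_dir (\<alpha> 0)))) (at 0)"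
    by (intro cross2_has_real_derivative has_vector_derivative_diff has_vector_derivative_const chain a b)
  then show ?thesis
    unfolding e G by (rule DERIV_cong) (simp add: cross2_eq radius_sum_def algebra_simps)
qed

text \<open>
  Along any family of parallel pairs the two tangent angles differ by a constant, hence have the
  same speed, which is not zero. The envelope equations of the family are thus those of the
  family parametrised by the angle.
\<close>

lemma centre_symmetry_set_angle_form:
  assumes "angle_form \<Gamma> \<rho>" "angle_change \<phi>"
  shows "centre_symmetry_set (\<lambda>t. \<Gamma> (\<phi> t)) = range (chord_contact \<Gamma> \<rho>)"
proof -
  have sm: "smooth \<phi>" and nz: "\<And>t. vderiv \<phi> t \<noteq> 0" using assms(2) by (auto simp: angle_change_def)
  let ?\<gamma> = "\<lambda>t. \<Gamma> (\<phi> t)"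
  show ?thesis
  proof
    show "centre_symmetry_set ?\<gamma> \<subseteq> range (chord_contact \<Gamma> \<rho>)"
    proof
      fix x assume "x \<in> centre_symmetry_set ?\<gamma>"
      then obtain u v where uv: "smooth u" "smooth v" "\<forall>\<^sub>F \<tau> in nhds 0. parallel_pair ?\<gamma> (u \<tau>) (v \<tau>)"
        "vderiv u 0 \<noteq> 0 \<or> vderiv v 0 \<noteq> 0"
        and ch: "chord_eq ?\<gamma> u v 0 x = 0" "((\<lambda>\<tau>. chord_eq ?\<gamma> u v \<tau> x) has_real_derivative 0) (at 0)"
        unfolding centre_symmetry_set_def parallel_family_def by blast
      define \<alpha> where "\<alpha> \<tau> = \<phi> (u \<tau>)" for \<tau>
      define \<beta> where "\<beta> \<tau> = \<phi> (v \<tau>)" for \<tau>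
      let ?a = "vderiv \<phi> (u 0) * vderiv u 0" and ?b = "vderiv \<phi> (v 0) * vderiv v 0"
      have da: "(\<alpha> has_real_derivative ?a) (at 0)"
        unfolding \<alpha>_def[abs_def] by (intro DERIV_chain2 smooth_has_real_derivative sm uv)
      have db: "(\<beta> has_real_derivative ?b) (at 0)"
        unfolding \<beta>_def[abs_def] by (intro DERIV_chain2 smooth_has_real_derivative sm uv)
      have opp: "\<forall>\<^sub>F \<tau> in nhds 0. \<exists>k::int. \<beta> \<tau> = \<alpha> \<tau> + pi + of_int k * (2 * pi)"
        using uv(3) unfolding parallel_pair_angle_form[OF assms] \<alpha>_def \<beta>_def .
      then obtain k :: int where k: "\<beta> 0 = \<alpha> 0 + pi + of_int k * (2 * pi)"
        using eventually_nhds_x_imp_x by blast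
      have sin0: "\<forall>\<^sub>F \<tau> in nhds 0. sin (\<beta> \<tau> - \<alpha> \<tau>) = 0"
        using opp
      proof (rule eventually_mono)
        fix \<tau> assume "\<exists>k::int. \<beta> \<tau> = \<alpha> \<tau> + pi + of_int k * (2 * pi)"
        then obtain j :: int where "\<beta> \<tau> - \<alpha> \<tau> = of_int (1 + 2 * j) * pi" by (auto simp: algebra_simps)
        then show "sin (\<beta> \<tau> - \<alpha> \<tau>) = 0" using sin_zero_iff_int2 by blast
      qed
      have "((\<lambda>\<tau>. sin (\<beta> \<tau> - \<alpha> \<tau>)) has_real_derivative cos (\<beta> 0 - \<alpha> 0) * (?b - ?a)) (at 0)"
        by (rule DERIV_chain2[OF DERIV_sin DERIV_diff[OF db da]])
      moreover have "((\<lambda>\<tau>. sin (\<beta> \<tau> - \<alpha> \<tau>)) has_real_derivative 0) (at 0)"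
        using DERIV_cong_ev[OF refl sin0 refl] by simp
      ultimately have "cos (\<beta> 0 - \<alpha> 0) * (?b - ?a) = 0" by (rule DERIV_unique)
      moreover have "cos (\<beta> 0 - \<alpha> 0) \<noteq> 0"
        using eventually_nhds_x_imp_x[OF sin0] sin_zero_abs_cos_one by fastforce
      ultimately have ab: "?b = ?a" by simp
      then have a0: "?a \<noteq> 0" using uv(4) nz by auto
      have "?a * (radius_sum \<rho> (\<alpha> 0) * cross2 (unit_dir (\<alpha> 0)) (x - \<Gamma> (\<alpha> 0))
          - \<rho> (\<alpha> 0) * cross2 (unit_dir (\<alpha> 0)) (\<Gamma> (\<alpha> 0 + pi) - \<Gamma> (\<alpha> 0))) = 0"
        using chord_family_derivative[OF assms(1) da db[unfolded ab] k, of x] ch(2)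
        unfolding chord_eq_def \<alpha>_def \<beta>_def by (rule DERIV_unique)
      moreover have "cross2 (x - \<Gamma> (\<alpha> 0)) (\<Gamma> (\<alpha> 0 + pi) - \<Gamma> (\<alpha> 0)) = 0"
        using ch(1) angle_form_int(1)[OF assms(1), of "\<alpha> 0 + pi" k] k
        unfolding chord_eq_def by (simp add: \<alpha>_def \<beta>_def)
      ultimately have "x = chord_contact \<Gamma> \<rho> (\<alpha> 0)"
        unfolding chord_contact_iff[OF assms(1)] using a0 by simp
      then show "x \<in> range (chord_contact \<Gamma> \<rho>)" by blast
    qed
    show "range (chord_contact \<Gamma> \<rho>) \<subseteq> centre_symmetry_set ?\<gamma>"
    proof
      fix x assume "x \<in> range (chord_contact \<Gamma> \<rho>)"
      then obtain \<theta> where x: "x = chord_contact \<Gamma> \<rho> \<theta>" by blast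
      obtain \<psi> where psi: "smooth \<psi>" "\<And>x. \<phi> (\<psi> x) = x" "\<And>t. \<psi> (\<phi> t) = t"
        "\<And>x. (\<psi> has_real_derivative inverse (vderiv \<phi> (\<psi> x))) (at x)"
        using angle_change_inverse[OF assms(2)] by blast
      define u where "u \<tau> = \<psi> (\<tau> + \<theta>)" for \<tau>
      define v where "v \<tau> = \<psi> (\<tau> + (\<theta> + pi))" for \<tau>
      have "vderiv u 0 = inverse (vderiv \<phi> (\<psi> \<theta>))"
        using vderiv_funpow_shift[OF psi(1), of 1 \<theta>] vderiv_real_eqI[OF psi(4)] by (simp add: u_def[abs_def])
      then have "vderiv u 0 \<noteq> 0" using nz by simp
      moreover have "parallel_pair ?\<gamma> (u \<tau>) (v \<tau>)" for \<tau>
        unfolding parallel_pair_angle_form[OF assms] u_def v_def psi(2) by (intro exI[of _ 0]) simp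
      ultimately have "parallel_family ?\<gamma> u v"
        unfolding parallel_family_def u_def[abs_def] v_def[abs_def]
        using smooth_shift[OF psi(1)] by (auto intro: always_eventually)
      moreover have eq: "chord_eq ?\<gamma> u v \<tau> x = cross2 (x - \<Gamma> (\<tau> + \<theta>)) (\<Gamma> (\<tau> + (\<theta> + pi)) - \<Gamma> (\<tau> + \<theta>))" for \<tau>
        unfolding chord_eq_def u_def v_def psi(2) ..
      note c = chord_contact_iff[OF assms(1), THEN iffD1, OF x]
      have "chord_eq ?\<gamma> u v 0 x = 0" unfolding eq using c by simp
      moreover have "((\<lambda>\<tau>. chord_eq ?\<gamma> u v \<tau> x) has_real_derivative 0) (at 0)"
      proof -
        have "((\<lambda>\<tau>. \<tau> + c) has_real_derivative 1) (at 0)" for c :: real by (auto intro!: derivative_eq_intros)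
        from chord_family_derivative[OF assms(1) this this, where k = 0]
        have "((\<lambda>\<tau>. chord_eq ?\<gamma> u v \<tau> x) has_real_derivative 1 * (radius_sum \<rho> (0 + \<theta>) * cross2 (unit_dir (0 + \<theta>)) (x - \<Gamma> (0 + \<theta>))
            - \<rho> (0 + \<theta>) * cross2 (unit_dir (0 + \<theta>)) (\<Gamma> (0 + \<theta> + pi) - \<Gamma> (0 + \<theta>)))) (at 0)"
          unfolding eq by simp
        then show ?thesis using c by simp
      qed
      ultimately show "x \<in> centre_symmetry_set ?\<gamma>" unfolding centre_symmetry_set_def by blast
    qed
  qed
qed

text \<open>
  The first two conditions make all cusps ordinary, the third one is used to keep different cusps at
  different points. The sine vanishes for angles that belong to the same parallel pair.
\<close>

definition simple_gaps :: "(real \<Rightarrow> real) \<Rightarrow> bool" where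
  "simple_gaps \<rho> \<longleftrightarrow> (\<forall>\<theta>. radius_gap \<rho> \<theta> = 0 \<longrightarrow> vderiv \<rho> \<theta> \<noteq> vderiv \<rho> (\<theta> + pi))"

definition simple_wronskian :: "(real \<Rightarrow> real) \<Rightarrow> bool" where
  "simple_wronskian \<rho> \<longleftrightarrow> (\<forall>\<theta>. radius_wronskian \<rho> \<theta> = 0 \<longrightarrow>
     vderiv (vderiv \<rho>) \<theta> * \<rho> (\<theta> + pi) \<noteq> \<rho> \<theta> * vderiv (vderiv \<rho>) (\<theta> + pi))"

definition separated_on_zeros :: "(real \<Rightarrow> real) \<Rightarrow> (real \<Rightarrow> real^2) \<Rightarrow> bool" where
  "separated_on_zeros \<omega> f \<longleftrightarrow> (\<forall>x y. \<omega> x = 0 \<longrightarrow> \<omega> y = 0 \<longrightarrow> f x = f y \<longrightarrow> sin (x - y) = 0)"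

lemma smooth_radius:
  assumes "angle_form \<Gamma> \<rho>"
  shows "smooth (radius_gap \<rho>)" "smooth (radius_sum \<rho>)" "smooth (radius_wronskian \<rho>)"
proof -
  have r: "smooth \<rho>" "smooth (vderiv \<rho>)" using angle_formD(2)[OF assms] smooth_vderiv by blast+
  note s = r smooth_shift[OF r(1), of pi] smooth_shift[OF r(2), of pi]
  show "smooth (radius_gap \<rho>)" unfolding radius_gap_def[abs_def] by (intro smooth_diff s)
  show "smooth (radius_sum \<rho>)" unfolding radius_sum_def[abs_def] by (intro smooth_add s)
  show "smooth (radius_wronskian \<rho>)"
    unfolding radius_wronskian_def[abs_def] by (intro smooth_diff smooth_mult s)
qed

lemma radius_antiperiodic:
  assumes "angle_form \<Gamma> \<rho>"
  shows "radius_gap \<rho> (\<theta> + pi) = - radius_gap \<rho> \<theta>" "radius_sum \<rho> (\<theta> + pi) = radius_sum \<rho> \<theta>"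
    "radius_wronskian \<rho> (\<theta> + pi) = - radius_wronskian \<rho> \<theta>"
  unfolding radius_gap_def radius_sum_def radius_wronskian_def angle_form_shift_pi(4,5)[OF assms]
  by simp_all

lemma radius_derivs:
  assumes "angle_form \<Gamma> \<rho>"
  shows "(radius_gap \<rho> has_real_derivative vderiv \<rho> \<theta> - vderiv \<rho> (\<theta> + pi)) (at \<theta>)"
    "(radius_sum \<rho> has_real_derivative vderiv \<rho> \<theta> + vderiv \<rho> (\<theta> + pi)) (at \<theta>)"
    "(radius_wronskian \<rho> has_real_derivative vderiv (vderiv \<rho>) \<theta> * \<rho> (\<theta> + pi) - \<rho> \<theta> * vderiv (vderiv \<rho>) (\<theta> + pi)) (at \<theta>)"
proof -
  have r: "(\<rho> has_real_derivative vderiv \<rho> x) (at x)" "(vderiv \<rho> has_real_derivative vderiv (vderiv \<rho>) x) (at x)" for x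
    using angle_formD(2)[OF assms] smooth_vderiv smooth_has_real_derivative by blast+
  have s: "((\<lambda>x. \<rho> (x + pi)) has_real_derivative vderiv \<rho> (x + pi)) (at x)"
    "((\<lambda>x. vderiv \<rho> (x + pi)) has_real_derivative vderiv (vderiv \<rho>) (x + pi)) (at x)" for x
    using r[of "x + pi"] by (simp_all add: DERIV_shift)
  show "(radius_gap \<rho> has_real_derivative vderiv \<rho> \<theta> - vderiv \<rho> (\<theta> + pi)) (at \<theta>)"
    "(radius_sum \<rho> has_real_derivative vderiv \<rho> \<theta> + vderiv \<rho> (\<theta> + pi)) (at \<theta>)"
    unfolding radius_gap_def[abs_def] radius_sum_def[abs_def] by (intro DERIV_diff DERIV_add r s)+
  show "(radius_wronskian \<rho> has_real_derivative vderiv (vderiv \<rho>) \<theta> * \<rho> (\<theta> + pi) - \<rho> \<theta> * vderiv (vderiv \<rho>) (\<theta> + pi)) (at \<theta>)"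
    unfolding radius_wronskian_def[abs_def]
    by (rule DERIV_cong[OF DERIV_diff[OF DERIV_mult[OF r(2) s(1)] DERIV_mult[OF r(1) s(2)]]]) (simp add: algebra_simps)
qed

lemma mid_chord_front:
  assumes "angle_form \<Gamma> \<rho>"
  shows "mid_chord \<Gamma> (\<theta> + pi) = mid_chord \<Gamma> \<theta>" "smooth (mid_chord \<Gamma>)"
    "(mid_chord \<Gamma> has_vector_derivative (radius_gap \<rho> \<theta> / 2) *\<^sub>R unit_dir \<theta>) (at \<theta>)"
proof -
  note D = angle_formD[OF assms] and S = angle_form_shift_pi[OF assms]
  show "mid_chord \<Gamma> (\<theta> + pi) = mid_chord \<Gamma> \<theta>" unfolding mid_chord_def S(3) by (simp add: add.commute)
  show "smooth (mid_chord \<Gamma>)"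
    unfolding mid_chord_def[abs_def] using D(1) smooth_vec_shift[OF D(1)] by (intro smooth_intros)
  have "(mid_chord \<Gamma> has_vector_derivative (1 / 2) *\<^sub>R (\<rho> \<theta> *\<^sub>R unit_dir \<theta> + - \<rho> (\<theta> + pi) *\<^sub>R unit_dir \<theta>)) (at \<theta>)"
    unfolding mid_chord_def[abs_def]
    by (intro bounded_linear.has_vector_derivative[OF bounded_linear_scaleR_right] has_vector_derivative_add D S)
  then show "(mid_chord \<Gamma> has_vector_derivative (radius_gap \<rho> \<theta> / 2) *\<^sub>R unit_dir \<theta>) (at \<theta>)"
    by (simp add: radius_gap_def flip: scaleR_diff_left)
qed

lemma chord_contact_front:
  assumes "angle_form \<Gamma> \<rho>"
  defines "d \<equiv> \<lambda>\<theta>. (1 / (radius_sum \<rho> \<theta>)\<^sup>2) *\<^sub>R (\<Gamma> (\<theta> + pi) - \<Gamma> \<theta>)"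
  shows "chord_contact \<Gamma> \<rho> (\<theta> + pi) = chord_contact \<Gamma> \<rho> \<theta>" "smooth (chord_contact \<Gamma> \<rho>)" "smooth d"
    "(chord_contact \<Gamma> \<rho> has_vector_derivative radius_wronskian \<rho> \<theta> *\<^sub>R d \<theta>) (at \<theta>)"
    "cross2 (d \<theta>) (vderiv d \<theta>) \<noteq> 0"
    "((\<lambda>\<theta>. radius_gap \<rho> \<theta> / radius_sum \<rho> \<theta>) has_real_derivative
        2 * radius_wronskian \<rho> \<theta> / (radius_sum \<rho> \<theta>)\<^sup>2) (at \<theta>)"
proof -
  note D = angle_formD[OF assms(1)] and S = angle_form_shift_pi[OF assms(1)]
  have Snz: "radius_sum \<rho> x \<noteq> 0" for x using radius_sum_pos[OF assms(1), of x] by simp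
  have D': "((\<lambda>x. \<Gamma> (x + pi) - \<Gamma> x) has_vector_derivative (- radius_sum \<rho> x) *\<^sub>R unit_dir x) (at x)" for x
  proof -
    have "- \<rho> (x + pi) *\<^sub>R unit_dir x - \<rho> x *\<^sub>R unit_dir x = (- radius_sum \<rho> x) *\<^sub>R unit_dir x"
      by (simp add: radius_sum_def vec2_eq_iff algebra_simps)
    then show ?thesis using has_vector_derivative_diff[OF S(1) D(5), of x] by simp
  qed
  have smD: "smooth (\<lambda>x. \<Gamma> (x + pi) - \<Gamma> x)" using D(1) smooth_vec_shift[OF D(1)] by (intro smooth_intros)
  show "chord_contact \<Gamma> \<rho> (\<theta> + pi) = chord_contact \<Gamma> \<rho> \<theta>"
  proof -
    have "\<rho> (\<theta> + pi) / radius_sum \<rho> \<theta> = 1 - \<rho> \<theta> / radius_sum \<rho> \<theta>"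
      using Snz[of \<theta>] by (simp add: field_simps radius_sum_def)
    moreover have "g' + (1 - b) *\<^sub>R (g - g') = g + b *\<^sub>R (g' - g)" for g g' :: "real^2" and b
      by (simp add: vec2_eq_iff algebra_simps)
    ultimately show ?thesis
      unfolding chord_contact_def radius_antiperiodic[OF assms(1)] S(3) by metis
  qed
  show "smooth (chord_contact \<Gamma> \<rho>)"
    unfolding chord_contact_def[abs_def]
    by (intro smooth_vec_add smooth_vec_scaleR smooth_divide D smD smooth_radius(2)[OF assms(1)] Snz)
  have inv: "smooth (\<lambda>\<theta>. 1 / (radius_sum \<rho> \<theta>)\<^sup>2)"
    using smooth_radius(2)[OF assms(1)] Snz by (intro smooth_intros) auto
  show "smooth d" unfolding d_def by (intro smooth_vec_scaleR inv smD)
  have q: "((\<lambda>x. \<rho> x / radius_sum \<rho> x) has_real_derivative radius_wronskian \<rho> \<theta> / (radius_sum \<rho> \<theta>)\<^sup>2) (at \<theta>)"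
    by (rule DERIV_cong[OF DERIV_divide[OF smooth_has_real_derivative[OF D(2)] radius_derivs(2)[OF assms(1)] Snz]])
      (simp add: radius_wronskian_def radius_sum_def power2_eq_square algebra_simps)
  have "(chord_contact \<Gamma> \<rho> has_vector_derivative \<rho> \<theta> *\<^sub>R unit_dir \<theta> + ((\<rho> \<theta> / radius_sum \<rho> \<theta>) *\<^sub>R ((- radius_sum \<rho> \<theta>) *\<^sub>R unit_dir \<theta>)
      + (radius_wronskian \<rho> \<theta> / (radius_sum \<rho> \<theta>)\<^sup>2) *\<^sub>R (\<Gamma> (\<theta> + pi) - \<Gamma> \<theta>))) (at \<theta>)"
    unfolding chord_contact_def[abs_def]
    by (intro has_vector_derivative_add has_vector_derivative_scaleR D q D')
  moreover have "\<rho> \<theta> *\<^sub>R unit_dir \<theta> + ((\<rho> \<theta> / radius_sum \<rho> \<theta>) *\<^sub>R ((- radius_sum \<rho> \<theta>) *\<^sub>R unit_dir \<theta>)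
      + (radius_wronskian \<rho> \<theta> / (radius_sum \<rho> \<theta>)\<^sup>2) *\<^sub>R (\<Gamma> (\<theta> + pi) - \<Gamma> \<theta>)) = radius_wronskian \<rho> \<theta> *\<^sub>R d \<theta>"
    unfolding d_def using Snz[of \<theta>] by simp
  ultimately show "(chord_contact \<Gamma> \<rho> has_vector_derivative radius_wronskian \<rho> \<theta> *\<^sub>R d \<theta>) (at \<theta>)" by simp
  have "vderiv d = (\<lambda>x. (1 / (radius_sum \<rho> x)\<^sup>2) *\<^sub>R ((- radius_sum \<rho> x) *\<^sub>R unit_dir x)
      + vderiv (\<lambda>\<theta>. 1 / (radius_sum \<rho> \<theta>)\<^sup>2) x *\<^sub>R (\<Gamma> (x + pi) - \<Gamma> x))"
    unfolding d_def by (intro vderiv_eqI has_vector_derivative_scaleR smooth_has_real_derivative inv D')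
  then have "cross2 (d \<theta>) (vderiv d \<theta>)
      = ((1 / (radius_sum \<rho> \<theta>)\<^sup>2) * (1 / (radius_sum \<rho> \<theta>)\<^sup>2) * radius_sum \<rho> \<theta>) * cross2 (unit_dir \<theta>) (\<Gamma> (\<theta> + pi) - \<Gamma> \<theta>)"
    unfolding d_def by (simp add: cross2_eq algebra_simps)
  also have "\<dots> \<noteq> 0" using Snz[of \<theta>] opposite_chord[OF assms(1), of \<theta>] by simp
  finally show "cross2 (d \<theta>) (vderiv d \<theta>) \<noteq> 0" .
  show "((\<lambda>\<theta>. radius_gap \<rho> \<theta> / radius_sum \<rho> \<theta>) has_real_derivative
        2 * radius_wronskian \<rho> \<theta> / (radius_sum \<rho> \<theta>)\<^sup>2) (at \<theta>)"
    by (rule DERIV_cong[OF DERIV_divide[OF radius_derivs(1)[OF assms(1)] radius_derivs(2)[OF assms(1)] Snz]])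
      (simp add: radius_wronskian_def radius_sum_def radius_gap_def power2_eq_square algebra_simps)
qed

text \<open>
  The critical points of the gap divided by the sum of the radii are the cusps of the centre
  symmetry set, its zeros are the cusps of the Wigner caustic; Rolle's theorem compares them.
\<close>

theorem cusp_numbers_of_angle_form:
  assumes af: "angle_form \<Gamma> \<rho>" and ac: "angle_change \<phi>"
    and gen: "simple_gaps \<rho>" "simple_wronskian \<rho>"
      "separated_on_zeros (radius_gap \<rho>) (mid_chord \<Gamma>)"
      "separated_on_zeros (radius_wronskian \<rho>) (chord_contact \<Gamma> \<rho>)"
  defines "W \<equiv> cusps (wigner_caustic (\<lambda>t. \<Gamma> (\<phi> t)))"
    and "C \<equiv> cusps (centre_symmetry_set (\<lambda>t. \<Gamma> (\<phi> t)))"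
  shows "(finite W \<and> odd (card W) \<and> 3 \<le> card W) \<and> (finite C \<and> odd (card C) \<and> 3 \<le> card C) \<and> card W \<le> card C"
proof -
  let ?g = "radius_gap \<rho>" and ?w = "radius_wronskian \<rho>"
  have g0: "?g x / 2 = 0 \<longleftrightarrow> ?g x = 0" for x by simp
  have g': "vderiv (\<lambda>\<theta>. ?g \<theta> / 2) = (\<lambda>\<theta>. (vderiv \<rho> \<theta> - vderiv \<rho> (\<theta> + pi)) / 2)"
    by (intro vderiv_real_eqI DERIV_cdivide radius_derivs[OF af])
  have w': "vderiv ?w = (\<lambda>\<theta>. vderiv (vderiv \<rho>) \<theta> * \<rho> (\<theta> + pi) - \<rho> \<theta> * vderiv (vderiv \<rho>) (\<theta> + pi))"
    by (intro vderiv_real_eqI radius_derivs[OF af])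
  have sg: "smooth (\<lambda>\<theta>. ?g \<theta> / 2)" using smooth_radius(1)[OF af] by (intro smooth_intros) auto
  have unit': "vderiv unit_dir = (\<lambda>\<theta>. unit_dir (\<theta> + pi / 2))"
    by (rule vderiv_eqI) (use unit_dir_has_vector_derivative[OF DERIV_ident] in simp)
  have unit_front: "cross2 (unit_dir \<theta>) (vderiv unit_dir \<theta>) \<noteq> 0" for \<theta>
    by (simp add: unit' cross2_unit_dir)
  have smu: "smooth unit_dir" using smooth_unit_dir[OF smooth_ident] by simp
  have simple1: "vderiv (\<lambda>\<theta>. ?g \<theta> / 2) \<theta> \<noteq> 0" if "?g \<theta> / 2 = 0" for \<theta>
    using gen(1) that by (simp add: g' simple_gaps_def)
  have simple2: "vderiv ?w \<theta> \<noteq> 0" if "?w \<theta> = 0" for \<theta>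
    using gen(2) that by (simp add: w' simple_wronskian_def)
  have anti1: "?g (\<theta> + pi) / 2 = - (?g \<theta> / 2)" for \<theta> using radius_antiperiodic(1)[OF af] by simp
  have inj1: "sin (x - y) = 0" if "?g x / 2 = 0" "?g y / 2 = 0" "mid_chord \<Gamma> x = mid_chord \<Gamma> y" for x y
    using gen(3) that by (simp add: separated_on_zeros_def)
  have inj2: "sin (x - y) = 0" if "?w x = 0" "?w y = 0" "chord_contact \<Gamma> \<rho> x = chord_contact \<Gamma> \<rho> y" for x y
    using gen(4) that by (simp add: separated_on_zeros_def)
  note W = card_cusps_of_front[OF mid_chord_front(1,2)[OF af] sg smu mid_chord_front(3)[OF af] unit_front simple1 anti1 inj1]
  note C = card_cusps_of_front[OF chord_contact_front(1,2)[OF af] smooth_radius(3)[OF af] chord_contact_front(3-5)[OF af] simple2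
      radius_antiperiodic(3)[OF af] inj2]
  have Weq: "W = cusps (range (mid_chord \<Gamma>))" and Ceq: "C = cusps (range (chord_contact \<Gamma> \<rho>))"
    unfolding W_def C_def wigner_caustic_angle_form[OF af ac] centre_symmetry_set_angle_form[OF af ac] by simp_all
  have cardW: "card W = card {x \<in> {a..<a + pi}. ?g x = 0}" for a
    using W(3)[of a] unfolding Weq g0 .
  have cardC: "card C = card {x \<in> {a..<a + pi}. ?w x = 0}" for a
    using C(3)[of a] unfolding Ceq .
  have oddW: "odd (card W)" using W(2) unfolding Weq .
  then have "card W \<noteq> 0" by (metis even_zero)
  then have "{x \<in> {0..<0 + pi}. ?g x = 0} \<noteq> {}" unfolding cardW[of 0] by (metis (lifting) card.empty)
  then obtain z where z: "?g z = 0" by blast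
  \<comment> \<open>A single cusp is impossible: the caustic would move to one side of the tangent at the cusp and never return.\<close>
  have "card W \<noteq> 1"
  proof
    assume "card W = 1"
    then have "card {x \<in> {z..<z + pi}. ?g x = 0} = 1" using cardW by simp
    then obtain y where single: "{x \<in> {z..<z + pi}. ?g x = 0} = {y}" by (rule card_1_singletonE)
    have "z \<in> {x \<in> {z..<z + pi}. ?g x = 0}" using z by simp
    then have "y = z" unfolding single by simp
    have only: "?g x \<noteq> 0" if "z < x" "x < z + pi" for x
    proof
      assume "?g x = 0"
      then have "x \<in> {x \<in> {z..<z + pi}. ?g x = 0}" using that by simp
      then show False unfolding single using \<open>y = z\<close> that by simp
    qed
    define h where "h x = cross2 (unit_dir z) (mid_chord \<Gamma> x)" for x
    have "(h has_real_derivative ?g x / 2 * sin (x - z)) (at x)" for x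
    proof -
      have "(h has_real_derivative cross2 0 (mid_chord \<Gamma> x) + cross2 (unit_dir z) ((?g x / 2) *\<^sub>R unit_dir x)) (at x)"
        unfolding h_def[abs_def]
        by (intro cross2_has_real_derivative has_vector_derivative_const mid_chord_front[OF af])
      moreover have "cross2 (unit_dir z) ((?g x / 2) *\<^sub>R unit_dir x) = ?g x / 2 * cross2 (unit_dir z) (unit_dir x)"
        by (simp add: cross2_eq algebra_simps)
      ultimately show ?thesis by (simp add: cross2_unit_dir) (simp add: cross2_eq)
    qed
    then obtain y where y: "z < y" "y < z + pi" "h (z + pi) - h z = (z + pi - z) * (?g y / 2 * sin (y - z))"
      using MVT2[of z "z + pi" h "\<lambda>x. ?g x / 2 * sin (x - z)"] pi_gt_zero by auto
    have "h (z + pi) = h z" by (simp add: h_def mid_chord_front(1)[OF af])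
    then have "?g y * sin (y - z) = 0" using y(3) by simp
    then show False using only[OF y(1,2)] sin_gt_zero[of "y - z"] y(1,2) by simp
  qed
  have odd3: "3 \<le> n" if "odd n" "n \<noteq> 1" for n :: nat using that by presburger
  have "3 \<le> card W" using \<open>card W \<noteq> 1\<close> oddW \<open>card W \<noteq> 0\<close> using odd3 by blast
  moreover have "card W \<le> card C"
  proof -
    let ?A = "{x \<in> {z..<z + pi}. ?g x = 0}" and ?B = "{x \<in> {z..<z + pi}. ?w x = 0}"
    let ?\<mu> = "\<lambda>\<theta>. ?g \<theta> / radius_sum \<rho> \<theta>"
    have "card ?A \<noteq> 0" using cardW[of z] \<open>card W \<noteq> 0\<close> by simp
    then have finA: "finite ?A" by (meson card.infinite)
    have "card C \<noteq> 0" using C(2) unfolding Ceq by (metis even_zero)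
    then have "card ?B \<noteq> 0" using cardC[of z] by simp
    then have finB: "finite ?B" by (meson card.infinite)
    have end0: "?\<mu> x = 0" if "x \<in> insert (z + pi) ?A" for x
      using that z radius_antiperiodic(1)[OF af, of z] by auto
    obtain h where h: "inj_on h ?A"
      "\<And>x. x \<in> ?A \<Longrightarrow> x < h x \<and> h x < z + pi \<and> 2 * ?w (h x) / (radius_sum \<rho> (h x))\<^sup>2 = 0"
      by (rule rolle_injection[OF finA _ end0 chord_contact_front(6)[OF af], of "z + pi"]) auto
    have "h ` ?A \<subseteq> ?B"
    proof
      fix y assume "y \<in> h ` ?A"
      then obtain x where x: "x \<in> ?A" "y = h x" by blast
      have "?w y = 0" using h(2)[OF x(1)] radius_sum_pos[OF af, of y] x(2) by simp
      then show "y \<in> ?B" using h(2)[OF x(1)] x by auto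
    qed
    then have "card ?A \<le> card ?B" using h(1) finB by (intro card_inj_on_le[of h])
    then show ?thesis using cardW[of z] cardC[of z] by simp
  qed
  ultimately show ?thesis
    using W(1,2) C(1,2) unfolding Weq Ceq by linarith
qed

section \<open>Genericity conditions in terms of jets\<close>

abbreviation jet :: "(real \<Rightarrow> real^2) \<Rightarrow> nat \<Rightarrow> real \<Rightarrow> real^2" where
  "jet \<gamma> k t \<equiv> (vderiv ^^ k) \<gamma> t"

definition curv0 :: "(real \<Rightarrow> real^2) \<Rightarrow> real \<Rightarrow> real" where
  "curv0 \<gamma> t = cross2 (jet \<gamma> 1 t) (jet \<gamma> 2 t)"

definition curv1 :: "(real \<Rightarrow> real^2) \<Rightarrow> real \<Rightarrow> real" where
  "curv1 \<gamma> t = cross2 (jet \<gamma> 1 t) (jet \<gamma> 3 t)"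

definition curv2 :: "(real \<Rightarrow> real^2) \<Rightarrow> real \<Rightarrow> real" where
  "curv2 \<gamma> t = cross2 (jet \<gamma> 2 t) (jet \<gamma> 3 t) + cross2 (jet \<gamma> 1 t) (jet \<gamma> 4 t)"

definition speed0 :: "(real \<Rightarrow> real^2) \<Rightarrow> real \<Rightarrow> real" where
  "speed0 \<gamma> t = jet \<gamma> 1 t \<bullet> jet \<gamma> 1 t"

definition speed1 :: "(real \<Rightarrow> real^2) \<Rightarrow> real \<Rightarrow> real" where
  "speed1 \<gamma> t = 2 * (jet \<gamma> 1 t \<bullet> jet \<gamma> 2 t)"

definition speed2 :: "(real \<Rightarrow> real^2) \<Rightarrow> real \<Rightarrow> real" where
  "speed2 \<gamma> t = 2 * (jet \<gamma> 2 t \<bullet> jet \<gamma> 2 t + jet \<gamma> 1 t \<bullet> jet \<gamma> 3 t)"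

text \<open>
  Three invariants of the curve under changes of the parameter. With \<open>\<rho>\<close> the radius of
  curvature as a function of the tangent angle, they are \<open>\<rho>\<close>, \<open>\<rho>' / \<rho>\<close> and \<open>\<rho>'' / \<rho>\<close>; the
  logarithmic derivative has the advantage of being a rational function of the jet.
\<close>

definition jet_radius :: "(real \<Rightarrow> real^2) \<Rightarrow> real \<Rightarrow> real" where
  "jet_radius \<gamma> t = norm (jet \<gamma> 1 t) ^ 3 / \<bar>curv0 \<gamma> t\<bar>"

definition jet_log1 :: "(real \<Rightarrow> real^2) \<Rightarrow> real \<Rightarrow> real" where
  "jet_log1 \<gamma> t = 3 / 2 * (speed1 \<gamma> t / curv0 \<gamma> t) - speed0 \<gamma> t * curv1 \<gamma> t / (curv0 \<gamma> t * curv0 \<gamma> t)"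

definition jet_log2 :: "(real \<Rightarrow> real^2) \<Rightarrow> real \<Rightarrow> real" where
  "jet_log2 \<gamma> t = speed0 \<gamma> t / curv0 \<gamma> t *
     (3 / 2 * ((speed2 \<gamma> t * curv0 \<gamma> t - speed1 \<gamma> t * curv1 \<gamma> t) / (curv0 \<gamma> t * curv0 \<gamma> t))
      - ((speed1 \<gamma> t * curv1 \<gamma> t + curv2 \<gamma> t * speed0 \<gamma> t) * (curv0 \<gamma> t * curv0 \<gamma> t)
         - speed0 \<gamma> t * curv1 \<gamma> t * (curv1 \<gamma> t * curv0 \<gamma> t + curv1 \<gamma> t * curv0 \<gamma> t))
        / (curv0 \<gamma> t * curv0 \<gamma> t * (curv0 \<gamma> t * curv0 \<gamma> t)))
     + jet_log1 \<gamma> t * jet_log1 \<gamma> t"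

lemma curv0_eq: "curv0 \<gamma> t = curv \<gamma> t"
  by (simp add: curv0_def numeral_2_eq_2)

lemma jet_derivs:
  assumes "smooth \<gamma>"
  shows "(curv0 \<gamma> has_real_derivative curv1 \<gamma> t) (at t)" "(curv1 \<gamma> has_real_derivative curv2 \<gamma> t) (at t)"
    "(speed0 \<gamma> has_real_derivative speed1 \<gamma> t) (at t)" "(speed1 \<gamma> has_real_derivative speed2 \<gamma> t) (at t)"
proof -
  have j: "(jet \<gamma> 1 has_vector_derivative jet \<gamma> 2 t) (at t)" "(jet \<gamma> 2 has_vector_derivative jet \<gamma> 3 t) (at t)"
    "(jet \<gamma> 3 has_vector_derivative jet \<gamma> 4 t) (at t)" for t
    using smooth_has_vderiv[OF smooth_funpow_vderiv[OF assms, of 1], of t]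
      smooth_has_vderiv[OF smooth_funpow_vderiv[OF assms, of 2], of t]
      smooth_has_vderiv[OF smooth_funpow_vderiv[OF assms, of 3], of t]
    by (simp_all add: eval_nat_numeral)
  have swap: "cross2 v v = 0" for v by (simp add: cross2_eq)
  show "(curv0 \<gamma> has_real_derivative curv1 \<gamma> t) (at t)"
    using cross2_has_real_derivative[OF j(1,2), of t] swap by (simp add: curv0_def[abs_def] curv1_def)
  show "(curv1 \<gamma> has_real_derivative curv2 \<gamma> t) (at t)"
    using cross2_has_real_derivative[OF j(1,3), of t] by (simp add: curv1_def[abs_def] curv2_def)
  show "(speed0 \<gamma> has_real_derivative speed1 \<gamma> t) (at t)"
    using inner2_has_real_derivative[OF j(1,1), of t] by (simp add: speed0_def[abs_def] speed1_def inner_commute)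
  show "(speed1 \<gamma> has_real_derivative speed2 \<gamma> t) (at t)"
    using DERIV_cmult[OF inner2_has_real_derivative[OF j(1,2), of t], of 2] by (simp add: speed1_def[abs_def] speed2_def)
qed

text \<open>
  With \<open>y = \<phi>'\<close>, the squared speed is \<open>(y * \<rho>)\<^sup>2\<close> and the cross product of the first two derivatives is
  \<open>y ^ 3 * \<rho>\<^sup>2\<close>, both for increasing and decreasing \<open>\<phi>\<close>; the speed \<open>y\<close> cancels in the invariants.
\<close>

lemma jets_of_angle_form:
  assumes "angle_form \<Gamma> \<rho>" "angle_change \<phi>"
  defines "\<gamma> \<equiv> \<lambda>t. \<Gamma> (\<phi> t)"
  shows "curv \<gamma> t \<noteq> 0" "jet_radius \<gamma> t = \<rho> (\<phi> t)" "jet_log1 \<gamma> t = vderiv \<rho> (\<phi> t) / \<rho> (\<phi> t)"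
    "jet_log2 \<gamma> t = vderiv (vderiv \<rho>) (\<phi> t) / \<rho> (\<phi> t)"
proof -
  define y where "y = vderiv \<phi>"
  define y' where "y' = vderiv y"
  define r where "r t = \<rho> (\<phi> t)" for t
  define r1 where "r1 t = vderiv \<rho> (\<phi> t)" for t
  define r2 where "r2 t = vderiv (vderiv \<rho>) (\<phi> t)" for t
  have sm: "smooth \<phi>" and nz: "\<And>t. y t \<noteq> 0" using assms(2) by (auto simp: angle_change_def y_def)
  have sr: "smooth \<rho>" using angle_formD(2)[OF assms(1)] .
  have pos: "0 < r t" for t using angle_formD(4)[OF assms(1)] by (simp add: r_def)
  have sg: "smooth \<gamma>" unfolding \<gamma>_def by (rule angle_form_compose_deriv(1)[OF assms(1,2)])
  have dphi: "(\<phi> has_real_derivative y t) (at t)" for t unfolding y_def by (rule smooth_has_real_derivative[OF sm])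
  have dy: "(y has_real_derivative y' t) (at t)" for t
    unfolding y_def y'_def by (rule smooth_has_real_derivative[OF smooth_vderiv[OF sm]])
  have dr: "(r has_real_derivative r1 t * y t) (at t)" for t
    unfolding r_def[abs_def] r1_def by (rule DERIV_chain2[OF smooth_has_real_derivative[OF sr] dphi])
  have dr1: "(r1 has_real_derivative r2 t * y t) (at t)" for t
    unfolding r1_def[abs_def] r2_def
    by (rule DERIV_chain2[OF smooth_has_real_derivative[OF smooth_vderiv[OF sr]] dphi])
  have g1: "vderiv \<gamma> = (\<lambda>t. (y t * r t) *\<^sub>R unit_dir (\<phi> t))"
    unfolding \<gamma>_def r_def y_def by (rule angle_form_compose_deriv(2)[OF assms(1,2)])
  have g2: "vderiv (vderiv \<gamma>) = (\<lambda>t. (y t * r t) *\<^sub>R (y t *\<^sub>R unit_dir (\<phi> t + pi / 2)) + (y' t * r t + r1 t * y t * y t) *\<^sub>R unit_dir (\<phi> t))"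
    unfolding g1
    by (intro vderiv_eqI has_vector_derivative_scaleR DERIV_mult dy dr unit_dir_has_vector_derivative dphi)
  have K: "curv0 \<gamma> t = y t ^ 3 * (r t)\<^sup>2" for t
  proof -
    have "curv0 \<gamma> t = y t ^ 3 * (r t)\<^sup>2 * cross2 (unit_dir (\<phi> t)) (unit_dir (\<phi> t + pi / 2))"
      unfolding curv0_eq fun_cong[OF g1] fun_cong[OF g2]
      by (simp add: cross2_eq power3_eq_cube power2_eq_square algebra_simps)
    then show ?thesis by (simp add: cross2_unit_dir)
  qed
  have N: "speed0 \<gamma> t = (y t * r t)\<^sup>2" for t
    by (simp add: speed0_def g1 inner_unit_dir power2_eq_square)
  have Knz: "curv0 \<gamma> t \<noteq> 0" for t using K nz pos[of t] by simp
  show "curv \<gamma> t \<noteq> 0" using Knz curv0_eq by metis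
  show "jet_radius \<gamma> t = \<rho> (\<phi> t)"
  proof -
    have "norm (jet \<gamma> 1 t) = \<bar>y t\<bar> * r t" using pos[of t] by (simp add: g1 abs_mult)
    moreover have "\<bar>curv0 \<gamma> t\<bar> = \<bar>y t\<bar> ^ 3 * (r t)\<^sup>2" unfolding K by (simp add: abs_mult power_abs)
    moreover have "(a * b) ^ 3 / (a ^ 3 * b\<^sup>2) = b" if "a \<noteq> 0" "b \<noteq> 0" for a b :: real
      using that by (simp add: power_mult_distrib power3_eq_cube power2_eq_square)
    ultimately have "jet_radius \<gamma> t = r t"
      unfolding jet_radius_def using nz[of t] pos[of t] by (metis abs_eq_0 less_irrefl)
    then show ?thesis by (simp add: r_def)
  qed
  have n1: "speed1 \<gamma> t = 2 * (y t * r t) * (y' t * r t + r1 t * y t * y t)" for t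
  proof (rule DERIV_unique[OF jet_derivs(3)[OF sg]])
    show "(speed0 \<gamma> has_real_derivative 2 * (y t * r t) * (y' t * r t + r1 t * y t * y t)) (at t)"
      unfolding N[abs_def] ext[of "speed0 \<gamma>", OF N]
      by (rule DERIV_cong[OF DERIV_power[OF DERIV_mult[OF dy dr]]]) (simp add: algebra_simps)
  qed
  have c1: "curv1 \<gamma> t = 3 * (y t)\<^sup>2 * y' t * (r t)\<^sup>2 + y t ^ 3 * (2 * r t * (r1 t * y t))" for t
  proof (rule DERIV_unique[OF jet_derivs(1)[OF sg]])
    show "(curv0 \<gamma> has_real_derivative 3 * (y t)\<^sup>2 * y' t * (r t)\<^sup>2 + y t ^ 3 * (2 * r t * (r1 t * y t))) (at t)"
      unfolding ext[of "curv0 \<gamma>", OF K]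
      by (rule DERIV_cong[OF DERIV_mult[OF DERIV_power[OF dy] DERIV_power[OF dr]]]) (simp add: algebra_simps)
  qed
  have L: "jet_log1 \<gamma> t = r1 t / r t" for t
    unfolding jet_log1_def n1 c1 K N using nz[of t] pos[of t]
    by (simp add: field_simps power2_eq_square power3_eq_cube)
  then show "jet_log1 \<gamma> t = vderiv \<rho> (\<phi> t) / \<rho> (\<phi> t)" by (simp add: r1_def r_def)
  let ?d = "3 / 2 * ((speed2 \<gamma> t * curv0 \<gamma> t - speed1 \<gamma> t * curv1 \<gamma> t) / (curv0 \<gamma> t * curv0 \<gamma> t))
      - ((speed1 \<gamma> t * curv1 \<gamma> t + curv2 \<gamma> t * speed0 \<gamma> t) * (curv0 \<gamma> t * curv0 \<gamma> t)
         - speed0 \<gamma> t * curv1 \<gamma> t * (curv1 \<gamma> t * curv0 \<gamma> t + curv1 \<gamma> t * curv0 \<gamma> t))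
        / (curv0 \<gamma> t * curv0 \<gamma> t * (curv0 \<gamma> t * curv0 \<gamma> t))"
  have cc: "curv0 \<gamma> t * curv0 \<gamma> t \<noteq> 0" using Knz[of t] by simp
  have "(jet_log1 \<gamma> has_real_derivative ?d) (at t)"
    unfolding jet_log1_def[abs_def]
    by (intro DERIV_diff DERIV_cmult DERIV_divide DERIV_mult jet_derivs[OF sg] Knz cc)
  moreover have "(jet_log1 \<gamma> has_real_derivative (r2 t * y t * r t - r1 t * (r1 t * y t)) / (r t * r t)) (at t)"
    unfolding ext[of "jet_log1 \<gamma>", OF L]
    by (rule DERIV_divide[OF dr1 dr]) (use pos[of t] in simp)
  ultimately have d: "?d = (r2 t * y t * r t - r1 t * (r1 t * y t)) / (r t * r t)" by (rule DERIV_unique)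
  have "jet_log2 \<gamma> t = speed0 \<gamma> t / curv0 \<gamma> t * ((r2 t * y t * r t - r1 t * (r1 t * y t)) / (r t * r t))
      + (r1 t / r t) * (r1 t / r t)"
    unfolding jet_log2_def d L ..
  also have "\<dots> = r2 t / r t"
    unfolding K N using nz[of t] pos[of t] by (simp add: field_simps power2_eq_square power3_eq_cube)
  finally show "jet_log2 \<gamma> t = vderiv (vderiv \<rho>) (\<phi> t) / \<rho> (\<phi> t)" by (simp add: r2_def r_def)
qed

text \<open>
  Parallel tangent vectors of a regular curve are not orthogonal, so the weak inequality means that
  they have opposite directions; being weak, it makes the condition closed.
\<close>

definition antiparallel :: "(real \<Rightarrow> real^2) \<Rightarrow> real \<Rightarrow> real \<Rightarrow> bool" where
  "antiparallel \<gamma> s t \<longleftrightarrow> cross2 (jet \<gamma> 1 s) (jet \<gamma> 1 t) = 0 \<and> jet \<gamma> 1 s \<bullet> jet \<gamma> 1 t \<le> 0"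

lemma antiparallel_angle_form:
  assumes "angle_form \<Gamma> \<rho>" "angle_change \<phi>"
  shows "antiparallel (\<lambda>t. \<Gamma> (\<phi> t)) s t \<longleftrightarrow> (\<exists>k::int. \<phi> t = \<phi> s + pi + of_int k * (2 * pi))"
    "\<exists>c>0. cross2 (jet (\<lambda>t. \<Gamma> (\<phi> t)) 1 s) (jet (\<lambda>t. \<Gamma> (\<phi> t)) 1 t) = c * sin (\<phi> t - \<phi> s) \<and>
       norm (jet (\<lambda>t. \<Gamma> (\<phi> t)) 1 s) * norm (jet (\<lambda>t. \<Gamma> (\<phi> t)) 1 t) = c"
proof -
  let ?\<gamma> = "\<lambda>t. \<Gamma> (\<phi> t)"
  obtain \<sigma> :: real where s: "\<sigma> = 1 \<or> \<sigma> = -1" "\<And>t. 0 < \<sigma> * vderiv \<phi> t" using angle_changeD[OF assms(2)] by metis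
  define a where "a t = vderiv \<phi> t * \<rho> (\<phi> t)" for t
  have \<gamma>': "jet ?\<gamma> 1 t = a t *\<^sub>R unit_dir (\<phi> t)" for t
    using angle_form_compose_deriv(2)[OF assms] by (simp add: a_def)
  have "0 < (\<sigma> * vderiv \<phi> s) * (\<sigma> * vderiv \<phi> t) * (\<rho> (\<phi> s) * \<rho> (\<phi> t))"
    by (rule mult_pos_pos[OF mult_pos_pos[OF s(2) s(2)] mult_pos_pos[OF angle_formD(4)[OF assms(1)] angle_formD(4)[OF assms(1)]]])
  then have c: "0 < a s * a t" using s(1) by (auto simp: a_def mult_ac)
  have 1: "cross2 (jet ?\<gamma> 1 s) (jet ?\<gamma> 1 t) = (a s * a t) * sin (\<phi> t - \<phi> s)"
    unfolding \<gamma>' cross2_unit_dir[symmetric] by (simp add: cross2_eq algebra_simps)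
  have 2: "jet ?\<gamma> 1 s \<bullet> jet ?\<gamma> 1 t = (a s * a t) * cos (\<phi> t - \<phi> s)"
    unfolding \<gamma>' by (simp add: inner_unit_dir)
  have 3: "norm (jet ?\<gamma> 1 s) * norm (jet ?\<gamma> 1 t) = a s * a t"
    unfolding \<gamma>' using c by (simp flip: abs_mult)
  show "\<exists>c>0. cross2 (jet ?\<gamma> 1 s) (jet ?\<gamma> 1 t) = c * sin (\<phi> t - \<phi> s) \<and> norm (jet ?\<gamma> 1 s) * norm (jet ?\<gamma> 1 t) = c"
    using 1 3 c by blast
  have "antiparallel ?\<gamma> s t \<longleftrightarrow> sin (\<phi> t - \<phi> s) = 0 \<and> cos (\<phi> t - \<phi> s) \<le> 0"
  proof -
    have "p * z = 0 \<longleftrightarrow> z = 0" "p * z \<le> 0 \<longleftrightarrow> z \<le> 0" if "0 < p" for p z :: real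
      using that by (simp_all add: mult_le_0_iff)
    then show ?thesis unfolding antiparallel_def 1 2 using c by metis
  qed
  also have "\<dots> \<longleftrightarrow> (\<exists>k::int. \<phi> t = \<phi> s + pi + of_int k * (2 * pi))"
  proof
    assume sc: "sin (\<phi> t - \<phi> s) = 0 \<and> cos (\<phi> t - \<phi> s) \<le> 0"
    then have "cos (\<phi> t - \<phi> s) = -1" using sin_zero_abs_cos_one[of "\<phi> t - \<phi> s"] by auto
    then have "cos (\<phi> t - \<phi> s - pi) = 1" by simp
    then obtain k :: int where "\<phi> t - \<phi> s - pi = of_int k * 2 * pi" using cos_one_2pi_int by blast
    then show "\<exists>k::int. \<phi> t = \<phi> s + pi + of_int k * (2 * pi)" by (intro exI[of _ k]) simp
  next
    assume "\<exists>k::int. \<phi> t = \<phi> s + pi + of_int k * (2 * pi)"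
    then obtain k :: int where k: "\<phi> t - \<phi> s = pi + of_int k * (2 * pi)" by auto
    show "sin (\<phi> t - \<phi> s) = 0 \<and> cos (\<phi> t - \<phi> s) \<le> 0"
      unfolding k periodic_int_multiple[of sin "2 * pi", OF sin_periodic]
        periodic_int_multiple[of cos "2 * pi", OF cos_periodic] by simp
  qed
  finally show "antiparallel ?\<gamma> s t \<longleftrightarrow> (\<exists>k::int. \<phi> t = \<phi> s + pi + of_int k * (2 * pi))" .
qed

text \<open>
  The violations of the genericity conditions, as closed conditions on the jets of the curve at
  two antiparallel pairs \<open>(s, t)\<close> and \<open>(s', t')\<close>. Coincidences of two cusps are only
  recorded for pairs whose directions have a definite distance, to keep the conditions closed.
\<close>

type_synonym violation = "(real \<Rightarrow> real^2) \<Rightarrow> real \<times> real \<times> real \<times> real \<Rightarrow> bool"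

definition double_gap :: violation where
  "double_gap \<gamma> = (\<lambda>(s, t, s', t'). antiparallel \<gamma> s t \<and> jet_radius \<gamma> s = jet_radius \<gamma> t \<and>
     jet_log1 \<gamma> s = jet_log1 \<gamma> t)"

definition double_wronskian :: violation where
  "double_wronskian \<gamma> = (\<lambda>(s, t, s', t'). antiparallel \<gamma> s t \<and> jet_log1 \<gamma> s = jet_log1 \<gamma> t \<and>
     jet_log2 \<gamma> s = jet_log2 \<gamma> t)"

definition far_directions :: "nat \<Rightarrow> violation" where
  "far_directions n \<gamma> = (\<lambda>(s, t, s', t'). norm (jet \<gamma> 1 s) * norm (jet \<gamma> 1 s')
     \<le> real (Suc n) * \<bar>cross2 (jet \<gamma> 1 s) (jet \<gamma> 1 s')\<bar>)"

definition caustic_coincidence :: "nat \<Rightarrow> violation" where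
  "caustic_coincidence n \<gamma> = (\<lambda>(s, t, s', t'). antiparallel \<gamma> s t \<and> antiparallel \<gamma> s' t' \<and>
     far_directions n \<gamma> (s, t, s', t') \<and> jet_radius \<gamma> s = jet_radius \<gamma> t \<and> jet_radius \<gamma> s' = jet_radius \<gamma> t' \<and>
     jet \<gamma> 0 s + jet \<gamma> 0 t = jet \<gamma> 0 s' + jet \<gamma> 0 t')"

definition contact_point :: "(real \<Rightarrow> real^2) \<Rightarrow> real \<Rightarrow> real \<Rightarrow> real^2" where
  "contact_point \<gamma> s t = jet \<gamma> 0 s + (jet_radius \<gamma> s / (jet_radius \<gamma> s + jet_radius \<gamma> t)) *\<^sub>R (jet \<gamma> 0 t - jet \<gamma> 0 s)"

definition contact_coincidence :: "nat \<Rightarrow> violation" where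
  "contact_coincidence n \<gamma> = (\<lambda>(s, t, s', t'). antiparallel \<gamma> s t \<and> antiparallel \<gamma> s' t' \<and>
     far_directions n \<gamma> (s, t, s', t') \<and> jet_log1 \<gamma> s = jet_log1 \<gamma> t \<and> jet_log1 \<gamma> s' = jet_log1 \<gamma> t' \<and>
     contact_point \<gamma> s t = contact_point \<gamma> s' t')"

definition closed_violation :: "violation \<Rightarrow> bool" where
  "closed_violation bad \<longleftrightarrow> (\<forall>H \<gamma> q p. jet_tendsto H \<gamma> \<longrightarrow> q \<longlonglongrightarrow> p \<longrightarrow> (\<forall>t. curv \<gamma> t \<noteq> 0) \<longrightarrow>
     (\<forall>m. bad (H m) (q m)) \<longrightarrow> bad \<gamma> p)"

lemma cross2_lim: "(f \<longlongrightarrow> a) F \<Longrightarrow> (g \<longlongrightarrow> b) F \<Longrightarrow> ((\<lambda>m. cross2 (f m) (g m)) \<longlongrightarrow> cross2 a b) F"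
  unfolding cross2_eq by (intro tendsto_intros)

context
  fixes H \<gamma> assumes H: "jet_tendsto H \<gamma>" and nz: "\<And>t. curv \<gamma> t \<noteq> 0"
begin

lemma jet_lim: "s \<longlonglongrightarrow> x \<Longrightarrow> (\<lambda>m. jet (H m) k (s m)) \<longlonglongrightarrow> jet \<gamma> k x"
  using H unfolding jet_tendsto_def by blast

lemma curv_lim:
  assumes "s \<longlonglongrightarrow> x"
  shows "(\<lambda>m. curv0 (H m) (s m)) \<longlonglongrightarrow> curv0 \<gamma> x" "(\<lambda>m. curv1 (H m) (s m)) \<longlonglongrightarrow> curv1 \<gamma> x"
    "(\<lambda>m. curv2 (H m) (s m)) \<longlonglongrightarrow> curv2 \<gamma> x"
    "(\<lambda>m. speed0 (H m) (s m)) \<longlonglongrightarrow> speed0 \<gamma> x" "(\<lambda>m. speed1 (H m) (s m)) \<longlonglongrightarrow> speed1 \<gamma> x"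
    "(\<lambda>m. speed2 (H m) (s m)) \<longlonglongrightarrow> speed2 \<gamma> x"
  unfolding curv0_def curv1_def curv2_def speed0_def speed1_def speed2_def
  by (intro tendsto_intros cross2_lim jet_lim assms)+

lemma jet_radius_lim:
  assumes "s \<longlonglongrightarrow> x"
  shows "(\<lambda>m. jet_radius (H m) (s m)) \<longlonglongrightarrow> jet_radius \<gamma> x"
  unfolding jet_radius_def using nz[of x]
  by (intro tendsto_intros jet_lim curv_lim assms) (simp add: curv0_eq)

lemma jet_log1_lim:
  assumes "s \<longlonglongrightarrow> x"
  shows "(\<lambda>m. jet_log1 (H m) (s m)) \<longlonglongrightarrow> jet_log1 \<gamma> x"
  unfolding jet_log1_def using nz[of x]
  by (intro tendsto_intros curv_lim assms) (simp_all add: curv0_eq)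

lemma jet_log2_lim:
  assumes "s \<longlonglongrightarrow> x"
  shows "(\<lambda>m. jet_log2 (H m) (s m)) \<longlonglongrightarrow> jet_log2 \<gamma> x"
  unfolding jet_log2_def using nz[of x]
  by (intro tendsto_intros curv_lim jet_log1_lim assms) (simp_all add: curv0_eq)

lemma jet_radius_pos: "0 < jet_radius \<gamma> x"
proof -
  have "jet \<gamma> 1 x \<noteq> 0" using nz[of x] by (auto simp: cross2_eq)
  then show ?thesis using nz[of x] by (simp add: jet_radius_def curv0_eq)
qed

lemma contact_point_lim:
  assumes "s \<longlonglongrightarrow> x" "t \<longlonglongrightarrow> y"
  shows "(\<lambda>m. contact_point (H m) (s m) (t m)) \<longlonglongrightarrow> contact_point \<gamma> x y"
  unfolding contact_point_def
  by (intro tendsto_intros jet_lim jet_radius_lim assms) (use jet_radius_pos[of x] jet_radius_pos[of y] in simp)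

end

lemma closed_violation_conj:
  "closed_violation A \<Longrightarrow> closed_violation B \<Longrightarrow> closed_violation (\<lambda>\<gamma> p. A \<gamma> p \<and> B \<gamma> p)"
  unfolding closed_violation_def by meson

lemma closed_violation_eq:
  fixes f g :: "(real \<Rightarrow> real^2) \<Rightarrow> real \<times> real \<times> real \<times> real \<Rightarrow> 'b::t2_space"
  assumes "\<And>H \<gamma> q p. jet_tendsto H \<gamma> \<Longrightarrow> (\<And>t. curv \<gamma> t \<noteq> 0) \<Longrightarrow> q \<longlonglongrightarrow> p \<Longrightarrow> (\<lambda>m. f (H m) (q m)) \<longlonglongrightarrow> f \<gamma> p"
    "\<And>H \<gamma> q p. jet_tendsto H \<gamma> \<Longrightarrow> (\<And>t. curv \<gamma> t \<noteq> 0) \<Longrightarrow> q \<longlonglongrightarrow> p \<Longrightarrow> (\<lambda>m. g (H m) (q m)) \<longlonglongrightarrow> g \<gamma> p"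
  shows "closed_violation (\<lambda>\<gamma> p. f \<gamma> p = g \<gamma> p)"
  unfolding closed_violation_def
proof (intro allI impI)
  fix H \<gamma> q p
  assume a: "jet_tendsto H \<gamma>" "q \<longlonglongrightarrow> p" "\<forall>t. curv \<gamma> t \<noteq> 0" "\<forall>m. f (H m) (q m) = g (H m) (q m)"
  have "(\<lambda>m. g (H m) (q m)) \<longlonglongrightarrow> f \<gamma> p" using assms(1)[OF a(1) _ a(2)] a(3,4) by simp
  then show "f \<gamma> p = g \<gamma> p" using assms(2)[OF a(1) _ a(2)] a(3) LIMSEQ_unique by blast
qed

lemma closed_violation_le:
  fixes f g :: "(real \<Rightarrow> real^2) \<Rightarrow> real \<times> real \<times> real \<times> real \<Rightarrow> real"
  assumes "\<And>H \<gamma> q p. jet_tendsto H \<gamma> \<Longrightarrow> (\<And>t. curv \<gamma> t \<noteq> 0) \<Longrightarrow> q \<longlonglongrightarrow> p \<Longrightarrow> (\<lambda>m. f (H m) (q m)) \<longlonglongrightarrow> f \<gamma> p"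
    "\<And>H \<gamma> q p. jet_tendsto H \<gamma> \<Longrightarrow> (\<And>t. curv \<gamma> t \<noteq> 0) \<Longrightarrow> q \<longlonglongrightarrow> p \<Longrightarrow> (\<lambda>m. g (H m) (q m)) \<longlonglongrightarrow> g \<gamma> p"
  shows "closed_violation (\<lambda>\<gamma> p. f \<gamma> p \<le> g \<gamma> p)"
  unfolding closed_violation_def
proof (intro allI impI)
  fix H \<gamma> q p
  assume a: "jet_tendsto H \<gamma>" "q \<longlonglongrightarrow> p" "\<forall>t. curv \<gamma> t \<noteq> 0" "\<forall>m. f (H m) (q m) \<le> g (H m) (q m)"
  show "f \<gamma> p \<le> g \<gamma> p"
    by (rule LIMSEQ_le[OF assms(1)[OF a(1) _ a(2)] assms(2)[OF a(1) _ a(2)]]) (use a(3,4) in blast)+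
qed

lemma closed_violations:
  "closed_violation double_gap" "closed_violation double_wronskian"
  "closed_violation (caustic_coincidence n)" "closed_violation (contact_coincidence n)"
proof -
  note lims = tendsto_fst tendsto_snd tendsto_norm tendsto_mult tendsto_inner tendsto_rabs tendsto_add tendsto_const
    cross2_lim jet_lim jet_radius_lim jet_log1_lim jet_log2_lim contact_point_lim
  note closed = closed_violation_conj closed_violation_eq closed_violation_le
  let ?s = "fst" and ?t = "\<lambda>p. fst (snd p)" and ?s' = "\<lambda>p. fst (snd (snd p))" and ?t' = "\<lambda>p. snd (snd (snd p))"
  have eq: "double_gap = (\<lambda>\<gamma> p. antiparallel \<gamma> (?s p) (?t p) \<and> jet_radius \<gamma> (?s p) = jet_radius \<gamma> (?t p) \<and>
      jet_log1 \<gamma> (?s p) = jet_log1 \<gamma> (?t p))"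
    by (auto simp: double_gap_def fun_eq_iff)
  show "closed_violation double_gap"
    unfolding eq antiparallel_def by (intro closed; intro lims; (assumption | blast))
  have eq: "double_wronskian = (\<lambda>\<gamma> p. antiparallel \<gamma> (?s p) (?t p) \<and> jet_log1 \<gamma> (?s p) = jet_log1 \<gamma> (?t p) \<and>
      jet_log2 \<gamma> (?s p) = jet_log2 \<gamma> (?t p))"
    by (auto simp: double_wronskian_def fun_eq_iff)
  show "closed_violation double_wronskian"
    unfolding eq antiparallel_def by (intro closed; intro lims; (assumption | blast))
  have eq: "caustic_coincidence n = (\<lambda>\<gamma> p. antiparallel \<gamma> (?s p) (?t p) \<and> antiparallel \<gamma> (?s' p) (?t' p) \<and>
      norm (jet \<gamma> 1 (?s p)) * norm (jet \<gamma> 1 (?s' p)) \<le> real (Suc n) * \<bar>cross2 (jet \<gamma> 1 (?s p)) (jet \<gamma> 1 (?s' p))\<bar> \<and>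
      jet_radius \<gamma> (?s p) = jet_radius \<gamma> (?t p) \<and> jet_radius \<gamma> (?s' p) = jet_radius \<gamma> (?t' p) \<and>
      jet \<gamma> 0 (?s p) + jet \<gamma> 0 (?t p) = jet \<gamma> 0 (?s' p) + jet \<gamma> 0 (?t' p))"
    by (auto simp: caustic_coincidence_def far_directions_def fun_eq_iff)
  show "closed_violation (caustic_coincidence n)"
    unfolding eq antiparallel_def by (intro closed; intro lims; (assumption | blast))
  have eq: "contact_coincidence n = (\<lambda>\<gamma> p. antiparallel \<gamma> (?s p) (?t p) \<and> antiparallel \<gamma> (?s' p) (?t' p) \<and>
      norm (jet \<gamma> 1 (?s p)) * norm (jet \<gamma> 1 (?s' p)) \<le> real (Suc n) * \<bar>cross2 (jet \<gamma> 1 (?s p)) (jet \<gamma> 1 (?s' p))\<bar> \<and>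
      jet_log1 \<gamma> (?s p) = jet_log1 \<gamma> (?t p) \<and> jet_log1 \<gamma> (?s' p) = jet_log1 \<gamma> (?t' p) \<and>
      contact_point \<gamma> (?s p) (?t p) = contact_point \<gamma> (?s' p) (?t' p))"
    by (auto simp: contact_coincidence_def far_directions_def fun_eq_iff)
  show "closed_violation (contact_coincidence n)"
    unfolding eq antiparallel_def by (intro closed; intro lims; (assumption | blast))
qed

definition parameter_cube :: "(real \<times> real \<times> real \<times> real) set" where
  "parameter_cube = {0..1} \<times> {0..1} \<times> {0..1} \<times> {0..1}"

definition avoiding :: "violation \<Rightarrow> (real \<Rightarrow> real^2) set" where
  "avoiding bad = {\<gamma>. convex_curve \<gamma> \<and> (\<forall>t. curv \<gamma> t \<noteq> 0) \<and> (\<forall>p\<in>parameter_cube. \<not> bad \<gamma> p)}"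

lemma curv_nonzero_open:
  assumes "smooth_loop \<gamma>" "\<And>t. curv \<gamma> t \<noteq> 0"
  obtains n e where "0 < e" "\<And>\<eta> t. \<eta> \<in> Ck_ball \<gamma> n e \<Longrightarrow> curv \<eta> t \<noteq> 0"
proof -
  have closed: "curv \<gamma> p = 0" if H: "jet_tendsto H \<gamma>" and "q \<longlonglongrightarrow> p" "\<And>m. curv (H m) (q m) = 0" for H q p
  proof -
    have "(\<lambda>m. curv0 (H m) (q m)) \<longlonglongrightarrow> curv0 \<gamma> p" by (rule curv_lim(1)[OF H assms(2) that(2)])
    moreover have "(\<lambda>m. curv0 (H m) (q m)) = (\<lambda>m. 0)" using that(3) by (auto simp: curv0_eq)
    ultimately show ?thesis by (simp only: LIMSEQ_const_iff curv0_eq)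
  qed
  obtain n e where ne: "0 < e" "\<And>\<eta> p. \<eta> \<in> Ck_ball \<gamma> n e \<Longrightarrow> p \<in> {0..1} \<Longrightarrow> curv \<eta> p \<noteq> 0"
  proof (rule stable_avoidance[OF assms(1) compact_Icc, where bad = "\<lambda>\<eta> t. curv \<eta> t = 0"])
    fix H q p assume "jet_tendsto H \<gamma>" "q \<longlonglongrightarrow> p" "\<And>m. curv (H m) (q m) = 0"
    then show "curv \<gamma> p = 0" by (rule closed)
  qed (use assms(2) in blast)+
  have "curv \<eta> t \<noteq> 0" if "\<eta> \<in> Ck_ball \<gamma> n e" for \<eta> t
  proof -
    have sl: "smooth_loop \<eta>" using that by (simp add: Ck_ball_def)
    obtain k :: int where k: "0 \<le> t + of_int k * 1" "t + of_int k * 1 < 0 + 1"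
      using shift_into_period[of 1 0 t] by auto
    have "curv \<eta> (t + 1) = curv \<eta> t" for t
      using sl funpow_vderiv_periodic[of \<eta> 1 1 t] funpow_vderiv_periodic[of \<eta> 1 2 t]
      by (simp add: smooth_loop_def numeral_2_eq_2)
    then have "curv \<eta> (t + of_int k * 1) = curv \<eta> t" by (rule periodic_int_multiple[where f = "curv \<eta>"])
    then show ?thesis using ne(2)[OF that, of "t + of_int k * 1"] k by simp
  qed
  then show ?thesis using that ne(1) by blast
qed

lemma avoiding_open:
  assumes "closed_violation bad" "\<gamma> \<in> avoiding bad"
  shows "\<exists>n e. 0 < e \<and> Ck_ball \<gamma> n e \<inter> {\<gamma>. convex_curve \<gamma>} \<subseteq> avoiding bad"
proof -
  have g: "convex_curve \<gamma>" "\<And>t. curv \<gamma> t \<noteq> 0" "\<And>p. p \<in> parameter_cube \<Longrightarrow> \<not> bad \<gamma> p"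
    using assms(2) by (auto simp: avoiding_def)
  have sl: "smooth_loop \<gamma>" using g(1) by (rule convex_curve_smooth_loop)
  have closed: "bad \<gamma> p" if "jet_tendsto H \<gamma>" "q \<longlonglongrightarrow> p" "\<And>m. bad (H m) (q m)" for H q p
    using assms(1) g(2) that unfolding closed_violation_def by blast
  have cp: "compact parameter_cube"
    unfolding parameter_cube_def by (intro compact_Times compact_Icc)
  obtain n e where ne: "0 < e" "\<And>\<eta> p. \<eta> \<in> Ck_ball \<gamma> n e \<Longrightarrow> p \<in> parameter_cube \<Longrightarrow> \<not> bad \<eta> p"
  proof (rule stable_avoidance[OF sl cp, where bad = bad])
    fix H q p assume "jet_tendsto H \<gamma>" "q \<longlonglongrightarrow> p" "\<And>m. bad (H m) (q m)"
    then show "bad \<gamma> p" by (rule closed)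
  qed (use g(3) in blast)+
  obtain n' e' where ne': "0 < e'" "\<And>\<eta> t. \<eta> \<in> Ck_ball \<gamma> n' e' \<Longrightarrow> curv \<eta> t \<noteq> 0"
  proof (rule curv_nonzero_open[OF sl g(2)])
    fix n e assume "0 < e" "\<And>\<eta> t. \<eta> \<in> Ck_ball \<gamma> n e \<Longrightarrow> curv \<eta> t \<noteq> 0"
    then show thesis by (rule that)
  qed
  have "Ck_ball \<gamma> (max n n') (min e e') \<subseteq> Ck_ball \<gamma> n e \<inter> Ck_ball \<gamma> n' e'"
    using Ck_ball_mono[of n "max n n'" "min e e'" e \<gamma>] Ck_ball_mono[of n' "max n n'" "min e e'" e' \<gamma>] by auto
  then have "\<eta> \<in> avoiding bad" if "\<eta> \<in> Ck_ball \<gamma> (max n n') (min e e')" "convex_curve \<eta>" for \<eta>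
    unfolding avoiding_def using that ne(2)[of \<eta>] ne'(2)[of \<eta>] by auto
  then have "Ck_ball \<gamma> (max n n') (min e e') \<inter> {\<gamma>. convex_curve \<gamma>} \<subseteq> avoiding bad" by blast
  then show ?thesis
    using ne(1) ne'(1) by (intro exI[of _ "max n n'"] exI[of _ "min e e'"]) simp
qed

lemma angle_change_param:
  assumes "angle_change \<phi>"
  obtains s and k :: int where "s \<in> {0..1}" "\<phi> s = \<theta> + of_int k * (2 * pi)"
proof -
  obtain \<sigma> :: real where sg: "\<sigma> = 1 \<or> \<sigma> = -1" "\<And>t. \<phi> (t + 1) = \<phi> t + \<sigma> * (2 * pi)"
    using angle_changeD[OF assms] by metis
  obtain \<tau> where tau: "\<And>x. \<phi> (\<tau> x) = x" using angle_change_inverse[OF assms] by metis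
  obtain j :: int where j: "0 \<le> \<tau> \<theta> + of_int j * 1" "\<tau> \<theta> + of_int j * 1 < 0 + 1"
    using shift_into_period[of 1 0 "\<tau> \<theta>"] by auto
  have eq: "\<phi> (\<tau> \<theta> + of_int j) = \<theta> + \<sigma> * of_int j * (2 * pi)"
    using angle_change_int[of \<phi> \<sigma> "\<tau> \<theta>" j, OF sg(2)] tau by simp
  have "\<tau> \<theta> + of_int j \<in> {0..1}" using j by auto
  moreover have "\<phi> (\<tau> \<theta> + of_int j) = \<theta> + of_int (if \<sigma> = 1 then j else - j) * (2 * pi)"
    using eq sg(1) by auto
  ultimately show ?thesis by (rule that)
qed

text \<open>
  Every tangent direction occurs at a parameter in the unit interval, so avoiding the violations on
  the cube of parameters amounts to the conditions on the radius of curvature at all angles.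
\<close>

context
  fixes \<Gamma> \<rho> \<phi> assumes af: "angle_form \<Gamma> \<rho>" and ac: "angle_change \<phi>"
begin

lemma radius_int_periodic:
  "vderiv \<rho> (x + of_int k * (2 * pi)) = vderiv \<rho> x"
  "vderiv (vderiv \<rho>) (x + of_int k * (2 * pi)) = vderiv (vderiv \<rho>) x"
proof -
  have sr: "smooth \<rho>" using angle_formD(2)[OF af] .
  have p1: "vderiv \<rho> (x + 2 * pi) = vderiv \<rho> x" for x
    using vderiv_periodic[OF sr] angle_formD(6)[OF af] by blast
  then show "vderiv \<rho> (x + of_int k * (2 * pi)) = vderiv \<rho> x" by (rule periodic_int_multiple)
  have p2: "vderiv (vderiv \<rho>) (x + 2 * pi) = vderiv (vderiv \<rho>) x" for x
    using vderiv_periodic[OF smooth_vderiv[OF sr]] p1 by blast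
  then show "vderiv (vderiv \<rho>) (x + of_int k * (2 * pi)) = vderiv (vderiv \<rho>) x" by (rule periodic_int_multiple)
qed

lemma antiparallel_dictionary:
  assumes "antiparallel (\<lambda>t. \<Gamma> (\<phi> t)) s t" "\<phi> s = \<theta> + of_int j * (2 * pi)"
  shows "jet_radius (\<lambda>t. \<Gamma> (\<phi> t)) s = jet_radius (\<lambda>t. \<Gamma> (\<phi> t)) t \<longleftrightarrow> radius_gap \<rho> \<theta> = 0"
    "jet_log1 (\<lambda>t. \<Gamma> (\<phi> t)) s = jet_log1 (\<lambda>t. \<Gamma> (\<phi> t)) t \<longleftrightarrow> radius_wronskian \<rho> \<theta> = 0"
    "jet_log2 (\<lambda>t. \<Gamma> (\<phi> t)) s = jet_log2 (\<lambda>t. \<Gamma> (\<phi> t)) t \<longleftrightarrow>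
       vderiv (vderiv \<rho>) \<theta> * \<rho> (\<theta> + pi) = \<rho> \<theta> * vderiv (vderiv \<rho>) (\<theta> + pi)"
    "radius_gap \<rho> \<theta> = 0 \<Longrightarrow>
       jet_log1 (\<lambda>t. \<Gamma> (\<phi> t)) s = jet_log1 (\<lambda>t. \<Gamma> (\<phi> t)) t \<longleftrightarrow> vderiv \<rho> \<theta> = vderiv \<rho> (\<theta> + pi)"
    "jet (\<lambda>t. \<Gamma> (\<phi> t)) 0 s + jet (\<lambda>t. \<Gamma> (\<phi> t)) 0 t = 2 *\<^sub>R mid_chord \<Gamma> \<theta>"
    "contact_point (\<lambda>t. \<Gamma> (\<phi> t)) s t = chord_contact \<Gamma> \<rho> \<theta>"
proof -
  obtain k :: int where "\<phi> t = \<phi> s + pi + of_int k * (2 * pi)"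
    using antiparallel_angle_form(1)[OF af ac] assms(1) by blast
  then have t: "\<phi> t = \<theta> + pi + of_int (j + k) * (2 * pi)" using assms(2) by (simp add: algebra_simps)
  note per = angle_form_int[OF af] radius_int_periodic
  have s_eq: "\<Gamma> (\<phi> s) = \<Gamma> \<theta>" "\<rho> (\<phi> s) = \<rho> \<theta>" "vderiv \<rho> (\<phi> s) = vderiv \<rho> \<theta>"
    "vderiv (vderiv \<rho>) (\<phi> s) = vderiv (vderiv \<rho>) \<theta>" unfolding assms(2) per by simp_all
  have t_eq: "\<Gamma> (\<phi> t) = \<Gamma> (\<theta> + pi)" "\<rho> (\<phi> t) = \<rho> (\<theta> + pi)" "vderiv \<rho> (\<phi> t) = vderiv \<rho> (\<theta> + pi)"
    "vderiv (vderiv \<rho>) (\<phi> t) = vderiv (vderiv \<rho>) (\<theta> + pi)" unfolding t per by simp_all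
  have nz: "\<rho> x \<noteq> 0" for x using angle_formD(4)[OF af, of x] by simp
  note J = jets_of_angle_form(2-4)[OF af ac]
  show "jet_radius (\<lambda>t. \<Gamma> (\<phi> t)) s = jet_radius (\<lambda>t. \<Gamma> (\<phi> t)) t \<longleftrightarrow> radius_gap \<rho> \<theta> = 0"
    unfolding J s_eq t_eq by (simp add: radius_gap_def)
  show "jet_log1 (\<lambda>t. \<Gamma> (\<phi> t)) s = jet_log1 (\<lambda>t. \<Gamma> (\<phi> t)) t \<longleftrightarrow> radius_wronskian \<rho> \<theta> = 0"
    unfolding J s_eq t_eq radius_wronskian_def frac_eq_eq[OF nz nz] by (auto simp: mult.commute)
  show "jet_log2 (\<lambda>t. \<Gamma> (\<phi> t)) s = jet_log2 (\<lambda>t. \<Gamma> (\<phi> t)) t \<longleftrightarrow>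
       vderiv (vderiv \<rho>) \<theta> * \<rho> (\<theta> + pi) = \<rho> \<theta> * vderiv (vderiv \<rho>) (\<theta> + pi)"
    unfolding J s_eq t_eq frac_eq_eq[OF nz nz] by (auto simp: mult.commute)
  show "jet_log1 (\<lambda>t. \<Gamma> (\<phi> t)) s = jet_log1 (\<lambda>t. \<Gamma> (\<phi> t)) t \<longleftrightarrow> vderiv \<rho> \<theta> = vderiv \<rho> (\<theta> + pi)"
    if "radius_gap \<rho> \<theta> = 0"
    using that nz unfolding J s_eq t_eq by (simp add: radius_gap_def)
  show "jet (\<lambda>t. \<Gamma> (\<phi> t)) 0 s + jet (\<lambda>t. \<Gamma> (\<phi> t)) 0 t = 2 *\<^sub>R mid_chord \<Gamma> \<theta>"
    by (simp add: mid_chord_def s_eq t_eq)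
  show "contact_point (\<lambda>t. \<Gamma> (\<phi> t)) s t = chord_contact \<Gamma> \<rho> \<theta>"
    unfolding contact_point_def chord_contact_def radius_sum_def J by (simp add: s_eq t_eq)
qed

lemma antiparallel_param:
  obtains s t and k :: int where "s \<in> {0..1}" "t \<in> {0..1}" "antiparallel (\<lambda>t. \<Gamma> (\<phi> t)) s t"
    "\<phi> s = \<theta> + of_int k * (2 * pi)"
proof -
  obtain s and k :: int where s: "s \<in> {0..1}" "\<phi> s = \<theta> + of_int k * (2 * pi)" by (rule angle_change_param[OF ac])
  obtain t and j :: int where t: "t \<in> {0..1}" "\<phi> t = (\<phi> s + pi) + of_int j * (2 * pi)" by (rule angle_change_param[OF ac])
  then have "antiparallel (\<lambda>t. \<Gamma> (\<phi> t)) s t" unfolding antiparallel_angle_form(1)[OF af ac] by blast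
  then show ?thesis using that s t by blast
qed

lemma avoid_double_gap: "(\<forall>p\<in>parameter_cube. \<not> double_gap (\<lambda>t. \<Gamma> (\<phi> t)) p) \<longleftrightarrow> simple_gaps \<rho>"
proof
  assume avoid: "\<forall>p\<in>parameter_cube. \<not> double_gap (\<lambda>t. \<Gamma> (\<phi> t)) p"
  show "simple_gaps \<rho>"
    unfolding simple_gaps_def
  proof (intro allI impI notI)
    fix \<theta> assume z: "radius_gap \<rho> \<theta> = 0" "vderiv \<rho> \<theta> = vderiv \<rho> (\<theta> + pi)"
    obtain s t and k :: int where st: "s \<in> {0..1}" "t \<in> {0..1}" "antiparallel (\<lambda>t. \<Gamma> (\<phi> t)) s t"
      "\<phi> s = \<theta> + of_int k * (2 * pi)" by (rule antiparallel_param)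
    have "double_gap (\<lambda>t. \<Gamma> (\<phi> t)) (s, t, s, t)"
      using st(3) z antiparallel_dictionary(1,4)[OF st(3,4)] by (simp add: double_gap_def)
    then show False using avoid st(1,2) by (auto simp: parameter_cube_def)
  qed
next
  assume sg: "simple_gaps \<rho>"
  have "\<not> double_gap (\<lambda>t. \<Gamma> (\<phi> t)) (s, t, s', t')" for s t s' t'
  proof
    assume "double_gap (\<lambda>t. \<Gamma> (\<phi> t)) (s, t, s', t')"
    then have b: "antiparallel (\<lambda>t. \<Gamma> (\<phi> t)) s t" "jet_radius (\<lambda>t. \<Gamma> (\<phi> t)) s = jet_radius (\<lambda>t. \<Gamma> (\<phi> t)) t"
      "jet_log1 (\<lambda>t. \<Gamma> (\<phi> t)) s = jet_log1 (\<lambda>t. \<Gamma> (\<phi> t)) t" by (auto simp: double_gap_def)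
    have s: "\<phi> s = \<phi> s + of_int 0 * (2 * pi)" by simp
    show False
      using b sg antiparallel_dictionary(1,4)[OF b(1) s] unfolding simple_gaps_def by blast
  qed
  then show "\<forall>p\<in>parameter_cube. \<not> double_gap (\<lambda>t. \<Gamma> (\<phi> t)) p" by auto
qed

lemma avoid_double_wronskian: "(\<forall>p\<in>parameter_cube. \<not> double_wronskian (\<lambda>t. \<Gamma> (\<phi> t)) p) \<longleftrightarrow> simple_wronskian \<rho>"
proof
  assume avoid: "\<forall>p\<in>parameter_cube. \<not> double_wronskian (\<lambda>t. \<Gamma> (\<phi> t)) p"
  show "simple_wronskian \<rho>"
    unfolding simple_wronskian_def
  proof (intro allI impI notI)
    fix \<theta> assume z: "radius_wronskian \<rho> \<theta> = 0" "vderiv (vderiv \<rho>) \<theta> * \<rho> (\<theta> + pi) = \<rho> \<theta> * vderiv (vderiv \<rho>) (\<theta> + pi)"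
    obtain s t and k :: int where st: "s \<in> {0..1}" "t \<in> {0..1}" "antiparallel (\<lambda>t. \<Gamma> (\<phi> t)) s t"
      "\<phi> s = \<theta> + of_int k * (2 * pi)" by (rule antiparallel_param)
    have "double_wronskian (\<lambda>t. \<Gamma> (\<phi> t)) (s, t, s, t)"
      using st(3) z antiparallel_dictionary(2,3)[OF st(3,4)] by (simp add: double_wronskian_def)
    then show False using avoid st(1,2) by (auto simp: parameter_cube_def)
  qed
next
  assume sg: "simple_wronskian \<rho>"
  have "\<not> double_wronskian (\<lambda>t. \<Gamma> (\<phi> t)) (s, t, s', t')" for s t s' t'
  proof
    assume "double_wronskian (\<lambda>t. \<Gamma> (\<phi> t)) (s, t, s', t')"
    then have b: "antiparallel (\<lambda>t. \<Gamma> (\<phi> t)) s t" "jet_log1 (\<lambda>t. \<Gamma> (\<phi> t)) s = jet_log1 (\<lambda>t. \<Gamma> (\<phi> t)) t"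
      "jet_log2 (\<lambda>t. \<Gamma> (\<phi> t)) s = jet_log2 (\<lambda>t. \<Gamma> (\<phi> t)) t" by (auto simp: double_wronskian_def)
    have s: "\<phi> s = \<phi> s + of_int 0 * (2 * pi)" by simp
    show False
      using b sg antiparallel_dictionary(2,3)[OF b(1) s] unfolding simple_wronskian_def by blast
  qed
  then show "\<forall>p\<in>parameter_cube. \<not> double_wronskian (\<lambda>t. \<Gamma> (\<phi> t)) p" by auto
qed

lemma far_directions_iff:
  assumes "\<phi> s = x + of_int j * (2 * pi)" "\<phi> s' = y + of_int k * (2 * pi)"
  shows "far_directions n (\<lambda>t. \<Gamma> (\<phi> t)) (s, t, s', t') \<longleftrightarrow> 1 \<le> real (Suc n) * \<bar>sin (x - y)\<bar>"
proof -
  obtain c where c: "0 < c" "cross2 (jet (\<lambda>t. \<Gamma> (\<phi> t)) 1 s) (jet (\<lambda>t. \<Gamma> (\<phi> t)) 1 s') = c * sin (\<phi> s' - \<phi> s)"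
    "norm (jet (\<lambda>t. \<Gamma> (\<phi> t)) 1 s) * norm (jet (\<lambda>t. \<Gamma> (\<phi> t)) 1 s') = c"
    using antiparallel_angle_form(2)[OF af ac] by blast
  have "\<phi> s' - \<phi> s = - (x - y) + of_int (k - j) * (2 * pi)" using assms by (simp add: algebra_simps)
  then have "sin (\<phi> s' - \<phi> s) = sin (- (x - y))"
    using periodic_int_multiple[of sin "2 * pi", OF sin_periodic] by metis
  then have "\<bar>sin (\<phi> s' - \<phi> s)\<bar> = \<bar>sin (x - y)\<bar>" by (simp only: sin_minus abs_minus_cancel)
  then have "far_directions n (\<lambda>t. \<Gamma> (\<phi> t)) (s, t, s', t') \<longleftrightarrow> c \<le> c * (real (Suc n) * \<bar>sin (x - y)\<bar>)"
    unfolding far_directions_def prod.case c using c(1) by (simp add: abs_mult mult_ac)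
  then show ?thesis using c(1) by simp
qed

lemma large_multiple:
  assumes "(a :: real) \<noteq> 0"
  obtains n where "1 \<le> real (Suc n) * \<bar>a\<bar>"
proof -
  obtain n where "1 < real n * \<bar>a\<bar>" using reals_Archimedean3[of "\<bar>a\<bar>"] assms by auto
  then have "1 \<le> real (Suc n) * \<bar>a\<bar>" by (simp add: algebra_simps)
  then show ?thesis by (rule that)
qed

lemma avoid_caustic_coincidence:
  "(\<forall>n. \<forall>p\<in>parameter_cube. \<not> caustic_coincidence n (\<lambda>t. \<Gamma> (\<phi> t)) p) \<longleftrightarrow>
    separated_on_zeros (radius_gap \<rho>) (mid_chord \<Gamma>)"
proof
  assume avoid: "\<forall>n. \<forall>p\<in>parameter_cube. \<not> caustic_coincidence n (\<lambda>t. \<Gamma> (\<phi> t)) p"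
  show "separated_on_zeros (radius_gap \<rho>) (mid_chord \<Gamma>)"
    unfolding separated_on_zeros_def
  proof (intro allI impI, rule ccontr)
    fix x y assume z: "radius_gap \<rho> x = 0" "radius_gap \<rho> y = 0" "mid_chord \<Gamma> x = mid_chord \<Gamma> y" "sin (x - y) \<noteq> 0"
    obtain n where n: "1 \<le> real (Suc n) * \<bar>sin (x - y)\<bar>" by (rule large_multiple[OF z(4)])
    obtain s t and k :: int where st: "s \<in> {0..1}" "t \<in> {0..1}" "antiparallel (\<lambda>t. \<Gamma> (\<phi> t)) s t"
      "\<phi> s = x + of_int k * (2 * pi)" by (rule antiparallel_param)
    obtain s' t' and k' :: int where st': "s' \<in> {0..1}" "t' \<in> {0..1}" "antiparallel (\<lambda>t. \<Gamma> (\<phi> t)) s' t'"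
      "\<phi> s' = y + of_int k' * (2 * pi)" by (rule antiparallel_param)
    have "caustic_coincidence n (\<lambda>t. \<Gamma> (\<phi> t)) (s, t, s', t')"
      unfolding caustic_coincidence_def prod.case far_directions_iff[OF st(4) st'(4)]
        antiparallel_dictionary(1,5)[OF st(3,4)] antiparallel_dictionary(1,5)[OF st'(3,4)]
      using st st' z n by simp
    then show False using avoid st(1,2) st'(1,2) by (auto simp: parameter_cube_def)
  qed
next
  assume sep: "separated_on_zeros (radius_gap \<rho>) (mid_chord \<Gamma>)"
  have "\<not> caustic_coincidence n (\<lambda>t. \<Gamma> (\<phi> t)) (s, t, s', t')" for n s t s' t'
  proof
    assume "caustic_coincidence n (\<lambda>t. \<Gamma> (\<phi> t)) (s, t, s', t')"
    then have b: "antiparallel (\<lambda>t. \<Gamma> (\<phi> t)) s t" "antiparallel (\<lambda>t. \<Gamma> (\<phi> t)) s' t'"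
      "far_directions n (\<lambda>t. \<Gamma> (\<phi> t)) (s, t, s', t')"
      "jet_radius (\<lambda>t. \<Gamma> (\<phi> t)) s = jet_radius (\<lambda>t. \<Gamma> (\<phi> t)) t"
      "jet_radius (\<lambda>t. \<Gamma> (\<phi> t)) s' = jet_radius (\<lambda>t. \<Gamma> (\<phi> t)) t'"
      "jet (\<lambda>t. \<Gamma> (\<phi> t)) 0 s + jet (\<lambda>t. \<Gamma> (\<phi> t)) 0 t = jet (\<lambda>t. \<Gamma> (\<phi> t)) 0 s' + jet (\<lambda>t. \<Gamma> (\<phi> t)) 0 t'"
      unfolding caustic_coincidence_def by auto
    have e: "\<phi> s = \<phi> s + of_int 0 * (2 * pi)" "\<phi> s' = \<phi> s' + of_int 0 * (2 * pi)" by simp_all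
    have "mid_chord \<Gamma> (\<phi> s) = mid_chord \<Gamma> (\<phi> s')"
      using b(6) unfolding antiparallel_dictionary(5)[OF b(1) e(1)] antiparallel_dictionary(5)[OF b(2) e(2)] by simp
    then have "sin (\<phi> s - \<phi> s') = 0"
      using sep b(4,5) unfolding antiparallel_dictionary(1)[OF b(1) e(1)] antiparallel_dictionary(1)[OF b(2) e(2)]
        separated_on_zeros_def by blast
    then show False using b(3) far_directions_iff[OF e] by simp
  qed
  then show "\<forall>n. \<forall>p\<in>parameter_cube. \<not> caustic_coincidence n (\<lambda>t. \<Gamma> (\<phi> t)) p" by auto
qed

lemma avoid_contact_coincidence:
  "(\<forall>n. \<forall>p\<in>parameter_cube. \<not> contact_coincidence n (\<lambda>t. \<Gamma> (\<phi> t)) p) \<longleftrightarrow>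
    separated_on_zeros (radius_wronskian \<rho>) (chord_contact \<Gamma> \<rho>)"
proof
  assume avoid: "\<forall>n. \<forall>p\<in>parameter_cube. \<not> contact_coincidence n (\<lambda>t. \<Gamma> (\<phi> t)) p"
  show "separated_on_zeros (radius_wronskian \<rho>) (chord_contact \<Gamma> \<rho>)"
    unfolding separated_on_zeros_def
  proof (intro allI impI, rule ccontr)
    fix x y assume z: "radius_wronskian \<rho> x = 0" "radius_wronskian \<rho> y = 0"
      "chord_contact \<Gamma> \<rho> x = chord_contact \<Gamma> \<rho> y" "sin (x - y) \<noteq> 0"
    obtain n where n: "1 \<le> real (Suc n) * \<bar>sin (x - y)\<bar>" by (rule large_multiple[OF z(4)])
    obtain s t and k :: int where st: "s \<in> {0..1}" "t \<in> {0..1}" "antiparallel (\<lambda>t. \<Gamma> (\<phi> t)) s t"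
      "\<phi> s = x + of_int k * (2 * pi)" by (rule antiparallel_param)
    obtain s' t' and k' :: int where st': "s' \<in> {0..1}" "t' \<in> {0..1}" "antiparallel (\<lambda>t. \<Gamma> (\<phi> t)) s' t'"
      "\<phi> s' = y + of_int k' * (2 * pi)" by (rule antiparallel_param)
    have "contact_coincidence n (\<lambda>t. \<Gamma> (\<phi> t)) (s, t, s', t')"
      unfolding contact_coincidence_def prod.case far_directions_iff[OF st(4) st'(4)]
        antiparallel_dictionary(2,6)[OF st(3,4)] antiparallel_dictionary(2,6)[OF st'(3,4)]
      using st st' z n by simp
    then show False using avoid st(1,2) st'(1,2) by (auto simp: parameter_cube_def)
  qed
next
  assume sep: "separated_on_zeros (radius_wronskian \<rho>) (chord_contact \<Gamma> \<rho>)"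
  have "\<not> contact_coincidence n (\<lambda>t. \<Gamma> (\<phi> t)) (s, t, s', t')" for n s t s' t'
  proof
    assume "contact_coincidence n (\<lambda>t. \<Gamma> (\<phi> t)) (s, t, s', t')"
    then have b: "antiparallel (\<lambda>t. \<Gamma> (\<phi> t)) s t" "antiparallel (\<lambda>t. \<Gamma> (\<phi> t)) s' t'"
      "far_directions n (\<lambda>t. \<Gamma> (\<phi> t)) (s, t, s', t')"
      "jet_log1 (\<lambda>t. \<Gamma> (\<phi> t)) s = jet_log1 (\<lambda>t. \<Gamma> (\<phi> t)) t"
      "jet_log1 (\<lambda>t. \<Gamma> (\<phi> t)) s' = jet_log1 (\<lambda>t. \<Gamma> (\<phi> t)) t'"
      "contact_point (\<lambda>t. \<Gamma> (\<phi> t)) s t = contact_point (\<lambda>t. \<Gamma> (\<phi> t)) s' t'"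
      unfolding contact_coincidence_def by auto
    have e: "\<phi> s = \<phi> s + of_int 0 * (2 * pi)" "\<phi> s' = \<phi> s' + of_int 0 * (2 * pi)" by simp_all
    have "chord_contact \<Gamma> \<rho> (\<phi> s) = chord_contact \<Gamma> \<rho> (\<phi> s')"
      using b(6) unfolding antiparallel_dictionary(6)[OF b(1) e(1)] antiparallel_dictionary(6)[OF b(2) e(2)] .
    then have "sin (\<phi> s - \<phi> s') = 0"
      using sep b(4,5) unfolding antiparallel_dictionary(2)[OF b(1) e(1)] antiparallel_dictionary(2)[OF b(2) e(2)]
        separated_on_zeros_def by blast
    then show False using b(3) far_directions_iff[OF e] by simp
  qed
  then show "\<forall>n. \<forall>p\<in>parameter_cube. \<not> contact_coincidence n (\<lambda>t. \<Gamma> (\<phi> t)) p" by auto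
qed

end

section \<open>Density of the genericity conditions\<close>

text \<open>
  Perturbations that do not change the tangent angles; \<open>p\<close> is the change of the radius of curvature.
\<close>

definition displacement :: "(real \<Rightarrow> real^2) \<Rightarrow> (real \<Rightarrow> real) \<Rightarrow> bool" where
  "displacement W p \<longleftrightarrow> smooth W \<and> smooth p \<and> (\<forall>\<theta>. W (\<theta> + 2 * pi) = W \<theta>) \<and> (\<forall>\<theta>. p (\<theta> + 2 * pi) = p \<theta>) \<and>
     (\<forall>\<theta>. (W has_vector_derivative p \<theta> *\<^sub>R unit_dir \<theta>) (at \<theta>))"

lemma angle_form_perturbation:
  assumes af: "angle_form \<Gamma> \<rho>" and ac: "angle_change \<phi>" and "0 < e"
    and W: "displacement W p" "displacement W' p'"
  obtains d where "0 < d"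
    "\<And>x y. \<bar>x\<bar> < d \<Longrightarrow> \<bar>y\<bar> < d \<Longrightarrow> angle_form (\<lambda>\<theta>. \<Gamma> \<theta> + x *\<^sub>R W \<theta> + y *\<^sub>R W' \<theta>) (\<lambda>\<theta>. \<rho> \<theta> + x * p \<theta> + y * p' \<theta>)"
    "\<And>x y. \<bar>x\<bar> < d \<Longrightarrow> \<bar>y\<bar> < d \<Longrightarrow> (\<lambda>t. \<Gamma> (\<phi> t) + x *\<^sub>R W (\<phi> t) + y *\<^sub>R W' (\<phi> t)) \<in> Ck_ball (\<lambda>t. \<Gamma> (\<phi> t)) n e"
proof -
  note D = angle_formD[OF af]
  have w: "smooth W" "smooth p" "\<And>\<theta>. W (\<theta> + 2 * pi) = W \<theta>" "\<And>\<theta>. p (\<theta> + 2 * pi) = p \<theta>"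
    "\<And>\<theta>. (W has_vector_derivative p \<theta> *\<^sub>R unit_dir \<theta>) (at \<theta>)" using W(1) by (auto simp: displacement_def)
  have w': "smooth W'" "smooth p'" "\<And>\<theta>. W' (\<theta> + 2 * pi) = W' \<theta>" "\<And>\<theta>. p' (\<theta> + 2 * pi) = p' \<theta>"
    "\<And>\<theta>. (W' has_vector_derivative p' \<theta> *\<^sub>R unit_dir \<theta>) (at \<theta>)" using W(2) by (auto simp: displacement_def)
  have pi2: "0 < 2 * pi" using pi_gt_zero by simp
  obtain c where c: "0 < c" "\<And>\<theta>. c \<le> \<rho> \<theta>"
    using periodic_positive_lower_bound[OF pi2 D(6) smooth_continuous[OF D(2)] D(4)] by metis
  obtain B where B: "0 < B" "\<And>\<theta>. norm (p \<theta>) \<le> B"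
    using periodic_bounded[OF pi2 w(4) smooth_continuous[OF w(2)]] by metis
  obtain B' where B': "0 < B'" "\<And>\<theta>. norm (p' \<theta>) \<le> B'"
    using periodic_bounded[OF pi2 w'(4) smooth_continuous[OF w'(2)]] by metis
  obtain d where d: "0 < d" "\<And>x y. \<bar>x\<bar> < d \<Longrightarrow> \<bar>y\<bar> < d \<Longrightarrow>
      (\<lambda>t. \<Gamma> (\<phi> t) + x *\<^sub>R W (\<phi> t) + y *\<^sub>R W' (\<phi> t)) \<in> Ck_ball (\<lambda>t. \<Gamma> (\<phi> t)) n e"
  proof (rule Ck_ball_perturbation[OF smooth_loop_compose[OF D(1,3) ac] smooth_loop_compose[OF w(1,3) ac]
        smooth_loop_compose[OF w'(1,3) ac] \<open>0 < e\<close>, of n])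
    fix d assume "0 < d" "\<And>x y. \<bar>x\<bar> < d \<Longrightarrow> \<bar>y\<bar> < d \<Longrightarrow>
      (\<lambda>t. \<Gamma> (\<phi> t) + x *\<^sub>R W (\<phi> t) + y *\<^sub>R W' (\<phi> t)) \<in> Ck_ball (\<lambda>t. \<Gamma> (\<phi> t)) n e"
    then show thesis by (rule that)
  qed
  define d' where "d' = min d (c / (B + B'))"
  have "0 < d'" using d(1) c(1) B(1) B'(1) by (simp add: d'_def)
  moreover have "angle_form (\<lambda>\<theta>. \<Gamma> \<theta> + x *\<^sub>R W \<theta> + y *\<^sub>R W' \<theta>) (\<lambda>\<theta>. \<rho> \<theta> + x * p \<theta> + y * p' \<theta>)"
    if xy: "\<bar>x\<bar> < d'" "\<bar>y\<bar> < d'" for x y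
    unfolding angle_form_def
  proof (intro conjI allI)
    show "smooth (\<lambda>\<theta>. \<Gamma> \<theta> + x *\<^sub>R W \<theta> + y *\<^sub>R W' \<theta>)"
      by (intro smooth_vec_add smooth_vec_scaleR smooth_const D w w')
    show "smooth (\<lambda>\<theta>. \<rho> \<theta> + x * p \<theta> + y * p' \<theta>)"
      by (intro smooth_add smooth_mult smooth_const D w w')
    fix \<theta>
    show "\<Gamma> (\<theta> + 2 * pi) + x *\<^sub>R W (\<theta> + 2 * pi) + y *\<^sub>R W' (\<theta> + 2 * pi) = \<Gamma> \<theta> + x *\<^sub>R W \<theta> + y *\<^sub>R W' \<theta>"
      by (simp only: D w w')
    have "d' \<le> c / (B + B')" by (simp add: d'_def)
    then have lt: "d' * (B + B') \<le> c" using B(1) B'(1) by (simp add: pos_le_divide_eq)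
    have "\<bar>x * p \<theta>\<bar> \<le> \<bar>x\<bar> * B" using B(2)[of \<theta>] by (simp add: abs_mult mult_left_mono)
    moreover have "\<bar>y * p' \<theta>\<bar> \<le> \<bar>y\<bar> * B'" using B'(2)[of \<theta>] by (simp add: abs_mult mult_left_mono)
    moreover have "\<bar>x\<bar> * B < d' * B" "\<bar>y\<bar> * B' < d' * B'" using xy B(1) B'(1) by simp_all
    ultimately have "\<bar>x * p \<theta>\<bar> + \<bar>y * p' \<theta>\<bar> < c" using lt by (simp add: algebra_simps)
    then show "0 < \<rho> \<theta> + x * p \<theta> + y * p' \<theta>" using c(2)[of \<theta>] by linarith
    have "((\<lambda>\<theta>. \<Gamma> \<theta> + x *\<^sub>R W \<theta> + y *\<^sub>R W' \<theta>) has_vector_derivative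
        \<rho> \<theta> *\<^sub>R unit_dir \<theta> + x *\<^sub>R (p \<theta> *\<^sub>R unit_dir \<theta>) + y *\<^sub>R (p' \<theta> *\<^sub>R unit_dir \<theta>)) (at \<theta>)"
      by (intro has_vector_derivative_add bounded_linear.has_vector_derivative[OF bounded_linear_scaleR_right] D w w')
    then show "((\<lambda>\<theta>. \<Gamma> \<theta> + x *\<^sub>R W \<theta> + y *\<^sub>R W' \<theta>) has_vector_derivative
        (\<rho> \<theta> + x * p \<theta> + y * p' \<theta>) *\<^sub>R unit_dir \<theta>) (at \<theta>)"
      by (simp add: scaleR_add_left)
  qed
  moreover have "(\<lambda>t. \<Gamma> (\<phi> t) + x *\<^sub>R W (\<phi> t) + y *\<^sub>R W' (\<phi> t)) \<in> Ck_ball (\<lambda>t. \<Gamma> (\<phi> t)) n e"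
    if "\<bar>x\<bar> < d'" "\<bar>y\<bar> < d'" for x y using d(2) that by (simp add: d'_def)
  ultimately show ?thesis by (rule that)
qed

text \<open>
  A differentiable curve is a null set in the plane.
\<close>

lemma parameters_off_curve:
  fixes g :: "real \<Rightarrow> real \<times> real"
  assumes "g differentiable_on T" "0 < d"
  obtains x y where "\<bar>x\<bar> < d" "\<bar>y\<bar> < d" "(x, y) \<notin> g ` T"
proof -
  have neg: "negligible (g ` T)"
    by (rule negligible_differentiable_image_lowdim[OF _ assms(1)]) simp
  have "open ({-d<..<d} \<times> {-d<..<d})" by (intro open_Times open_greaterThanLessThan)
  moreover have "(0, 0) \<in> {-d<..<d} \<times> {-d<..<d}" using assms(2) by simp
  ultimately have "\<not> negligible ({-d<..<d} \<times> {-d<..<d})" using open_not_negligible by blast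
  then have "\<not> {-d<..<d} \<times> {-d<..<d} \<subseteq> g ` T" using neg negligible_subset by blast
  then obtain z where z: "z \<in> {-d<..<d} \<times> {-d<..<d}" "z \<notin> g ` T" by blast
  have "\<bar>fst z\<bar> < d" "\<bar>snd z\<bar> < d" using z(1) by auto
  moreover have "(fst z, snd z) \<notin> g ` T" using z(2) by simp
  ultimately show ?thesis by (rule that)
qed

text \<open>
  The vector field \<open>p e\<close> changes its sign over half a turn, so its antiderivative is periodic.
\<close>

lemma displacement_of_pi_periodic:
  assumes "smooth p" "\<And>\<theta>. p (\<theta> + pi) = p \<theta>"
  obtains W where "displacement W p"
proof -
  obtain a where a: "\<And>\<theta>. (a has_real_derivative p \<theta> * cos \<theta>) (at \<theta>)"
    using antiderivative_exists[OF smooth_continuous[OF smooth_mult[OF assms(1) smooth_cos[OF smooth_ident]]]] by blast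
  obtain b where b: "\<And>\<theta>. (b has_real_derivative p \<theta> * sin \<theta>) (at \<theta>)"
    using antiderivative_exists[OF smooth_continuous[OF smooth_mult[OF assms(1) smooth_sin[OF smooth_ident]]]] by blast
  have per: "f (\<theta> + 2 * pi) = f \<theta>" if f: "\<And>\<theta>. (f has_real_derivative p \<theta> * h \<theta>) (at \<theta>)" and h: "\<And>\<theta>. h (\<theta> + pi) = - h \<theta>"
    for f h :: "real \<Rightarrow> real" and \<theta>
  proof -
    have "((\<lambda>x. f (x + pi) + f x) has_real_derivative p (x + pi) * h (x + pi) + p x * h x) (at x)" for x
      by (intro DERIV_add f) (use f[of "x + pi"] in \<open>simp add: DERIV_shift\<close>)
    then have "((\<lambda>x. f (x + pi) + f x) has_real_derivative 0) (at x)" for x by (simp add: assms(2) h)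
    then have "f (\<theta> + pi + pi) + f (\<theta> + pi) = f (\<theta> + pi) + f \<theta>"
      using DERIV_isconst_all[of "\<lambda>x. f (x + pi) + f x" "\<theta> + pi" \<theta>] by blast
    then show ?thesis by (simp add: algebra_simps)
  qed
  define W :: "real \<Rightarrow> real^2" where "W \<theta> = vector [a \<theta>, b \<theta>]" for \<theta>
  have "smooth a" by (rule smooth_antideriv[OF _ a]) (intro smooth_mult assms(1) smooth_cos smooth_ident)
  moreover have "smooth b" by (rule smooth_antideriv[OF _ b]) (intro smooth_mult assms(1) smooth_sin smooth_ident)
  ultimately have "smooth W" by (simp add: smooth_vec2[of W] W_def)
  moreover have "W (\<theta> + 2 * pi) = W \<theta>" for \<theta>
    using per[OF a] per[OF b] by (simp add: W_def)
  moreover have "p (\<theta> + 2 * pi) = p \<theta>" for \<theta>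
    using assms(2)[of \<theta>] assms(2)[of "\<theta> + pi"] by (simp add: add.assoc)
  moreover have "(W has_vector_derivative p \<theta> *\<^sub>R unit_dir \<theta>) (at \<theta>)" for \<theta>
    using a b by (simp add: has_real_derivative_vec2 W_def)
  ultimately have "displacement W p" using assms(1) by (simp add: displacement_def)
  then show ?thesis by (rule that)
qed

text \<open>
  The first harmonics are excluded as changes of the radius of curvature, because the curve would not
  close up; among the antiperiodic functions the third harmonics come next.
\<close>

lemma third_harmonic_displacements:
  obtains W W' where "displacement W (\<lambda>\<theta>. cos (3 * \<theta>))" "displacement W' (\<lambda>\<theta>. sin (3 * \<theta>))"
proof -
  define W :: "real \<Rightarrow> real^2" where "W \<theta> = vector [sin (4 * \<theta>) / 8 + sin (2 * \<theta>) / 4, cos (2 * \<theta>) / 4 - cos (4 * \<theta>) / 8]" for \<theta>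
  define W' :: "real \<Rightarrow> real^2" where "W' \<theta> = vector [- (cos (4 * \<theta>) / 8) - cos (2 * \<theta>) / 4, sin (2 * \<theta>) / 4 - sin (4 * \<theta>) / 8]" for \<theta>
  have sm: "smooth (\<lambda>\<theta>. sin (c * \<theta>))" "smooth (\<lambda>\<theta>. cos (c * \<theta>))" for c :: real
    by (intro smooth_sin smooth_cos smooth_mult smooth_const smooth_ident)+
  have "4 * \<theta> = 3 * \<theta> + \<theta>" "2 * \<theta> = 3 * \<theta> - \<theta>" for \<theta> :: real by simp_all
  then have tr: "cos (4 * \<theta>) / 2 + cos (2 * \<theta>) / 2 = cos (3 * \<theta>) * cos \<theta>" "sin (4 * \<theta>) / 2 - sin (2 * \<theta>) / 2 = cos (3 * \<theta>) * sin \<theta>"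
    "sin (4 * \<theta>) / 2 + sin (2 * \<theta>) / 2 = sin (3 * \<theta>) * cos \<theta>" "cos (2 * \<theta>) / 2 - cos (4 * \<theta>) / 2 = sin (3 * \<theta>) * sin \<theta>" for \<theta> :: real
    by (simp_all only: cos_add cos_diff sin_add sin_diff) (simp_all add: field_simps)
  have per: "sin (of_nat k * (\<theta> + 2 * pi)) = sin (of_nat k * \<theta>)" "cos (of_nat k * (\<theta> + 2 * pi)) = cos (of_nat k * \<theta>)" for k \<theta>
    using periodic_int_multiple[of sin "2 * pi" "of_nat k * \<theta>" "int k", OF sin_periodic]
      periodic_int_multiple[of cos "2 * pi" "of_nat k * \<theta>" "int k", OF cos_periodic]
    by (simp_all add: algebra_simps)
  have per': "sin (2 * (\<theta> + 2 * pi)) = sin (2 * \<theta>)" "cos (2 * (\<theta> + 2 * pi)) = cos (2 * \<theta>)"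
    "sin (3 * (\<theta> + 2 * pi)) = sin (3 * \<theta>)" "cos (3 * (\<theta> + 2 * pi)) = cos (3 * \<theta>)"
    "sin (4 * (\<theta> + 2 * pi)) = sin (4 * \<theta>)" "cos (4 * (\<theta> + 2 * pi)) = cos (4 * \<theta>)" for \<theta>
    using per[of 2 \<theta>] per[of 3 \<theta>] per[of 4 \<theta>] by (simp_all only: of_nat_numeral)
  have "displacement W (\<lambda>\<theta>. cos (3 * \<theta>))"
    unfolding displacement_def
  proof (intro conjI allI)
    show "smooth W" unfolding smooth_vec2[of W] by (simp add: W_def smooth_intros sm)
    show "W (\<theta> + 2 * pi) = W \<theta>" for \<theta> unfolding W_def per' ..
    show "cos (3 * (\<theta> + 2 * pi)) = cos (3 * \<theta>)" for \<theta> unfolding per' ..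
    show "(W has_vector_derivative cos (3 * \<theta>) *\<^sub>R unit_dir \<theta>) (at \<theta>)" for \<theta>
      unfolding has_real_derivative_vec2 W_def[abs_def] using tr[of \<theta>]
      by (auto intro!: derivative_eq_intros)
  qed (rule sm)
  moreover have "displacement W' (\<lambda>\<theta>. sin (3 * \<theta>))"
    unfolding displacement_def
  proof (intro conjI allI)
    show "smooth W'" unfolding smooth_vec2[of W'] by (simp add: W'_def smooth_intros sm)
    show "W' (\<theta> + 2 * pi) = W' \<theta>" for \<theta> unfolding W'_def per' ..
    show "sin (3 * (\<theta> + 2 * pi)) = sin (3 * \<theta>)" for \<theta> unfolding per' ..
    show "(W' has_vector_derivative sin (3 * \<theta>) *\<^sub>R unit_dir \<theta>) (at \<theta>)" for \<theta>
      unfolding has_real_derivative_vec2 W'_def[abs_def] using tr[of \<theta>]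
      by (auto intro!: derivative_eq_intros)
  qed (rule sm)
  ultimately show ?thesis by (rule that)
qed

lemma smooth_differentiable_on:
  fixes f :: "real \<Rightarrow> real"
  shows "smooth f \<Longrightarrow> f differentiable_on T"
  using smooth_has_real_derivative real_differentiable_def differentiable_at_imp_differentiable_on
  by (metis)

lemma differentiable_on_Pair:
  fixes f g :: "real \<Rightarrow> real"
  assumes "f differentiable_on T" "g differentiable_on T"
  shows "(\<lambda>x. (f x, g x)) differentiable_on T"
  using assms unfolding differentiable_on_def differentiable_def
  by (blast intro: has_derivative_Pair)

lemma differentiable_on_quotient:
  fixes f g :: "real \<Rightarrow> real"
  assumes "f differentiable_on T" "g differentiable_on T" "\<And>x. x \<in> T \<Longrightarrow> g x \<noteq> 0"
  shows "(\<lambda>x. f x / g x) differentiable_on T"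
  using assms unfolding differentiable_on_def by (auto intro!: differentiable_divide)

text \<open>
  Adding \<open>x * cos (3 * \<theta>) + y * sin (3 * \<theta>)\<close> to the radius of curvature, the gap gets a double zero at a
  given angle for exactly one pair \<open>(x, y)\<close>; these pairs form a smooth curve.
\<close>

lemma simple_gaps_dense:
  assumes af: "angle_form \<Gamma> \<rho>" and ac: "angle_change \<phi>" and "0 < e"
  obtains \<Gamma>' \<rho>' where "angle_form \<Gamma>' \<rho>'" "simple_gaps \<rho>'" "(\<lambda>t. \<Gamma>' (\<phi> t)) \<in> Ck_ball (\<lambda>t. \<Gamma> (\<phi> t)) n e"
proof -
  let ?c = "\<lambda>\<theta>. cos (3 * \<theta>)" and ?s = "\<lambda>\<theta>. sin (3 * \<theta>)"
  obtain W W' where W: "displacement W ?c" "displacement W' ?s" by (rule third_harmonic_displacements)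
  obtain d where d: "0 < d"
    "\<And>x y. \<bar>x\<bar> < d \<Longrightarrow> \<bar>y\<bar> < d \<Longrightarrow> angle_form (\<lambda>\<theta>. \<Gamma> \<theta> + x *\<^sub>R W \<theta> + y *\<^sub>R W' \<theta>) (\<lambda>\<theta>. \<rho> \<theta> + x * ?c \<theta> + y * ?s \<theta>)"
    "\<And>x y. \<bar>x\<bar> < d \<Longrightarrow> \<bar>y\<bar> < d \<Longrightarrow> (\<lambda>t. \<Gamma> (\<phi> t) + x *\<^sub>R W (\<phi> t) + y *\<^sub>R W' (\<phi> t)) \<in> Ck_ball (\<lambda>t. \<Gamma> (\<phi> t)) n e"
    by (rule angle_form_perturbation[OF af ac \<open>0 < e\<close> W, of n]) blast
  let ?a = "radius_gap \<rho>" and ?a' = "\<lambda>\<theta>. vderiv \<rho> \<theta> - vderiv \<rho> (\<theta> + pi)"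
  define g where "g \<theta> = (- (?a \<theta> / 2) * ?c \<theta> + (?a' \<theta> / 6) * ?s \<theta>, - (?a \<theta> / 2) * ?s \<theta> - (?a' \<theta> / 6) * ?c \<theta>)" for \<theta>
  have sr: "smooth \<rho>" "smooth (vderiv \<rho>)" using angle_formD(2)[OF af] smooth_vderiv by blast+
  have sm: "smooth ?c" "smooth ?s" "smooth ?a" "smooth ?a'"
    by (intro smooth_sin smooth_cos smooth_mult smooth_const smooth_ident smooth_diff
        smooth_radius(1)[OF af] sr smooth_shift[OF sr(2)])+
  have diff: "g differentiable_on UNIV"
    unfolding g_def[abs_def]
    by (intro differentiable_on_Pair smooth_differentiable_on smooth_add smooth_diff smooth_minus smooth_mult
        smooth_divide smooth_const sm) simp_all
  obtain x y where xy: "\<bar>x\<bar> < d" "\<bar>y\<bar> < d" "(x, y) \<notin> g ` UNIV"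
    by (rule parameters_off_curve[OF diff d(1)])
  define \<rho>' where "\<rho>' \<theta> = \<rho> \<theta> + x * ?c \<theta> + y * ?s \<theta>" for \<theta>
  have v': "vderiv \<rho>' = (\<lambda>\<theta>. vderiv \<rho> \<theta> - 3 * x * ?s \<theta> + 3 * y * ?c \<theta>)"
    unfolding \<rho>'_def[abs_def]
    by (rule vderiv_real_eqI) (auto intro!: derivative_eq_intros smooth_has_real_derivative sr)
  have anti: "cos (3 * (\<theta> + pi)) = - ?c \<theta>" "sin (3 * (\<theta> + pi)) = - ?s \<theta>" for \<theta>
  proof -
    have "3 * (\<theta> + pi) = (3 * \<theta> + pi) + of_int 1 * (2 * pi)" by (simp add: algebra_simps)
    then show "cos (3 * (\<theta> + pi)) = - ?c \<theta>" "sin (3 * (\<theta> + pi)) = - ?s \<theta>"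
      using periodic_int_multiple[of cos "2 * pi" "3 * \<theta> + pi" 1, OF cos_periodic]
        periodic_int_multiple[of sin "2 * pi" "3 * \<theta> + pi" 1, OF sin_periodic]
      by (simp_all add: algebra_simps)
  qed
  have "simple_gaps \<rho>'"
    unfolding simple_gaps_def
  proof (intro allI impI notI)
    fix \<theta> assume "radius_gap \<rho>' \<theta> = 0" "vderiv \<rho>' \<theta> = vderiv \<rho>' (\<theta> + pi)"
    then have 1: "x * ?c \<theta> + y * ?s \<theta> = - (?a \<theta> / 2)" "y * ?c \<theta> - x * ?s \<theta> = - (?a' \<theta> / 6)"
      unfolding v' radius_gap_def \<rho>'_def anti by (simp_all add: field_simps)
    have sc: "?s \<theta> * ?s \<theta> + ?c \<theta> * ?c \<theta> = 1" using sin_cos_squared_add[of "3 * \<theta>"] by (simp add: power2_eq_square)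
    have "x = (x * ?c \<theta> + y * ?s \<theta>) * ?c \<theta> - (y * ?c \<theta> - x * ?s \<theta>) * ?s \<theta>"
      "y = (x * ?c \<theta> + y * ?s \<theta>) * ?s \<theta> + (y * ?c \<theta> - x * ?s \<theta>) * ?c \<theta>"
      using sc by algebra+
    then have "(x, y) = g \<theta>" unfolding 1 g_def by simp
    then show False using xy(3) by blast
  qed
  then show ?thesis
    using that[of "\<lambda>\<theta>. \<Gamma> \<theta> + x *\<^sub>R W \<theta> + y *\<^sub>R W' \<theta>" \<rho>'] d(2,3)[OF xy(1,2)] unfolding \<rho>'_def[abs_def] by blast
qed

text \<open>
  Adding to \<open>\<rho>\<close> a multiple of its gap by an antiperiodic function keeps the gap and changes the
  quotient of sum and gap by twice that function. Its critical points become nondegenerate for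
  almost all linear combinations of \<open>cos\<close> and \<open>sin\<close>; where the gap vanishes,
  the Wronskian does not, because the zeros of the gap are simple.
\<close>

lemma simple_wronskian_dense:
  assumes af: "angle_form \<Gamma> \<rho>" and ac: "angle_change \<phi>" and "0 < e" and gaps: "simple_gaps \<rho>"
  obtains \<Gamma>' \<rho>' where "angle_form \<Gamma>' \<rho>'" "simple_wronskian \<rho>'" "(\<lambda>t. \<Gamma>' (\<phi> t)) \<in> Ck_ball (\<lambda>t. \<Gamma> (\<phi> t)) n e"
proof -
  let ?a = "radius_gap \<rho>" and ?a' = "\<lambda>\<theta>. vderiv \<rho> \<theta> - vderiv \<rho> (\<theta> + pi)"
  let ?w = "radius_wronskian \<rho>" and ?w' = "\<lambda>\<theta>. vderiv (vderiv \<rho>) \<theta> * \<rho> (\<theta> + pi) - \<rho> \<theta> * vderiv (vderiv \<rho>) (\<theta> + pi)"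
  let ?p = "\<lambda>\<theta>. ?a \<theta> * cos \<theta>" and ?q = "\<lambda>\<theta>. ?a \<theta> * sin \<theta>"
  have sr: "smooth \<rho>" "smooth (vderiv \<rho>)" "smooth (vderiv (vderiv \<rho>))" using angle_formD(2)[OF af] smooth_vderiv by blast+
  have sm: "smooth ?a" "smooth ?a'" "smooth ?w" "smooth ?w'" "smooth (\<lambda>\<theta>::real. cos \<theta>)" "smooth (\<lambda>\<theta>::real. sin \<theta>)"
    by (intro smooth_sin smooth_cos smooth_mult smooth_const smooth_ident smooth_diff
        smooth_radius[OF af] sr smooth_shift[OF sr(1)] smooth_shift[OF sr(2)] smooth_shift[OF sr(3)])+
  have spq: "smooth ?p" "smooth ?q" by (intro smooth_mult sm)+
  obtain W where W: "displacement W ?p"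
    using displacement_of_pi_periodic[OF spq(1)] radius_antiperiodic(1)[OF af] by auto
  obtain W' where W': "displacement W' ?q"
    using displacement_of_pi_periodic[OF spq(2)] radius_antiperiodic(1)[OF af] by auto
  obtain d where d: "0 < d"
    "\<And>x y. \<bar>x\<bar> < d \<Longrightarrow> \<bar>y\<bar> < d \<Longrightarrow> angle_form (\<lambda>\<theta>. \<Gamma> \<theta> + x *\<^sub>R W \<theta> + y *\<^sub>R W' \<theta>) (\<lambda>\<theta>. \<rho> \<theta> + x * ?p \<theta> + y * ?q \<theta>)"
    "\<And>x y. \<bar>x\<bar> < d \<Longrightarrow> \<bar>y\<bar> < d \<Longrightarrow> (\<lambda>t. \<Gamma> (\<phi> t) + x *\<^sub>R W (\<phi> t) + y *\<^sub>R W' (\<phi> t)) \<in> Ck_ball (\<lambda>t. \<Gamma> (\<phi> t)) n e"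
    by (rule angle_form_perturbation[OF af ac \<open>0 < e\<close> W W', of n]) blast
  define X where "X \<theta> = ?w \<theta> / (?a \<theta>)\<^sup>2" for \<theta>
  define Y where "Y \<theta> = (2 * ?a \<theta> * ?a' \<theta> * X \<theta> - ?w' \<theta>) / (?a \<theta>)\<^sup>2" for \<theta>
  define g where "g \<theta> = (Y \<theta> * cos \<theta> - X \<theta> * sin \<theta>, Y \<theta> * sin \<theta> + X \<theta> * cos \<theta>)" for \<theta>
  have diff: "g differentiable_on {\<theta>. ?a \<theta> \<noteq> 0}" (is "_ differentiable_on ?T")
  proof -
    note so = smooth_differentiable_on[where T = ?T]
    have a2: "(\<lambda>\<theta>. (?a \<theta>)\<^sup>2) differentiable_on ?T" by (intro so smooth_power sm)
    have X: "X differentiable_on ?T"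
      unfolding X_def[abs_def] by (rule differentiable_on_quotient[OF so[OF sm(3)] a2]) simp
    have "(\<lambda>\<theta>. 2 * ?a \<theta> * ?a' \<theta>) differentiable_on ?T" by (intro so smooth_mult smooth_const sm)
    then have "(\<lambda>\<theta>. 2 * ?a \<theta> * ?a' \<theta> * X \<theta> - ?w' \<theta>) differentiable_on ?T"
      by (rule differentiable_on_diff[OF differentiable_on_mult[OF _ X] so[OF sm(4)]])
    then have Y: "Y differentiable_on ?T"
      unfolding Y_def[abs_def] by (rule differentiable_on_quotient[OF _ a2]) simp
    show ?thesis
      unfolding g_def[abs_def]
      by (intro differentiable_on_Pair differentiable_on_add differentiable_on_diff
          differentiable_on_mult X Y so[OF sm(5)] so[OF sm(6)])
  qed
  obtain x y where xy: "\<bar>x\<bar> < d" "\<bar>y\<bar> < d" "(x, y) \<notin> g ` {\<theta>. ?a \<theta> \<noteq> 0}"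
    by (rule parameters_off_curve[OF diff d(1)])
  define \<rho>' where "\<rho>' \<theta> = \<rho> \<theta> + x * ?p \<theta> + y * ?q \<theta>" for \<theta>
  note af' = d(2)[OF xy(1,2), folded \<rho>'_def]
  let ?u = "\<lambda>\<theta>. x * cos \<theta> + y * sin \<theta>" and ?u' = "\<lambda>\<theta>. y * cos \<theta> - x * sin \<theta>"
  have rho': "\<rho>' \<theta> = \<rho> \<theta> + ?a \<theta> * ?u \<theta>" "\<rho>' (\<theta> + pi) = \<rho> (\<theta> + pi) + ?a \<theta> * ?u \<theta>" for \<theta>
    unfolding \<rho>'_def radius_antiperiodic(1)[OF af] by (simp_all add: algebra_simps)
  have v': "vderiv \<rho>' = (\<lambda>\<theta>. vderiv \<rho> \<theta> + ?a' \<theta> * ?u \<theta> + ?a \<theta> * ?u' \<theta>)"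
  proof (rule vderiv_real_eqI)
    fix \<theta>
    have u: "(?u has_real_derivative ?u' \<theta>) (at \<theta>)" by (auto intro!: derivative_eq_intros)
    have "((\<lambda>\<theta>. \<rho> \<theta> + ?a \<theta> * ?u \<theta>) has_real_derivative vderiv \<rho> \<theta> + (?a' \<theta> * ?u \<theta> + ?u' \<theta> * ?a \<theta>)) (at \<theta>)"
      by (intro DERIV_add DERIV_mult smooth_has_real_derivative sr radius_derivs(1)[OF af] u)
    then show "(\<rho>' has_real_derivative vderiv \<rho> \<theta> + ?a' \<theta> * ?u \<theta> + ?a \<theta> * ?u' \<theta>) (at \<theta>)"
      unfolding ext[of \<rho>', OF rho'(1)] by (rule DERIV_cong) (simp add: algebra_simps)
  qed
  have wr: "radius_wronskian \<rho>' \<theta> = ?w \<theta> - (?a \<theta>)\<^sup>2 * ?u' \<theta>" for \<theta>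
  proof -
    have "?a' (\<theta> + pi) = - ?a' \<theta>" using angle_form_shift_pi(5)[OF af, of \<theta>] by simp
    then have vpi: "vderiv \<rho>' (\<theta> + pi) = vderiv \<rho> (\<theta> + pi) + ?a' \<theta> * ?u \<theta> + ?a \<theta> * ?u' \<theta>"
      unfolding v' radius_antiperiodic(1)[OF af] by (simp add: algebra_simps)
    have "radius_wronskian \<rho>' \<theta> = (vderiv \<rho> \<theta> + ?a' \<theta> * ?u \<theta> + ?a \<theta> * ?u' \<theta>) * (\<rho> (\<theta> + pi) + ?a \<theta> * ?u \<theta>)
        - (\<rho> \<theta> + ?a \<theta> * ?u \<theta>) * (vderiv \<rho> (\<theta> + pi) + ?a' \<theta> * ?u \<theta> + ?a \<theta> * ?u' \<theta>)"
      unfolding radius_wronskian_def vpi rho'(1)[of \<theta>] rho'(2)[of \<theta>] fun_cong[OF v', of \<theta>] ..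
    also have "\<dots> = ?w \<theta> - (?a \<theta>)\<^sup>2 * ?u' \<theta>"
      unfolding radius_wronskian_def radius_gap_def by algebra
    finally show ?thesis .
  qed
  have "simple_wronskian \<rho>'"
    unfolding simple_wronskian_def
  proof (intro allI impI notI)
    fix \<theta> assume z: "radius_wronskian \<rho>' \<theta> = 0" "vderiv (vderiv \<rho>') \<theta> * \<rho>' (\<theta> + pi) = \<rho>' \<theta> * vderiv (vderiv \<rho>') (\<theta> + pi)"
    have u': "(?u' has_real_derivative - ?u \<theta>) (at \<theta>)" by (auto intro!: derivative_eq_intros)
    have "((\<lambda>\<theta>. ?w \<theta> - (?a \<theta>)\<^sup>2 * ?u' \<theta>) has_real_derivative
        ?w' \<theta> - (real 2 * (?a' \<theta> * ?a \<theta> ^ (2 - Suc 0)) * ?u' \<theta> + - ?u \<theta> * (?a \<theta>)\<^sup>2)) (at \<theta>)"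
      by (intro DERIV_diff DERIV_mult DERIV_power radius_derivs[OF af] u')
    then have "vderiv (vderiv \<rho>') \<theta> * \<rho>' (\<theta> + pi) - \<rho>' \<theta> * vderiv (vderiv \<rho>') (\<theta> + pi)
        = ?w' \<theta> - (real 2 * (?a' \<theta> * ?a \<theta> ^ (2 - Suc 0)) * ?u' \<theta> + - ?u \<theta> * (?a \<theta>)\<^sup>2)"
      using radius_derivs(3)[OF af', of \<theta>] DERIV_unique unfolding ext[of "radius_wronskian \<rho>'", OF wr] by blast
    then have 2: "?w' \<theta> - 2 * ?a \<theta> * ?a' \<theta> * ?u' \<theta> + (?a \<theta>)\<^sup>2 * ?u \<theta> = 0" using z(2) by (simp add: algebra_simps)
    have 1: "?w \<theta> = (?a \<theta>)\<^sup>2 * ?u' \<theta>" using z(1) wr by simp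
    show False
    proof (cases "?a \<theta> = 0")
      case True
      then have "\<rho> \<theta> * (vderiv \<rho> \<theta> - vderiv \<rho> (\<theta> + pi)) = 0"
        using 1 by (simp add: radius_wronskian_def radius_gap_def algebra_simps)
      then show False using angle_formD(4)[OF af, of \<theta>] gaps True by (simp add: simple_gaps_def)
    next
      case False
      then have X: "X \<theta> = ?u' \<theta>" using 1 by (simp add: X_def)
      have "(?a \<theta>)\<^sup>2 * ?u \<theta> = 2 * ?a \<theta> * ?a' \<theta> * X \<theta> - ?w' \<theta>" using 2 unfolding X by linarith
      then have Y: "Y \<theta> = ?u \<theta>" using False unfolding Y_def by (metis nonzero_mult_div_cancel_left power_not_zero)
      have sc: "sin \<theta> * sin \<theta> + cos \<theta> * cos \<theta> = 1" using sin_cos_squared_add[of \<theta>] by (simp add: power2_eq_square)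
      have "x = ?u \<theta> * cos \<theta> - ?u' \<theta> * sin \<theta>" "y = ?u \<theta> * sin \<theta> + ?u' \<theta> * cos \<theta>"
        using sc by algebra+
      then have "(x, y) = g \<theta>" unfolding g_def X Y by simp
      then show False using xy(3) False by blast
    qed
  qed
  then show ?thesis
    using that[OF af'] d(3)[OF xy(1,2)] by blast
qed

text \<open>
  Every pair of points of \<open>Z\<close> with different translations excludes at most one \<open>\<epsilon>\<close>.
\<close>

lemma avoid_countably_many_coincidences:
  fixes P V :: "real \<Rightarrow> real^2"
  assumes "countable Z" "0 < (d :: real)"
  obtains \<epsilon> where "0 < \<epsilon>" "\<epsilon> < d"
    "\<And>x y. x \<in> Z \<Longrightarrow> y \<in> Z \<Longrightarrow> P x + \<epsilon> *\<^sub>R V x = P y + \<epsilon> *\<^sub>R V y \<Longrightarrow> V x = V y"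
proof -
  define E where "E = (\<lambda>(x, y). ((P y - P x) \<bullet> (V x - V y)) / ((V x - V y) \<bullet> (V x - V y)))"
  have "countable (E ` (Z \<times> Z))" using assms(1) by simp
  moreover have "uncountable {0<..<d}" using assms(2) uncountable_open_interval by blast
  ultimately have "\<not> {0<..<d} \<subseteq> E ` (Z \<times> Z)" using countable_subset by blast
  then obtain \<epsilon> where e: "\<epsilon> \<in> {0<..<d}" "\<epsilon> \<notin> E ` (Z \<times> Z)" by blast
  have "V x = V y" if xy: "x \<in> Z" "y \<in> Z" "P x + \<epsilon> *\<^sub>R V x = P y + \<epsilon> *\<^sub>R V y" for x y
  proof (rule ccontr)
    assume ne: "V x \<noteq> V y"
    have "P y - P x = \<epsilon> *\<^sub>R (V x - V y)" using xy(3) by (simp add: algebra_simps)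
    then have "E (x, y) = \<epsilon>" using ne by (simp add: E_def)
    then show False using e(2) xy by (metis image_eqI mem_Sigma_iff)
  qed
  moreover have "0 < \<epsilon>" "\<epsilon> < d" using e(1) by auto
  ultimately show ?thesis using that by blast
qed

lemma countable_simple_zeros:
  fixes g :: "real \<Rightarrow> real"
  assumes "smooth g" "\<And>x. g x = 0 \<Longrightarrow> vderiv g x \<noteq> 0"
  shows "countable {x. g x = 0}"
proof -
  have "{x. g x = 0} = (\<Union>n. {x \<in> {- real n..real n}. g x = 0})"
  proof (intro set_eqI iffI)
    fix x assume "x \<in> {x. g x = 0}"
    moreover obtain n where "\<bar>x\<bar> \<le> real n" using real_arch_simple by blast
    ultimately have "x \<in> {x \<in> {- real n..real n}. g x = 0}" by auto
    then show "x \<in> (\<Union>n. {x \<in> {- real n..real n}. g x = 0})" by blast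
  qed auto
  moreover have "countable {x \<in> {- real n..real n}. g x = 0}" for n
    using finite_simple_zeros[OF assms] by (rule countable_finite)
  ultimately show ?thesis by simp
qed

text \<open>
  A displacement that translates the curve near every zero of an antiperiodic function \<open>f\<close>, to
  high order, by a vector that determines the zero modulo half a turn: the translation vector
  moves on a circle with a speed divisible by \<open>f\<close>.
\<close>

lemma separating_displacement:
  assumes sf: "smooth f" and simple: "\<And>\<theta>. f \<theta> = 0 \<Longrightarrow> vderiv f \<theta> \<noteq> 0" and anti: "\<And>\<theta>. f (\<theta> + pi) = - f \<theta>"
  obtains W p g V where "displacement W p" "smooth g" "\<And>\<theta>. p \<theta> = (f \<theta>)\<^sup>2 * g \<theta>" "\<And>\<theta>. g (\<theta> + pi) = - g \<theta>"
    "\<And>\<theta>. f \<theta> = 0 \<Longrightarrow> W \<theta> = V \<theta>" "\<And>\<theta>. f \<theta> = 0 \<Longrightarrow> W (\<theta> + pi) = V \<theta>"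
    "\<And>x y. V x = V y \<Longrightarrow> sin (x - y) = 0"
proof -
  have sf4: "smooth (\<lambda>\<theta>. f \<theta> ^ 4)" using sf by (rule smooth_power)
  obtain A where A: "\<And>\<theta>. (A has_real_derivative f \<theta> ^ 4) (at \<theta>)" "A 0 = 0"
    using antiderivative_exists[OF smooth_continuous[OF sf4]] by blast
  have mono: "A x \<le> A y" if "x \<le> y" for x y
    using that by (rule DERIV_nonneg_imp_nondecreasing) (use A(1) in \<open>force intro: zero_le_even_power\<close>)
  have strict: "A x < A y" if "x < y" for x y
  proof -
    have "infinite {x<..<y}" using that by (rule infinite_Ioo)
    then have "\<not> {x<..<y} \<subseteq> {t \<in> {x..y}. f t = 0}"
      using finite_simple_zeros[OF sf simple] finite_subset by blast
    then obtain m where "m \<in> {x<..<y}" "m \<notin> {t \<in> {x..y}. f t = 0}" by blast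
    then have m: "x < m" "m < y" "f m \<noteq> 0" by auto
    then have "0 < f m ^ 4" by (simp add: zero_less_power_eq)
    then obtain d where d: "0 < d" "\<And>h. 0 < h \<Longrightarrow> h < d \<Longrightarrow> A m < A (m + h)"
      using DERIV_pos_inc_right[OF A(1)] by blast
    let ?h = "min (d / 2) ((y - m) / 2)"
    have "A m < A (m + ?h)" using d m by (intro d(2)) auto
    moreover have "m + ?h \<le> y" using m(2) by (simp add: min_def field_simps)
    ultimately show ?thesis using mono[of x m] mono[of "m + ?h" y] m(1) by linarith
  qed
  define L where "L = A pi"
  have L: "0 < L" unfolding L_def using strict[of 0 pi] A(2) pi_gt_zero by simp
  have Api: "A (\<theta> + pi) = A \<theta> + L" for \<theta>
  proof -
    have "((\<lambda>x. A (x + pi) - A x) has_real_derivative f (x + pi) ^ 4 - f x ^ 4) (at x)" for x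
      by (intro DERIV_diff A) (use A(1)[of "x + pi"] in \<open>simp add: DERIV_shift\<close>)
    then have "((\<lambda>x. A (x + pi) - A x) has_real_derivative 0) (at x)" for x by (simp add: anti)
    then have "A (\<theta> + pi) - A \<theta> = A (0 + pi) - A 0"
      using DERIV_isconst_all[of "\<lambda>x. A (x + pi) - A x" \<theta> 0] by blast
    then show ?thesis by (simp add: L_def A(2))
  qed
  define B where "B \<theta> = 2 * pi * A \<theta> / L" for \<theta>
  have Bpi: "B (\<theta> + pi) = B \<theta> + 2 * pi" for \<theta>
    unfolding B_def Api using L by (simp add: field_simps)
  define b where "b = 2 * pi / L"
  have dB: "(B has_real_derivative b * f \<theta> ^ 4) (at \<theta>)" for \<theta>
    unfolding B_def[abs_def] b_def using DERIV_cmult[OF A(1), of "2 * pi / L" \<theta>] by (simp add: mult.commute)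
  have sB: "smooth B"
    using smooth_antideriv[OF smooth_mult[OF smooth_const sf4] dB] .
  define V where "V \<theta> = unit_dir (B \<theta>)" for \<theta>
  define U where "U \<theta> = b *\<^sub>R unit_dir (B \<theta> + pi / 2)" for \<theta>
  \<comment> \<open>The normal with \<open>N' = e\<close> and \<open>e' = - N\<close>. In \<open>W\<close> below, the translation \<open>V\<close> is corrected along
    \<open>e\<close> so that its derivative becomes a multiple of \<open>e\<close>.\<close>
  define N where "N \<theta> = unit_dir (\<theta> - pi / 2)" for \<theta>
  have sU: "smooth U" unfolding U_def[abs_def] by (intro smooth_vec_scaleR smooth_const smooth_unit_dir smooth_add sB)
  have sV: "smooth V" unfolding V_def[abs_def] by (intro smooth_unit_dir sB)
  have sN: "smooth N" unfolding N_def[abs_def] by (intro smooth_unit_dir smooth_diff smooth_ident smooth_const)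
  have se: "smooth unit_dir" using smooth_unit_dir[OF smooth_ident] by simp
  have dV: "(V has_vector_derivative f \<theta> ^ 4 *\<^sub>R U \<theta>) (at \<theta>)" for \<theta>
    unfolding V_def[abs_def] U_def using unit_dir_has_vector_derivative[OF dB] by (simp add: mult.commute)
  have dN: "(N has_vector_derivative unit_dir \<theta>) (at \<theta>)" for \<theta>
  proof -
    have "((\<lambda>x. x - pi / 2) has_real_derivative 1) (at \<theta>)" by (auto intro!: derivative_eq_intros)
    from unit_dir_has_vector_derivative[OF this] show ?thesis unfolding N_def[abs_def] by simp
  qed
  have de: "(unit_dir has_vector_derivative - N \<theta>) (at \<theta>)" for \<theta>
  proof -
    have "unit_dir (\<theta> + pi / 2) = - N \<theta>" by (simp add: N_def vec2_eq_iff cos_add sin_add cos_diff sin_diff)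
    then show ?thesis using unit_dir_has_vector_derivative[OF DERIV_ident, of \<theta>] by simp
  qed
  let ?f' = "vderiv f" and ?U' = "vderiv U"
  have df: "(f has_real_derivative ?f' \<theta>) (at \<theta>)" for \<theta> using sf by (rule smooth_has_real_derivative)
  have dU: "(U has_vector_derivative ?U' \<theta>) (at \<theta>)" for \<theta> using sU by (rule smooth_has_vderiv)
  define g where "g \<theta> = ((4 * f \<theta> * ?f' \<theta>) *\<^sub>R U \<theta> + (f \<theta>)\<^sup>2 *\<^sub>R ?U' \<theta>) \<bullet> N \<theta> + 2 * ((f \<theta>)\<^sup>2 * (U \<theta> \<bullet> unit_dir \<theta>))" for \<theta>
  define p where "p \<theta> = (f \<theta>)\<^sup>2 * g \<theta>" for \<theta>
  define W where "W \<theta> = V \<theta> + (f \<theta> ^ 4 * (U \<theta> \<bullet> N \<theta>)) *\<^sub>R unit_dir \<theta>" for \<theta>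
  have sg: "smooth g" unfolding g_def[abs_def]
    by (intro smooth_add smooth_mult smooth_inner smooth_vec_add smooth_vec_scaleR smooth_const smooth_power
        sf sU sN se smooth_vderiv)
  have sp: "smooth p" unfolding p_def[abs_def] by (intro smooth_mult smooth_power sf sg)
  have sW: "smooth W" unfolding W_def[abs_def]
    by (intro smooth_vec_add smooth_vec_scaleR smooth_mult smooth_power smooth_inner sf sU sN se sV)
  have antiN: "N (\<theta> + pi) = - N \<theta>" for \<theta>
    using unit_dir_pi[of "\<theta> - pi / 2"] by (simp add: N_def algebra_simps)
  have perU: "U (\<theta> + pi) = U \<theta>" for \<theta>
  proof -
    have "B \<theta> + 2 * pi + pi / 2 = B \<theta> + pi / 2 + 2 * pi" by simp
    then show ?thesis unfolding U_def Bpi by (metis unit_dir_2pi)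
  qed
  have perU': "?U' (\<theta> + pi) = ?U' \<theta>" for \<theta> using vderiv_periodic[OF sU perU] .
  have perV: "V (\<theta> + pi) = V \<theta>" for \<theta> unfolding V_def Bpi by simp
  have antif': "?f' (\<theta> + pi) = - ?f' \<theta>" for \<theta>
  proof -
    have "((\<lambda>x. f (x + pi)) has_real_derivative ?f' (\<theta> + pi)) (at \<theta>)"
      using df[of "\<theta> + pi"] by (simp add: DERIV_shift)
    moreover have "((\<lambda>x. f (x + pi)) has_real_derivative - ?f' \<theta>) (at \<theta>)"
      unfolding anti by (rule DERIV_minus[OF df])
    ultimately show ?thesis by (rule DERIV_unique)
  qed
  have gpi: "g (\<theta> + pi) = - g \<theta>" for \<theta>
    unfolding g_def anti antif' perU perU' antiN unit_dir_pi by simp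
  have ppi: "p (\<theta> + pi) = - p \<theta>" for \<theta> unfolding p_def anti gpi by simp
  have Wpi: "W (\<theta> + pi) = W \<theta>" for \<theta>
    unfolding W_def anti perU perV antiN unit_dir_pi by simp
  have dW: "(W has_vector_derivative p \<theta> *\<^sub>R unit_dir \<theta>) (at \<theta>)" for \<theta>
  proof -
    let ?u = "U \<theta> \<bullet> N \<theta>" and ?u' = "?U' \<theta> \<bullet> N \<theta> + U \<theta> \<bullet> unit_dir \<theta>"
    have f4: "((\<lambda>x. f x ^ 4) has_real_derivative 4 * f \<theta> ^ 3 * ?f' \<theta>) (at \<theta>)"
      by (rule DERIV_cong[OF DERIV_power[OF df]]) (simp add: algebra_simps)
    have "(W has_vector_derivative f \<theta> ^ 4 *\<^sub>R U \<theta> + ((f \<theta> ^ 4 * ?u) *\<^sub>R (- N \<theta>)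
        + (4 * f \<theta> ^ 3 * ?f' \<theta> * ?u + ?u' * f \<theta> ^ 4) *\<^sub>R unit_dir \<theta>)) (at \<theta>)"
      unfolding W_def[abs_def]
      by (intro has_vector_derivative_add has_vector_derivative_scaleR dV de DERIV_mult f4
          inner2_has_real_derivative dU dN)
    moreover have "f \<theta> ^ 4 *\<^sub>R U \<theta> + ((f \<theta> ^ 4 * ?u) *\<^sub>R (- N \<theta>)
        + (4 * f \<theta> ^ 3 * ?f' \<theta> * ?u + ?u' * f \<theta> ^ 4) *\<^sub>R unit_dir \<theta>) = p \<theta> *\<^sub>R unit_dir \<theta>"
    proof -
      have sc: "sin \<theta> * sin \<theta> + cos \<theta> * cos \<theta> = 1" using sin_cos_squared_add[of \<theta>] by (simp add: power2_eq_square)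
      have Nc: "N \<theta> $ 1 = sin \<theta>" "N \<theta> $ 2 = - cos \<theta>" by (simp_all add: N_def cos_diff sin_diff)
      have split: "U \<theta> = (U \<theta> \<bullet> unit_dir \<theta>) *\<^sub>R unit_dir \<theta> + ?u *\<^sub>R N \<theta>"
      proof -
        have "U \<theta> $ 1 = (U \<theta> $ 1 * cos \<theta> + U \<theta> $ 2 * sin \<theta>) * cos \<theta> + (U \<theta> $ 1 * sin \<theta> + U \<theta> $ 2 * - cos \<theta>) * sin \<theta>"
          "U \<theta> $ 2 = (U \<theta> $ 1 * cos \<theta> + U \<theta> $ 2 * sin \<theta>) * sin \<theta> + (U \<theta> $ 1 * sin \<theta> + U \<theta> $ 2 * - cos \<theta>) * - cos \<theta>"
          using sc by algebra+
        then show ?thesis unfolding vec2_eq_iff inner2_eq by (simp add: Nc)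
      qed
      have "f \<theta> ^ 4 *\<^sub>R U \<theta> + ((f \<theta> ^ 4 * ?u) *\<^sub>R (- N \<theta>)
        + (4 * f \<theta> ^ 3 * ?f' \<theta> * ?u + ?u' * f \<theta> ^ 4) *\<^sub>R unit_dir \<theta>)
        = (f \<theta> ^ 4 * (U \<theta> \<bullet> unit_dir \<theta>) + (4 * f \<theta> ^ 3 * ?f' \<theta> * ?u + ?u' * f \<theta> ^ 4)) *\<^sub>R unit_dir \<theta>"
        by (subst (1) split) (simp add: scaleR_add_left scaleR_add_right)
      also have "f \<theta> ^ 4 * (U \<theta> \<bullet> unit_dir \<theta>) + (4 * f \<theta> ^ 3 * ?f' \<theta> * ?u + ?u' * f \<theta> ^ 4) = p \<theta>"
        unfolding p_def g_def inner_add_left inner_scaleR_left by (simp add: algebra_simps power2_eq_square eval_nat_numeral)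
      finally show ?thesis .
    qed
    ultimately show ?thesis by simp
  qed
  have two_pi: "\<theta> + 2 * pi = \<theta> + pi + pi" for \<theta> by simp
  have "displacement W p"
    unfolding displacement_def two_pi Wpi ppi using sW sp dW by simp
  moreover have "sin (x - y) = 0" if "V x = V y" for x y
  proof -
    have "sin (B x) = sin (B y)" "cos (B x) = cos (B y)" using that by (auto simp: V_def vec2_eq_iff)
    then obtain k :: int where k: "B x = B y + 2 * pi * of_int k" using sin_cos_eq_iff by blast
    have "B (y + of_int k * pi) = B y + of_int k * (2 * pi)"
    proof -
      have "B (y + of_int k * pi) - 2 * (y + of_int k * pi) = B y - 2 * y"
        by (rule periodic_int_multiple[where f = "\<lambda>y. B y - 2 * y"]) (simp add: Bpi)
      then show ?thesis by (simp add: algebra_simps)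
    qed
    then have "B x = B (y + of_int k * pi)" using k by simp
    then have "A x = A (y + of_int k * pi)" using L by (simp add: B_def)
    then have "x = y + of_int k * pi"
      using strict[of x "y + of_int k * pi"] strict[of "y + of_int k * pi" x] by (cases x "y + of_int k * pi" rule: linorder_cases) auto
    then show ?thesis by (simp add: sin_times_pi_eq_0)
  qed
  ultimately show ?thesis
    using that[of W p g V] sg gpi Wpi by (simp add: p_def W_def)
qed

lemma antiperiodic_bounded:
  fixes h :: "real \<Rightarrow> real"
  assumes "smooth h" "\<And>\<theta>. \<bar>h (\<theta> + pi)\<bar> = \<bar>h \<theta>\<bar>"
  obtains M where "0 < M" "\<And>\<theta>. \<bar>h \<theta>\<bar> \<le> M"
proof (rule periodic_bounded[where f = "\<lambda>\<theta>. \<bar>h \<theta>\<bar>", OF pi_gt_zero assms(2)])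
  show "continuous_on UNIV (\<lambda>\<theta>. \<bar>h \<theta>\<bar>)"
    using smooth_continuous[OF assms(1)] by (rule continuous_on_rabs)
  fix M assume M: "0 < M" "\<And>\<theta>. norm \<bar>h \<theta>\<bar> \<le> M"
  have "\<bar>h \<theta>\<bar> \<le> M" for \<theta> using M(2)[of \<theta>] by simp
  with M(1) show thesis by (rule that)
qed

text \<open>
  The Wigner caustic and the centre symmetry set are both covered: \<open>\<omega>\<close> is the function whose zeros
  are the cusps, with \<open>\<omega> \<rho> = f\<close>, and \<open>F\<close> is the front. A displacement divisible by \<open>f\<^sup>2\<close>
  multiplies \<open>\<omega>\<close> by a factor close to \<open>1\<close>, so that the cusps keep their angles, and it translates them.
\<close>

lemma separated_on_zeros_dense:
  assumes af: "angle_form \<Gamma> \<rho>" and ac: "angle_change \<phi>" and "0 < e"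
    and sf: "smooth f" and simple: "\<And>\<theta>. f \<theta> = 0 \<Longrightarrow> vderiv f \<theta> \<noteq> 0" and anti: "\<And>\<theta>. f (\<theta> + pi) = - f \<theta>"
    and \<omega>: "\<And>p g \<epsilon>. smooth g \<Longrightarrow> (\<And>\<theta>. p \<theta> = (f \<theta>)\<^sup>2 * g \<theta>) \<Longrightarrow> (\<And>\<theta>. g (\<theta> + pi) = - g \<theta>) \<Longrightarrow>
      \<exists>h. smooth h \<and> (\<forall>\<theta>. \<bar>h (\<theta> + pi)\<bar> = \<bar>h \<theta>\<bar>) \<and>
        (\<forall>\<epsilon> \<theta>. \<omega> (\<lambda>\<theta>. \<rho> \<theta> + \<epsilon> * p \<theta>) \<theta> = f \<theta> * (1 + \<epsilon> * h \<theta>))"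
    and F: "\<And>W p \<epsilon> \<theta> v. p \<theta> = 0 \<Longrightarrow> p (\<theta> + pi) = 0 \<Longrightarrow> W \<theta> = v \<Longrightarrow> W (\<theta> + pi) = v \<Longrightarrow>
      F (\<lambda>\<theta>. \<Gamma> \<theta> + \<epsilon> *\<^sub>R W \<theta>) (\<lambda>\<theta>. \<rho> \<theta> + \<epsilon> * p \<theta>) \<theta> = F \<Gamma> \<rho> \<theta> + \<epsilon> *\<^sub>R v"
  obtains \<Gamma>' \<rho>' where "angle_form \<Gamma>' \<rho>'" "separated_on_zeros (\<omega> \<rho>') (F \<Gamma>' \<rho>')"
    "(\<lambda>t. \<Gamma>' (\<phi> t)) \<in> Ck_ball (\<lambda>t. \<Gamma> (\<phi> t)) n e"
proof -
  obtain W p g V where W: "displacement W p" "smooth g" "\<And>\<theta>. p \<theta> = (f \<theta>)\<^sup>2 * g \<theta>" "\<And>\<theta>. g (\<theta> + pi) = - g \<theta>"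
    "\<And>\<theta>. f \<theta> = 0 \<Longrightarrow> W \<theta> = V \<theta>" "\<And>\<theta>. f \<theta> = 0 \<Longrightarrow> W (\<theta> + pi) = V \<theta>"
    "\<And>x y. V x = V y \<Longrightarrow> sin (x - y) = 0"
    by (rule separating_displacement[OF sf simple anti]) blast+
  obtain h where h: "smooth h" "\<And>\<theta>. \<bar>h (\<theta> + pi)\<bar> = \<bar>h \<theta>\<bar>"
    "\<And>\<epsilon> \<theta>. \<omega> (\<lambda>\<theta>. \<rho> \<theta> + \<epsilon> * p \<theta>) \<theta> = f \<theta> * (1 + \<epsilon> * h \<theta>)"
    using \<omega>[OF W(2,3,4)] by blast
  obtain M where M: "0 < M" "\<And>\<theta>. \<bar>h \<theta>\<bar> \<le> M" by (rule antiperiodic_bounded[OF h(1,2)]) blast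
  obtain d where d: "0 < d"
    "\<And>x y. \<bar>x\<bar> < d \<Longrightarrow> \<bar>y\<bar> < d \<Longrightarrow> angle_form (\<lambda>\<theta>. \<Gamma> \<theta> + x *\<^sub>R W \<theta> + y *\<^sub>R W \<theta>) (\<lambda>\<theta>. \<rho> \<theta> + x * p \<theta> + y * p \<theta>)"
    "\<And>x y. \<bar>x\<bar> < d \<Longrightarrow> \<bar>y\<bar> < d \<Longrightarrow> (\<lambda>t. \<Gamma> (\<phi> t) + x *\<^sub>R W (\<phi> t) + y *\<^sub>R W (\<phi> t)) \<in> Ck_ball (\<lambda>t. \<Gamma> (\<phi> t)) n e"
    by (rule angle_form_perturbation[OF af ac \<open>0 < e\<close> W(1) W(1), of n]) blast
  have dM: "0 < min d (1 / M)" using d(1) M(1) by simp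
  obtain \<epsilon> where eps: "0 < \<epsilon>" "\<epsilon> < min d (1 / M)"
    "\<And>x y. x \<in> {x. f x = 0} \<Longrightarrow> y \<in> {x. f x = 0} \<Longrightarrow> F \<Gamma> \<rho> x + \<epsilon> *\<^sub>R V x = F \<Gamma> \<rho> y + \<epsilon> *\<^sub>R V y \<Longrightarrow> V x = V y"
    by (rule avoid_countably_many_coincidences[where P = "F \<Gamma> \<rho>" and V = V, OF countable_simple_zeros[OF sf simple] dM]) blast+
  let ?G = "\<lambda>\<theta>. \<Gamma> \<theta> + \<epsilon> *\<^sub>R W \<theta>" and ?r = "\<lambda>\<theta>. \<rho> \<theta> + \<epsilon> * p \<theta>"
  have "\<epsilon> * M < 1" using eps(2) M(1) by (simp add: field_simps)
  have zeros: "\<omega> ?r \<theta> = 0 \<longleftrightarrow> f \<theta> = 0" for \<theta>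
  proof -
    have "\<bar>\<epsilon> * h \<theta>\<bar> \<le> \<epsilon> * M" using M(2)[of \<theta>] eps(1) by (simp add: abs_mult)
    then have "1 + \<epsilon> * h \<theta> \<noteq> 0" using \<open>\<epsilon> * M < 1\<close> by linarith
    then show ?thesis unfolding h(3) by simp
  qed
  have front: "F ?G ?r \<theta> = F \<Gamma> \<rho> \<theta> + \<epsilon> *\<^sub>R V \<theta>" if "f \<theta> = 0" for \<theta>
    by (rule F) (use that W(3,5,6) anti in simp_all)
  have "separated_on_zeros (\<omega> ?r) (F ?G ?r)"
    unfolding separated_on_zeros_def zeros using front eps(3) W(7) by auto
  moreover have "angle_form ?G ?r" "(\<lambda>t. ?G (\<phi> t)) \<in> Ck_ball (\<lambda>t. \<Gamma> (\<phi> t)) n e"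
    using d(1) d(2,3)[of \<epsilon> 0] eps(1,2) by simp_all
  ultimately show ?thesis using that by blast
qed

lemma caustic_separation_dense:
  assumes af: "angle_form \<Gamma> \<rho>" and ac: "angle_change \<phi>" and "0 < e" and gaps: "simple_gaps \<rho>"
  obtains \<Gamma>' \<rho>' where "angle_form \<Gamma>' \<rho>'" "separated_on_zeros (radius_gap \<rho>') (mid_chord \<Gamma>')"
    "(\<lambda>t. \<Gamma>' (\<phi> t)) \<in> Ck_ball (\<lambda>t. \<Gamma> (\<phi> t)) n e"
proof (rule separated_on_zeros_dense[OF af ac \<open>0 < e\<close> smooth_radius(1)[OF af] _ radius_antiperiodic(1)[OF af],
      where \<omega> = radius_gap and F = "\<lambda>\<Gamma> \<rho>. mid_chord \<Gamma>" and n = n])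
  have "vderiv (radius_gap \<rho>) = (\<lambda>\<theta>. vderiv \<rho> \<theta> - vderiv \<rho> (\<theta> + pi))"
    by (rule vderiv_real_eqI[OF radius_derivs(1)[OF af]])
  then show "vderiv (radius_gap \<rho>) \<theta> \<noteq> 0" if "radius_gap \<rho> \<theta> = 0" for \<theta>
    using gaps that by (simp add: simple_gaps_def)
next
  fix p g :: "real \<Rightarrow> real"
  assume g: "smooth g" "\<And>\<theta>. p \<theta> = (radius_gap \<rho> \<theta>)\<^sup>2 * g \<theta>" "\<And>\<theta>. g (\<theta> + pi) = - g \<theta>"
  have ppi: "p (\<theta> + pi) = - p \<theta>" for \<theta> by (simp add: g(2,3) radius_antiperiodic(1)[OF af])
  show "\<exists>h. smooth h \<and> (\<forall>\<theta>. \<bar>h (\<theta> + pi)\<bar> = \<bar>h \<theta>\<bar>) \<and>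
        (\<forall>\<epsilon> \<theta>. radius_gap (\<lambda>\<theta>. \<rho> \<theta> + \<epsilon> * p \<theta>) \<theta> = radius_gap \<rho> \<theta> * (1 + \<epsilon> * h \<theta>))"
  proof (intro exI[of _ "\<lambda>\<theta>. 2 * (radius_gap \<rho> \<theta> * g \<theta>)"] conjI allI)
    show "smooth (\<lambda>\<theta>. 2 * (radius_gap \<rho> \<theta> * g \<theta>))" by (intro smooth_mult smooth_const smooth_radius(1)[OF af] g(1))
    show "\<bar>2 * (radius_gap \<rho> (\<theta> + pi) * g (\<theta> + pi))\<bar> = \<bar>2 * (radius_gap \<rho> \<theta> * g \<theta>)\<bar>" for \<theta>
      by (simp add: g(3) radius_antiperiodic(1)[OF af])
    fix \<epsilon> \<theta>
    have "radius_gap (\<lambda>\<theta>. \<rho> \<theta> + \<epsilon> * p \<theta>) \<theta> = radius_gap \<rho> \<theta> + 2 * \<epsilon> * p \<theta>"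
      unfolding radius_gap_def ppi by simp
    then show "radius_gap (\<lambda>\<theta>. \<rho> \<theta> + \<epsilon> * p \<theta>) \<theta> = radius_gap \<rho> \<theta> * (1 + \<epsilon> * (2 * (radius_gap \<rho> \<theta> * g \<theta>)))"
      unfolding g(2) by (simp add: power2_eq_square algebra_simps)
  qed
next
  fix W :: "real \<Rightarrow> real^2" and p :: "real \<Rightarrow> real" and \<epsilon> \<theta> v
  assume "W \<theta> = v" "W (\<theta> + pi) = v"
  then show "mid_chord (\<lambda>\<theta>. \<Gamma> \<theta> + \<epsilon> *\<^sub>R W \<theta>) \<theta> = mid_chord \<Gamma> \<theta> + \<epsilon> *\<^sub>R v"
    by (simp add: mid_chord_def vec2_eq_iff algebra_simps)
qed (rule that)

lemma contact_separation_dense: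
  assumes af: "angle_form \<Gamma> \<rho>" and ac: "angle_change \<phi>" and "0 < e" and wr: "simple_wronskian \<rho>"
  obtains \<Gamma>' \<rho>' where "angle_form \<Gamma>' \<rho>'" "separated_on_zeros (radius_wronskian \<rho>') (chord_contact \<Gamma>' \<rho>')"
    "(\<lambda>t. \<Gamma>' (\<phi> t)) \<in> Ck_ball (\<lambda>t. \<Gamma> (\<phi> t)) n e"
proof (rule separated_on_zeros_dense[OF af ac \<open>0 < e\<close> smooth_radius(3)[OF af] _ radius_antiperiodic(3)[OF af],
      where \<omega> = radius_wronskian and F = chord_contact and n = n])
  have "vderiv (radius_wronskian \<rho>) = (\<lambda>\<theta>. vderiv (vderiv \<rho>) \<theta> * \<rho> (\<theta> + pi) - \<rho> \<theta> * vderiv (vderiv \<rho>) (\<theta> + pi))"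
    by (rule vderiv_real_eqI[OF radius_derivs(3)[OF af]])
  then show "vderiv (radius_wronskian \<rho>) \<theta> \<noteq> 0" if "radius_wronskian \<rho> \<theta> = 0" for \<theta>
    using wr that by (simp add: simple_wronskian_def)
next
  let ?w = "radius_wronskian \<rho>" and ?S = "radius_sum \<rho>" and ?S' = "\<lambda>\<theta>. vderiv \<rho> \<theta> + vderiv \<rho> (\<theta> + pi)"
  fix p g :: "real \<Rightarrow> real"
  assume g: "smooth g" "\<And>\<theta>. p \<theta> = (?w \<theta>)\<^sup>2 * g \<theta>" "\<And>\<theta>. g (\<theta> + pi) = - g \<theta>"
  have sw: "smooth ?w" and sS: "smooth ?S" and sr: "smooth \<rho>"
    using smooth_radius[OF af] angle_formD(2)[OF af] by blast+
  let ?w' = "vderiv ?w" and ?g' = "vderiv g"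
  define q where "q \<theta> = 2 * ?w' \<theta> * g \<theta> + ?w \<theta> * ?g' \<theta>" for \<theta>
  have deriv_anti: "vderiv k (\<theta> + pi) = - vderiv k \<theta>" if k: "smooth k" "\<And>\<theta>. k (\<theta> + pi) = - k \<theta>" for k :: "real \<Rightarrow> real" and \<theta>
  proof -
    have "((\<lambda>x. k (x + pi)) has_real_derivative vderiv k (\<theta> + pi)) (at \<theta>)"
      using smooth_has_real_derivative[OF k(1), of "\<theta> + pi"] by (simp add: DERIV_shift)
    moreover have "((\<lambda>x. k (x + pi)) has_real_derivative - vderiv k \<theta>) (at \<theta>)"
      unfolding k(2) by (rule DERIV_minus[OF smooth_has_real_derivative[OF k(1)]])
    ultimately show ?thesis by (rule DERIV_unique)
  qed
  have wpi: "?w (\<theta> + pi) = - ?w \<theta>" and w'pi: "?w' (\<theta> + pi) = - ?w' \<theta>" and g'pi: "?g' (\<theta> + pi) = - ?g' \<theta>" for \<theta>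
    using radius_antiperiodic(3)[OF af] deriv_anti[OF sw] deriv_anti[OF g(1,3)] by blast+
  have ppi: "p (\<theta> + pi) = - p \<theta>" for \<theta> by (simp add: g(2,3) wpi)
  have qpi: "q (\<theta> + pi) = q \<theta>" for \<theta> by (simp add: q_def wpi w'pi g'pi g(3))
  have peq: "p = (\<lambda>\<theta>. (?w \<theta>)\<^sup>2 * g \<theta>)" using g(2) by (rule ext)
  have sp: "smooth p" unfolding peq by (intro smooth_mult smooth_power sw g(1))
  have dp: "(p has_real_derivative ?w \<theta> * q \<theta>) (at \<theta>)" for \<theta>
    unfolding peq
    by (rule DERIV_cong[OF DERIV_mult[OF DERIV_power[OF smooth_has_real_derivative[OF sw]] smooth_has_real_derivative[OF g(1)]]])
      (simp add: q_def power2_eq_square algebra_simps)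
  have p': "vderiv p = (\<lambda>\<theta>. ?w \<theta> * q \<theta>)" by (rule vderiv_real_eqI[OF dp])
  define h where "h \<theta> = q \<theta> * ?S \<theta> - ?w \<theta> * g \<theta> * ?S' \<theta>" for \<theta>
  have sS': "smooth ?S'" by (intro smooth_add smooth_vderiv sr smooth_shift[OF smooth_vderiv[OF sr]])
  have "smooth h"
    unfolding h_def[abs_def] q_def
    by (intro smooth_diff smooth_mult smooth_add smooth_const sw g(1) sS sS' smooth_vderiv)
  moreover have "\<bar>h (\<theta> + pi)\<bar> = \<bar>h \<theta>\<bar>" for \<theta>
    unfolding h_def qpi wpi g(3) radius_antiperiodic(2)[OF af] angle_form_shift_pi(5)[OF af] by (simp add: add.commute)
  moreover have "radius_wronskian (\<lambda>\<theta>. \<rho> \<theta> + \<epsilon> * p \<theta>) \<theta> = ?w \<theta> * (1 + \<epsilon> * h \<theta>)" for \<epsilon> \<theta>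
  proof -
    have v: "vderiv (\<lambda>\<theta>. \<rho> \<theta> + \<epsilon> * p \<theta>) = (\<lambda>\<theta>. vderiv \<rho> \<theta> + \<epsilon> * (?w \<theta> * q \<theta>))"
      by (intro vderiv_real_eqI DERIV_add DERIV_cmult dp smooth_has_real_derivative sr)
    have "radius_wronskian (\<lambda>\<theta>. \<rho> \<theta> + \<epsilon> * p \<theta>) \<theta> =
        (vderiv \<rho> \<theta> + \<epsilon> * (?w \<theta> * q \<theta>)) * (\<rho> (\<theta> + pi) - \<epsilon> * p \<theta>)
        - (\<rho> \<theta> + \<epsilon> * p \<theta>) * (vderiv \<rho> (\<theta> + pi) - \<epsilon> * (?w \<theta> * q \<theta>))"
      unfolding radius_wronskian_def[of "\<lambda>\<theta>. \<rho> \<theta> + \<epsilon> * p \<theta>"] v ppi wpi qpi by simp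
    also have "\<dots> = ?w \<theta> + \<epsilon> * (?w \<theta> * q \<theta> * ?S \<theta> - p \<theta> * ?S' \<theta>)"
      unfolding radius_wronskian_def[of \<rho> \<theta>] radius_sum_def by algebra
    also have "\<dots> = ?w \<theta> * (1 + \<epsilon> * h \<theta>)"
      unfolding g(2) h_def by (simp add: algebra_simps power2_eq_square)
    finally show ?thesis .
  qed
  ultimately show "\<exists>h. smooth h \<and> (\<forall>\<theta>. \<bar>h (\<theta> + pi)\<bar> = \<bar>h \<theta>\<bar>) \<and>
        (\<forall>\<epsilon> \<theta>. radius_wronskian (\<lambda>\<theta>. \<rho> \<theta> + \<epsilon> * p \<theta>) \<theta> = ?w \<theta> * (1 + \<epsilon> * h \<theta>))" by blast
next
  fix W :: "real \<Rightarrow> real^2" and p :: "real \<Rightarrow> real" and \<epsilon> \<theta> v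
  assume "p \<theta> = 0" "p (\<theta> + pi) = 0" "W \<theta> = v" "W (\<theta> + pi) = v"
  then show "chord_contact (\<lambda>\<theta>. \<Gamma> \<theta> + \<epsilon> *\<^sub>R W \<theta>) (\<lambda>\<theta>. \<rho> \<theta> + \<epsilon> * p \<theta>) \<theta> = chord_contact \<Gamma> \<rho> \<theta> + \<epsilon> *\<^sub>R v"
    by (simp add: chord_contact_def radius_sum_def)
qed (rule that)

section \<open>The number of cusps of a generic convex curve\<close>

lemma angle_form_in_avoiding:
  assumes "angle_form \<Gamma> \<rho>" "angle_change \<phi>" "\<forall>p\<in>parameter_cube. \<not> bad (\<lambda>t. \<Gamma> (\<phi> t)) p"
  shows "(\<lambda>t. \<Gamma> (\<phi> t)) \<in> avoiding bad"
  unfolding avoiding_def using assms convex_curve_of_angle_form[OF assms(1,2)] jets_of_angle_form(1)[OF assms(1,2)] by blast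

text \<open>
  The perturbations are carried out one after the other, since the later ones start
  from curves with simple zeros.
\<close>

lemma avoiding_dense:
  assumes "convex_curve \<gamma>" "0 < e"
  shows "\<exists>\<eta>\<in>avoiding double_gap. \<eta> \<in> Ck_ball \<gamma> n e"
    "\<exists>\<eta>\<in>avoiding double_wronskian. \<eta> \<in> Ck_ball \<gamma> n e"
    "\<exists>\<eta>\<in>avoiding (caustic_coincidence m). \<eta> \<in> Ck_ball \<gamma> n e"
    "\<exists>\<eta>\<in>avoiding (contact_coincidence m). \<eta> \<in> Ck_ball \<gamma> n e"
proof -
  have e4: "0 < e / 4" using assms(2) by simp
  obtain \<Gamma> \<rho> \<phi> where f0: "angle_form \<Gamma> \<rho>" "angle_change \<phi>" "(\<lambda>t. \<Gamma> (\<phi> t)) \<in> Ck_ball \<gamma> n (e / 4)"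
    using has_angle_form_dense[OF assms(1) e4] unfolding has_angle_form_def by metis
  obtain \<Gamma>1 \<rho>1 where f1: "angle_form \<Gamma>1 \<rho>1" "simple_gaps \<rho>1" "(\<lambda>t. \<Gamma>1 (\<phi> t)) \<in> Ck_ball (\<lambda>t. \<Gamma> (\<phi> t)) n (e / 4)"
    by (rule simple_gaps_dense[OF f0(1,2) e4])
  have b1: "(\<lambda>t. \<Gamma>1 (\<phi> t)) \<in> Ck_ball \<gamma> n (2 * e / 4)" by (rule Ck_ball_trans[OF f0(3) f1(3)]) simp
  obtain \<Gamma>2 \<rho>2 where f2: "angle_form \<Gamma>2 \<rho>2" "simple_wronskian \<rho>2" "(\<lambda>t. \<Gamma>2 (\<phi> t)) \<in> Ck_ball (\<lambda>t. \<Gamma>1 (\<phi> t)) n (e / 4)"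
    by (rule simple_wronskian_dense[OF f1(1) f0(2) e4 f1(2)])
  have b2: "(\<lambda>t. \<Gamma>2 (\<phi> t)) \<in> Ck_ball \<gamma> n (3 * e / 4)" by (rule Ck_ball_trans[OF b1 f2(3)]) simp
  obtain \<Gamma>3 \<rho>3 where f3: "angle_form \<Gamma>3 \<rho>3" "separated_on_zeros (radius_gap \<rho>3) (mid_chord \<Gamma>3)"
    "(\<lambda>t. \<Gamma>3 (\<phi> t)) \<in> Ck_ball (\<lambda>t. \<Gamma>1 (\<phi> t)) n (e / 4)"
    by (rule caustic_separation_dense[OF f1(1) f0(2) e4 f1(2)])
  obtain \<Gamma>4 \<rho>4 where f4: "angle_form \<Gamma>4 \<rho>4" "separated_on_zeros (radius_wronskian \<rho>4) (chord_contact \<Gamma>4 \<rho>4)"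
    "(\<lambda>t. \<Gamma>4 (\<phi> t)) \<in> Ck_ball (\<lambda>t. \<Gamma>2 (\<phi> t)) n (e / 4)"
    by (rule contact_separation_dense[OF f2(1) f0(2) e4 f2(2)])
  have "(\<lambda>t. \<Gamma>1 (\<phi> t)) \<in> avoiding double_gap"
    using f1(2) by (intro angle_form_in_avoiding[OF f1(1) f0(2)]) (simp only: avoid_double_gap[OF f1(1) f0(2)])
  moreover have "(\<lambda>t. \<Gamma>1 (\<phi> t)) \<in> Ck_ball \<gamma> n e" by (rule Ck_ball_trans[OF f0(3) f1(3)]) (use assms(2) in simp)
  ultimately show "\<exists>\<eta>\<in>avoiding double_gap. \<eta> \<in> Ck_ball \<gamma> n e" by blast
  have "(\<lambda>t. \<Gamma>2 (\<phi> t)) \<in> avoiding double_wronskian"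
    using f2(2) by (intro angle_form_in_avoiding[OF f2(1) f0(2)]) (simp only: avoid_double_wronskian[OF f2(1) f0(2)])
  moreover have "(\<lambda>t. \<Gamma>2 (\<phi> t)) \<in> Ck_ball \<gamma> n e" by (rule Ck_ball_trans[OF b1 f2(3)]) (use assms(2) in simp)
  ultimately show "\<exists>\<eta>\<in>avoiding double_wronskian. \<eta> \<in> Ck_ball \<gamma> n e" by blast
  have "(\<lambda>t. \<Gamma>3 (\<phi> t)) \<in> avoiding (caustic_coincidence m)"
    by (rule angle_form_in_avoiding[OF f3(1) f0(2)])
      (use f3(2)[folded avoid_caustic_coincidence[OF f3(1) f0(2)]] in blast)
  moreover have "(\<lambda>t. \<Gamma>3 (\<phi> t)) \<in> Ck_ball \<gamma> n e" by (rule Ck_ball_trans[OF b1 f3(3)]) (use assms(2) in simp)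
  ultimately show "\<exists>\<eta>\<in>avoiding (caustic_coincidence m). \<eta> \<in> Ck_ball \<gamma> n e" by blast
  have "(\<lambda>t. \<Gamma>4 (\<phi> t)) \<in> avoiding (contact_coincidence m)"
    by (rule angle_form_in_avoiding[OF f4(1) f0(2)])
      (use f4(2)[folded avoid_contact_coincidence[OF f4(1) f0(2)]] in blast)
  moreover have "(\<lambda>t. \<Gamma>4 (\<phi> t)) \<in> Ck_ball \<gamma> n e" by (rule Ck_ball_trans[OF b2 f4(3)]) (use assms(2) in simp)
  ultimately show "\<exists>\<eta>\<in>avoiding (contact_coincidence m). \<eta> \<in> Ck_ball \<gamma> n e" by blast
qed

theorem theorem7p2:
  shows "\<exists>R. residual_in convex_curves R \<and>
    (\<forall>\<gamma>\<in>R.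
       (finite (cusps (wigner_caustic \<gamma>)) \<and> odd (card (cusps (wigner_caustic \<gamma>))) \<and>
          3 \<le> card (cusps (wigner_caustic \<gamma>))) \<and>
       (finite (cusps (centre_symmetry_set \<gamma>)) \<and> odd (card (cusps (centre_symmetry_set \<gamma>))) \<and>
          3 \<le> card (cusps (centre_symmetry_set \<gamma>))) \<and>
       card (cusps (wigner_caustic \<gamma>)) \<le> card (cusps (centre_symmetry_set \<gamma>)))"
proof -
  define \<B> where "\<B> = {double_gap, double_wronskian} \<union> (range caustic_coincidence \<union> range contact_coincidence)"
  let ?R = "{\<gamma>. convex_curve \<gamma>} \<inter> \<Inter>(avoiding ` \<B>)"
  have "residual_in convex_curves ?R"
  proof (rule residual_in_convex_curvesI)
    show "countable (avoiding ` \<B>)" unfolding \<B>_def by simp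
    fix U assume "U \<in> avoiding ` \<B>"
    then obtain bad where bad: "bad \<in> \<B>" "U = avoiding bad" by blast
    show "U \<subseteq> {\<gamma>. convex_curve \<gamma>}" unfolding bad(2) avoiding_def by blast
    have "closed_violation bad" using bad(1) closed_violations unfolding \<B>_def by blast
    then show "\<exists>n e. 0 < e \<and> Ck_ball \<gamma> n e \<inter> {\<gamma>. convex_curve \<gamma>} \<subseteq> U" if "\<gamma> \<in> U" for \<gamma>
      using that avoiding_open unfolding bad(2) by blast
    show "\<exists>\<eta>\<in>U. \<eta> \<in> Ck_ball \<gamma> n e" if "convex_curve \<gamma>" "0 < e" for \<gamma> n e
      using bad(1) avoiding_dense[OF that] unfolding bad(2) \<B>_def by blast
  qed
  moreover have "(finite (cusps (wigner_caustic \<gamma>)) \<and> odd (card (cusps (wigner_caustic \<gamma>))) \<and>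
          3 \<le> card (cusps (wigner_caustic \<gamma>))) \<and>
       (finite (cusps (centre_symmetry_set \<gamma>)) \<and> odd (card (cusps (centre_symmetry_set \<gamma>))) \<and>
          3 \<le> card (cusps (centre_symmetry_set \<gamma>))) \<and>
       card (cusps (wigner_caustic \<gamma>)) \<le> card (cusps (centre_symmetry_set \<gamma>))" if "\<gamma> \<in> ?R" for \<gamma>
  proof -
    have av: "\<gamma> \<in> avoiding bad" if "bad \<in> \<B>" for bad using \<open>\<gamma> \<in> ?R\<close> that by blast
    have "convex_curve \<gamma>" "\<And>t. curv \<gamma> t \<noteq> 0"
      using av[of double_gap] unfolding avoiding_def \<B>_def by blast+
    then obtain \<Gamma> \<rho> \<phi> where af: "angle_form \<Gamma> \<rho>" and ac: "angle_change \<phi>" and \<gamma>: "\<gamma> = (\<lambda>t. \<Gamma> (\<phi> t))"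
      using convex_curve_has_angle_form unfolding has_angle_form_def by blast
    have avoid: "\<forall>p\<in>parameter_cube. \<not> bad (\<lambda>t. \<Gamma> (\<phi> t)) p" if "bad \<in> \<B>" for bad
      using av[OF that] unfolding avoiding_def \<gamma> by blast
    have "simple_gaps \<rho>"
      unfolding avoid_double_gap[OF af ac, symmetric] by (rule avoid) (simp add: \<B>_def)
    moreover have "simple_wronskian \<rho>"
      unfolding avoid_double_wronskian[OF af ac, symmetric] by (rule avoid) (simp add: \<B>_def)
    moreover have "separated_on_zeros (radius_gap \<rho>) (mid_chord \<Gamma>)"
      unfolding avoid_caustic_coincidence[OF af ac, symmetric] by (intro allI avoid) (simp add: \<B>_def)
    moreover have "separated_on_zeros (radius_wronskian \<rho>) (chord_contact \<Gamma> \<rho>)"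
      unfolding avoid_contact_coincidence[OF af ac, symmetric] by (intro allI avoid) (simp add: \<B>_def)
    ultimately show ?thesis
      unfolding \<gamma> by (rule cusp_numbers_of_angle_form[OF af ac])
  qed
  ultimately show ?thesis by blast
qed

end
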